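(* For $\gamma\in(0,1]$ call a pair $(R,M)$ $\gamma$-admissible if $R\ge1$, $\sqrt R\in\mathbb{N}$, $M$ is a positive integer dividing $R$, and $\frac12R^{1-\gamma}\le M\le 2R^{1-\gamma}$. Assume there is $\gamma_0>0$ such that for every $\gamma\in(0,\gamma_0)$ and every $\epsilon>0$ there is a constant $C_{\epsilon,\gamma}$ with $$\|EF\|_{L^3(B_R)}^3\le C_{\epsilon,\gamma} R^\epsilon \Big(\frac{R}{M}\Big)^{\frac12}\sum_{j=1}^{R/M}\|E_{P_j}F\|_{L^3(w_{B_R})}^3$$ for all $\gamma$-admissible $(R,M)$, all balls $B_R\subset\mathbb{R}^3$ of radius $R$, all integrable $F:[0,1]^2\to\mathbb{C}$ and all partitions of $\mathcal{Q}_R$ into $M$-sets $P_1,\ldots,P_{R/M}$. Then the Restriction conjecture for the paraboloid holds: for every $\epsilon>0$ there is $C'_\epsilon$ such that $$\int_{B_{\sqrt{R}}}|EF|^3\le C'_\epsilon R^\epsilon\|F\|_\infty^3$$ for all $R\ge1$, all balls $B_{\sqrt R}\subset\mathbb{R}^3$ of radius $\sqrt R$ and all bounded measurable $F:[0,1]^2\to\mathbb{C}$.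
   Context: Write $e(t)=e^{2\pi i t}$. For measurable $S\subset[0,1]^2$, integrable $F$ and $x\in\mathbb{R}^3$, $E_SF(x)=\int_SF(\xi)e((\xi,|\xi|^2)\cdot x)\,d\xi$, and $EF=E_{[0,1]^2}F$. $\mathcal{Q}_R$ is the collection of the $R$ squares $[\frac{j}{\sqrt R},\frac{j+1}{\sqrt R}]\times[\frac{i}{\sqrt R},\frac{i+1}{\sqrt R}]\subset[0,1]^2$. An $M$-set is a union of $M$ distinct squares of $\mathcal{Q}_R$ (identified with the collection of these squares). For a ball $B_R$ with center $c$ and radius $R$, $w_{B_R}(x)=(1+|x-c|/R)^{-100}$ is a rapidly decaying approximation of $1_{B_R}$, and $\|f\|_{L^p(w_{B_R})}=(\int|f|^pw_{B_R})^{1/p}$. *)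

theory Defs
  imports "HOL-Analysis.Analysis" "HOL-Probability.Essential_Supremum"
begin

definition unit_square :: "(real ^ 2) set" where
  "unit_square = cbox (vector [0, 0]) (vector [1, 1])"

definition e :: "real \<Rightarrow> complex" where
  "e t = exp (2 * of_real pi * \<i> * of_real t)"

definition paraboloid_point :: "real ^ 2 \<Rightarrow> real ^ 3" where
  "paraboloid_point \<xi> = vector [\<xi> $ 1, \<xi> $ 2, (norm \<xi>)\<^sup>2]"

text \<open>The extension operator; \<open>S\<close> is meant to be a Lebesgue measurable subset of
  \<^const>\<open>unit_square\<close>. Functions on the unit square are total functions of which
  only the values on \<^const>\<open>unit_square\<close> matter.\<close>

definition extension_on :: "(real ^ 2) set \<Rightarrow> (real ^ 2 \<Rightarrow> complex) \<Rightarrow> real ^ 3 \<Rightarrow> complex" where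
  "extension_on S F x = (LINT \<xi>|lebesgue_on S. F \<xi> * e (paraboloid_point \<xi> \<bullet> x))"

abbreviation extension :: "(real ^ 2 \<Rightarrow> complex) \<Rightarrow> real ^ 3 \<Rightarrow> complex" where
  "extension \<equiv> extension_on unit_square"

definition grid_square :: "nat \<Rightarrow> nat \<Rightarrow> nat \<Rightarrow> (real ^ 2) set" where
  "grid_square R j i =
     cbox (vector [real j / sqrt (real R), real i / sqrt (real R)])
          (vector [(real j + 1) / sqrt (real R), (real i + 1) / sqrt (real R)])"

definition grid :: "nat \<Rightarrow> (real ^ 2) set set" where
  "grid R = {Q. \<exists>j i. Q = grid_square R j i \<and> Q \<subseteq> unit_square}"

text \<open>An \<open>M\<close>-set is represented by its collection of squares; the corresponding subset of the
  unit square is the union of that collection.\<close>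

definition M_set :: "nat \<Rightarrow> nat \<Rightarrow> (real ^ 2) set set \<Rightarrow> bool" where
  "M_set R M P \<longleftrightarrow> P \<subseteq> grid R \<and> finite P \<and> card P = M"

definition M_set_partition :: "nat \<Rightarrow> nat \<Rightarrow> (nat \<Rightarrow> (real ^ 2) set set) \<Rightarrow> bool" where
  "M_set_partition R M P \<longleftrightarrow>
     (\<forall>j\<in>{1..R div M}. M_set R M (P j)) \<and>
     disjoint_family_on P {1..R div M} \<and>
     (\<Union>j\<in>{1..R div M}. P j) = grid R"

text \<open>Since the square root of \<open>R\<close> is a natural number, so is \<open>R\<close>; hence \<open>R\<close> is typed as
  a natural number and \<open>M dvd R\<close> is divisibility of natural numbers.\<close>

definition admissible :: "real \<Rightarrow> nat \<Rightarrow> nat \<Rightarrow> bool" where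
  "admissible \<gamma> R M \<longleftrightarrow>
     0 < \<gamma> \<and> \<gamma> \<le> 1 \<and> 1 \<le> R \<and> sqrt (real R) \<in> \<nat> \<and> 0 < M \<and> M dvd R \<and>
     1 / 2 * real R powr (1 - \<gamma>) \<le> real M \<and> real M \<le> 2 * real R powr (1 - \<gamma>)"

definition ball_weight :: "real ^ 3 \<Rightarrow> real \<Rightarrow> real ^ 3 \<Rightarrow> real" where
  "ball_weight c r x = (1 + norm (x - c) / r) powr (- 100)"

text \<open>The norm of \<open>L\<^sup>p(w)\<close>; for \<open>w\<close> the indicator function of a set it is the norm of
  \<open>L\<^sup>p\<close> of that set. For integrable \<open>F\<close> the function \<^term>\<open>extension_on S F\<close> is bounded and
  continuous, so the Bochner integrals below converge for both kinds of weight.\<close>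

definition Lp_norm :: "real \<Rightarrow> (real ^ 3 \<Rightarrow> real) \<Rightarrow> (real ^ 3 \<Rightarrow> complex) \<Rightarrow> real" where
  "Lp_norm p w f = (LINT x|lebesgue. norm (f x) powr p * w x) powr (1 / p)"

text \<open>The essential supremum is finite for bounded measurable \<open>F\<close>.\<close>

definition Linf_norm :: "(real ^ 2 \<Rightarrow> complex) \<Rightarrow> real" where
  "Linf_norm F = real_of_ereal (esssup (lebesgue_on unit_square) (\<lambda>\<xi>. ereal (norm (F \<xi>))))"

end

theory Submission
  imports Defs "HOL-Real_Asymp.Real_Asymp"
begin

text \<open>
  Fix a scale \<open>R = N\<^sup>2\<close>, put \<open>K = R / M\<close>, and let \<open>S = sqrt (\<Sum> |E\<^sub>q F|\<^sup>2)\<close> be the square function over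
  the squares \<open>q\<close> of side \<open>1 / N\<close>.

  Randomisation. The hypothesis holds for every partition, so it may be averaged over random ones.
  A random part contains each square with probability \<open>1 / K\<close>; its extension is therefore
  \<open>E F / K\<close> up to a fluctuation whose cube is on average at most a constant times \<open>S ^ 3\<close>
  (\<open>third_moment_shifted_sampling\<close>; the random partitions are made of independent cyclic shifts, so
  that only independent sums occur). Summing over the \<open>K\<close> parts, the hypothesis becomes, up to the
  factor \<open>R\<close> to the power \<open>\<epsilon>\<close>,
  \<open>\<integral> |E F| ^ 3 \<le> C K powr (-3/2) \<integral> |E F| ^ 3 + C K powr (3/2) \<integral> S ^ 3\<close>.
  The hypothesis has a ball on the left and a weight with tails on the right; after averaging over
  the centres of the balls, both integrals of \<open>|E F| ^ 3\<close> carry the same weight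
  (\<open>weighted_inequality\<close>). If the exponent \<open>\<epsilon>\<close> of the hypothesis is \<open>\<gamma> / 2\<close>, then for large \<open>R\<close> the
  first term on the right is absorbed. What remains is a reverse square function estimate which
  loses a power of \<open>K\<close>, that is, an arbitrarily small power of \<open>R\<close>, since \<open>\<gamma>\<close> is arbitrarily small.

  The square function. This estimate lives on a ball of radius \<open>R\<close>, but the conclusion on one
  of radius \<open>N\<close>, and for a general \<open>F\<close> the integral of \<open>S ^ 3\<close> over the larger ball can be much
  too large. If \<open>F\<close> is constant on every square and bounded by one, then \<open>E\<^sub>q F\<close> is concentrated on a
  tube through the origin of width \<open>N\<close> and length \<open>R\<close>. The tubes point in different directions and
  spread out, and the integral of \<open>S ^ 3\<close> is \<open>O(log N)\<close> (\<open>square_function_integral_le\<close>).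

  Reduction to piecewise constant functions. On the ball of radius \<open>\<delta> N\<close> around the origin the phase
  of the extension varies over a square by \<open>O(\<delta>)\<close>. Let \<open>G\<close> be the average of \<open>F\<close> over the squares.
  As \<open>F - G\<close> has mean zero on every square, \<open>E F - E G\<close> is a power series, starting in degree one,
  in the coordinates of \<open>x / N\<close>, all of size at most \<open>\<delta>\<close>, whose coefficients are extensions of
  bounded functions. For small \<open>\<delta>\<close> the best constant \<open>Q\<close> for bounded functions is thus at most a
  multiple of the one for piecewise constant functions plus \<open>3 / 4 Q\<close>
  (\<open>energy_le_piecewise_constant\<close>). Balls with other centres are reached by modulating \<open>F\<close>.
\<close>

section \<open>Third moments of independent draws\<close>

text \<open>The term linear in \<open>y\<close> is kept exactly: it disappears on averaging over a centred
  \<open>y\<close>, and only even powers of \<open>norm a\<close> survive.\<close>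

lemma norm_add_pow4_le:
  fixes a y :: "'a::real_inner"
  shows "norm (a + y) ^ 4 \<le> norm a ^ 4 + 4 * (norm a)\<^sup>2 * (a \<bullet> y) + 8 * (norm a)\<^sup>2 * (norm y)\<^sup>2 + 3 * norm y ^ 4"
proof -
  have cs: "\<bar>a \<bullet> y\<bar> \<le> norm a * norm y" by (rule Cauchy_Schwarz_ineq2)
  have "norm (a + y) ^ 4 = ((norm (a + y))\<^sup>2)\<^sup>2" by simp
  also have "(norm (a + y))\<^sup>2 = (norm a)\<^sup>2 + 2 * (a \<bullet> y) + (norm y)\<^sup>2"
    by (simp add: power2_norm_eq_inner inner_add inner_commute)
  finally have eq: "norm (a + y) ^ 4 = norm a ^ 4 + 4 * (norm a)\<^sup>2 * (a \<bullet> y) + 4 * (a \<bullet> y)\<^sup>2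
      + 2 * (norm a)\<^sup>2 * (norm y)\<^sup>2 + 4 * (a \<bullet> y) * (norm y)\<^sup>2 + norm y ^ 4"
    by (simp add: power2_eq_square power4_eq_xxxx algebra_simps)
  have 1: "(a \<bullet> y)\<^sup>2 \<le> (norm a)\<^sup>2 * (norm y)\<^sup>2"
    using power_mono[OF cs, of 2] by (simp add: power_mult_distrib)
  have "4 * (a \<bullet> y) * (norm y)\<^sup>2 \<le> 4 * (norm a * norm y) * (norm y)\<^sup>2"
    using cs by (intro mult_right_mono) auto
  also have "\<dots> \<le> 2 * (norm a)\<^sup>2 * (norm y)\<^sup>2 + 2 * norm y ^ 4"
    using mult_right_mono[OF sum_squares_bound[of "norm a" "norm y"], of "2 * (norm y)\<^sup>2"]
    by (simp add: power2_eq_square power4_eq_xxxx algebra_simps)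
  finally show ?thesis using eq 1 by linarith
qed

lemma sum_PiE_lessThan_Suc:
  fixes \<phi> :: "(nat \<Rightarrow> nat) \<Rightarrow> 'b::comm_monoid_add"
  shows "(\<Sum>h\<in>PiE {..<Suc m} (\<lambda>_. {..<K}). \<phi> h)
       = (\<Sum>h\<in>PiE {..<m} (\<lambda>_. {..<K}). \<Sum>k<K. \<phi> (h(m := k)))"
proof -
  have "(\<Sum>h\<in>PiE {..<Suc m} (\<lambda>_. {..<K}). \<phi> h)
      = (\<Sum>(k, h)\<in>{..<K} \<times> PiE {..<m} (\<lambda>_. {..<K}). \<phi> (h(m := k)))"
  proof -
    have inj: "inj_on (\<lambda>(y, g). g(m := y)) ({..<K} \<times> PiE {..<m} (\<lambda>_. {..<K}))"
      by (rule inj_combinator) simp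
    show ?thesis
      unfolding lessThan_Suc PiE_insert_eq
      by (subst sum.reindex[OF inj]) (simp add: case_prod_beta)
  qed
  also have "\<dots> = (\<Sum>k<K. \<Sum>h\<in>PiE {..<m} (\<lambda>_. {..<K}). \<phi> (h(m := k)))"
    by (simp add: sum.cartesian_product)
  also have "\<dots> = (\<Sum>h\<in>PiE {..<m} (\<lambda>_. {..<K}). \<Sum>k<K. \<phi> (h(m := k)))"
    by (rule sum.swap)
  finally show ?thesis .
qed

text \<open>A function \<open>h\<close> in the extensional product records \<open>m\<close> independent uniform draws
  from \<open>{..<K}\<close>, so the sums over \<open>H\<close> are expectations multiplied by \<open>K ^ m\<close>. Adding one
  more centred summand to a partial sum \<open>a\<close> changes the second and fourth moments only
  through \<open>(norm a)\<^sup>2\<close> and the bound \<open>b\<close>. The constant \<open>4\<close> is one for which the recursion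
  closes: \<open>4 V\<^sup>2 + 8 V b + 3 b\<^sup>2 \<le> 4 (V + b)\<^sup>2\<close>.\<close>

lemma moments_independent_sum:
  fixes Y :: "nat \<Rightarrow> nat \<Rightarrow> 'a::real_inner" and b :: "nat \<Rightarrow> real"
  assumes mean0: "\<And>g. g < m \<Longrightarrow> (\<Sum>k<K. Y g k) = 0"
    and bd: "\<And>g k. g < m \<Longrightarrow> k < K \<Longrightarrow> (norm (Y g k))\<^sup>2 \<le> b g"
  defines "H \<equiv> PiE {..<m} (\<lambda>_. {..<K})" and "V \<equiv> \<Sum>g<m. b g"
  shows "(\<Sum>h\<in>H. (norm (\<Sum>g<m. Y g (h g)))\<^sup>2) \<le> real K ^ m * V"
    and "(\<Sum>h\<in>H. norm (\<Sum>g<m. Y g (h g)) ^ 4) \<le> 4 * real K ^ m * V\<^sup>2"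
proof -
  have "(\<Sum>h\<in>PiE {..<m} (\<lambda>_. {..<K}). (norm (\<Sum>g<m. Y g (h g)))\<^sup>2) \<le> real K ^ m * (\<Sum>g<m. b g)
     \<and> (\<Sum>h\<in>PiE {..<m} (\<lambda>_. {..<K}). norm (\<Sum>g<m. Y g (h g)) ^ 4) \<le> 4 * real K ^ m * (\<Sum>g<m. b g)\<^sup>2"
    using mean0 bd
  proof (induction m)
    case 0
    then show ?case by simp
  next
    case (Suc m)
    let ?H = "PiE {..<m} (\<lambda>_. {..<K})"
    let ?V = "\<Sum>g<m. b g"
    define A where "A h = (\<Sum>g<m. Y g (h g))" for h
    have cardH: "real (card ?H) = real K ^ m" by (simp add: card_PiE)
    have IH2: "(\<Sum>h\<in>?H. (norm (A h))\<^sup>2) \<le> real K ^ m * ?V"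
      and IH4: "(\<Sum>h\<in>?H. norm (A h) ^ 4) \<le> 4 * real K ^ m * ?V\<^sup>2"
      using Suc.IH Suc.prems unfolding A_def by auto
    have upd: "(\<Sum>g<Suc m. Y g ((h(m := k)) g)) = A h + Y m k" for h k
      by (simp add: A_def)
    have m0: "(\<Sum>k<K. Y m k) = 0" using Suc.prems(1) by blast
    have bm: "(norm (Y m k))\<^sup>2 \<le> b m" if "k < K" for k using Suc.prems(2) that by blast
    have bm4: "norm (Y m k) ^ 4 \<le> (b m)\<^sup>2" if "k < K" for k
      using power_mono[OF bm[OF that], of 2] by simp
    have V0: "0 \<le> ?V" if "K > 0"
      using Suc.prems(2)[OF _ that] by (intro sum_nonneg) (auto intro: order_trans[OF zero_le_power2] less_SucI)
    have s2: "(\<Sum>k<K. (norm (a + Y m k))\<^sup>2) \<le> real K * (norm a)\<^sup>2 + real K * b m" for a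
    proof -
      have "(\<Sum>k<K. (norm (a + Y m k))\<^sup>2) = (\<Sum>k<K. (norm a)\<^sup>2 + 2 * (a \<bullet> Y m k) + (norm (Y m k))\<^sup>2)"
        by (intro sum.cong) (auto simp: power2_norm_eq_inner inner_add inner_commute)
      also have "\<dots> = real K * (norm a)\<^sup>2 + 2 * (a \<bullet> (\<Sum>k<K. Y m k)) + (\<Sum>k<K. (norm (Y m k))\<^sup>2)"
        by (simp add: sum.distrib sum_distrib_left inner_sum_right)
      also have "\<dots> \<le> real K * (norm a)\<^sup>2 + real K * b m"
        using sum_bounded_above[of "{..<K}" "\<lambda>k. (norm (Y m k))\<^sup>2" "b m"] bm m0 by simp
      finally show ?thesis .
    qed
    have s4: "(\<Sum>k<K. norm (a + Y m k) ^ 4)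
        \<le> real K * norm a ^ 4 + 8 * (real K * (norm a)\<^sup>2 * b m) + 3 * (real K * (b m)\<^sup>2)" for a
    proof -
      have "(\<Sum>k<K. norm (a + Y m k) ^ 4)
        \<le> (\<Sum>k<K. norm a ^ 4 + 4 * (norm a)\<^sup>2 * (a \<bullet> Y m k) + 8 * (norm a)\<^sup>2 * b m + 3 * (b m)\<^sup>2)"
      proof (rule sum_mono)
        fix k assume "k \<in> {..<K}"
        hence k: "k < K" by simp
        have "8 * (norm a)\<^sup>2 * (norm (Y m k))\<^sup>2 \<le> 8 * (norm a)\<^sup>2 * b m"
          using bm[OF k] by (intro mult_left_mono) auto
        thus "norm (a + Y m k) ^ 4 \<le> norm a ^ 4 + 4 * (norm a)\<^sup>2 * (a \<bullet> Y m k) + 8 * (norm a)\<^sup>2 * b m + 3 * (b m)\<^sup>2"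
          using norm_add_pow4_le[of a "Y m k"] bm4[OF k] by linarith
      qed
      also have "\<dots> = real K * norm a ^ 4 + 4 * (norm a)\<^sup>2 * (a \<bullet> (\<Sum>k<K. Y m k))
           + 8 * (real K * (norm a)\<^sup>2 * b m) + 3 * (real K * (b m)\<^sup>2)"
        by (simp add: sum.distrib sum_distrib_left inner_sum_right)
      finally show ?thesis by (simp add: m0)
    qed
    have K_bm: "real K * b m \<ge> 0"
      using bm[of 0] order_trans[OF zero_le_power2] by (cases "K = 0") (auto intro!: mult_nonneg_nonneg)
    have "(\<Sum>h\<in>PiE {..<Suc m} (\<lambda>_. {..<K}). (norm (\<Sum>g<Suc m. Y g (h g)))\<^sup>2)
        = (\<Sum>h\<in>?H. \<Sum>k<K. (norm (A h + Y m k))\<^sup>2)"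
      unfolding sum_PiE_lessThan_Suc upd ..
    also have "\<dots> \<le> (\<Sum>h\<in>?H. real K * (norm (A h))\<^sup>2 + real K * b m)"
      by (intro sum_mono s2)
    also have "\<dots> = real K * (\<Sum>h\<in>?H. (norm (A h))\<^sup>2) + real K ^ m * (real K * b m)"
      by (simp add: sum.distrib sum_distrib_left cardH)
    also have "\<dots> \<le> real K * (real K ^ m * ?V) + real K ^ m * (real K * b m)"
      using IH2 by (intro add_mono mult_left_mono) auto
    finally have r2: "(\<Sum>h\<in>PiE {..<Suc m} (\<lambda>_. {..<K}). (norm (\<Sum>g<Suc m. Y g (h g)))\<^sup>2)
        \<le> real K ^ Suc m * (\<Sum>g<Suc m. b g)" by (simp add: algebra_simps)
    have "(\<Sum>h\<in>PiE {..<Suc m} (\<lambda>_. {..<K}). norm (\<Sum>g<Suc m. Y g (h g)) ^ 4)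
        = (\<Sum>h\<in>?H. \<Sum>k<K. norm (A h + Y m k) ^ 4)"
      unfolding sum_PiE_lessThan_Suc upd ..
    also have "\<dots> \<le> (\<Sum>h\<in>?H. real K * norm (A h) ^ 4 + 8 * (real K * (norm (A h))\<^sup>2 * b m) + 3 * (real K * (b m)\<^sup>2))"
      by (intro sum_mono s4)
    also have "\<dots> = real K * (\<Sum>h\<in>?H. norm (A h) ^ 4) + 8 * ((real K * b m) * (\<Sum>h\<in>?H. (norm (A h))\<^sup>2))
         + 3 * (real K ^ m * (real K * (b m)\<^sup>2))"
      by (simp add: sum.distrib sum_distrib_left cardH mult_ac)
    also have "\<dots> \<le> real K * (4 * real K ^ m * ?V\<^sup>2) + 8 * ((real K * b m) * (real K ^ m * ?V))
         + 4 * (real K ^ m * (real K * (b m)\<^sup>2))"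
      using IH2 IH4 K_bm by (intro add_mono mult_left_mono mult_right_mono) auto
    also have "\<dots> = 4 * real K ^ Suc m * (\<Sum>g<Suc m. b g)\<^sup>2"
      by (simp add: power2_eq_square algebra_simps)
    finally have r4: "(\<Sum>h\<in>PiE {..<Suc m} (\<lambda>_. {..<K}). norm (\<Sum>g<Suc m. Y g (h g)) ^ 4)
        \<le> 4 * real K ^ Suc m * (\<Sum>g<Suc m. b g)\<^sup>2" .
    show ?case using r2 r4 by simp
  qed
  thus "(\<Sum>h\<in>H. (norm (\<Sum>g<m. Y g (h g)))\<^sup>2) \<le> real K ^ m * V"
    and "(\<Sum>h\<in>H. norm (\<Sum>g<m. Y g (h g)) ^ 4) \<le> 4 * real K ^ m * V\<^sup>2"
    unfolding H_def V_def by auto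
qed

text \<open>The third moment lies between the second and the fourth, of sizes \<open>V\<close> and \<open>V\<^sup>2\<close>.\<close>

lemma third_moment_independent_sum:
  fixes Y :: "nat \<Rightarrow> nat \<Rightarrow> 'a::real_inner" and b :: "nat \<Rightarrow> real"
  assumes "K > 0"
    and mean0: "\<And>g. g < m \<Longrightarrow> (\<Sum>k<K. Y g k) = 0"
    and bd: "\<And>g k. g < m \<Longrightarrow> k < K \<Longrightarrow> (norm (Y g k))\<^sup>2 \<le> b g"
  shows "(\<Sum>h\<in>PiE {..<m} (\<lambda>_. {..<K}). norm (\<Sum>g<m. Y g (h g)) ^ 3)
     \<le> 5 / 2 * real K ^ m * sqrt (\<Sum>g<m. b g) ^ 3"
proof -
  let ?H = "PiE {..<m} (\<lambda>_. {..<K})"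
  define V where "V = (\<Sum>g<m. b g)"
  define X where "X h = (\<Sum>g<m. Y g (h g))" for h
  have m2: "(\<Sum>h\<in>?H. (norm (X h))\<^sup>2) \<le> real K ^ m * V"
    and m4: "(\<Sum>h\<in>?H. norm (X h) ^ 4) \<le> 4 * real K ^ m * V\<^sup>2"
    using moments_independent_sum[where Y = Y and b = b and K = K and m = m] mean0 bd unfolding V_def X_def by auto
  have b0: "b g \<ge> 0" if "g < m" for g
    using bd[OF that \<open>K > 0\<close>] order_trans[OF zero_le_power2] by blast
  have V0: "V \<ge> 0" unfolding V_def by (intro sum_nonneg) (auto intro: b0)
  have fin: "finite ?H" by (intro finite_PiE) auto
  show ?thesis
  proof (cases "V = 0")
    case True
    have "(\<Sum>h\<in>?H. (norm (X h))\<^sup>2) = 0"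
      using m2 True by (intro antisym sum_nonneg) auto
    hence "\<forall>h\<in>?H. X h = 0" using fin by (subst (asm) sum_nonneg_eq_0_iff) auto
    thus ?thesis using True unfolding X_def V_def by simp
  next
    case False
    define s where "s = sqrt V"
    have s: "s > 0" "V = s\<^sup>2" using False V0 by (auto simp: s_def)
    \<comment> \<open>With \<open>s = sqrt V\<close> each term on the right has an average bounded by a multiple of \<open>s ^ 3\<close>.\<close>
    have pt: "z ^ 3 \<le> (z ^ 4 / s + s * z\<^sup>2) / 2" if "z \<ge> 0" for z :: real
    proof -
      have "0 \<le> z\<^sup>2 * (z - s)\<^sup>2 / s" using s by simp
      also have "\<dots> = z ^ 4 / s + s * z\<^sup>2 - 2 * z ^ 3"
        using s by (simp add: field_simps power2_eq_square power3_eq_cube power4_eq_xxxx)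
      finally show ?thesis by (simp add: algebra_simps)
    qed
    have "(\<Sum>h\<in>?H. norm (X h) ^ 3) \<le> (\<Sum>h\<in>?H. (norm (X h) ^ 4 / s + s * (norm (X h))\<^sup>2) / 2)"
      by (intro sum_mono pt) auto
    also have "\<dots> = ((\<Sum>h\<in>?H. norm (X h) ^ 4) / s + s * (\<Sum>h\<in>?H. (norm (X h))\<^sup>2)) / 2"
      by (simp add: sum.distrib sum_distrib_left sum_divide_distrib add_divide_distrib)
    also have "\<dots> \<le> ((4 * real K ^ m * V\<^sup>2) / s + s * (real K ^ m * V)) / 2"
      using m2 m4 s by (intro divide_right_mono add_mono mult_left_mono) auto
    also have "\<dots> = 5 / 2 * real K ^ m * s ^ 3"
      using s by (simp add: field_simps power2_eq_square power3_eq_cube)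
    finally show ?thesis unfolding X_def s_def V_def .
  qed
qed

lemma norm_add_pow3_le:
  fixes a b :: "'a::real_normed_vector"
  shows "norm (a + b) ^ 3 \<le> 4 * norm a ^ 3 + 4 * norm b ^ 3"
proof -
  have "norm (a + b) ^ 3 \<le> (norm a + norm b) ^ 3"
    by (intro power_mono norm_triangle_ineq) auto
  also have "\<dots> \<le> 4 * norm a ^ 3 + 4 * norm b ^ 3"
  proof -
    have "0 \<le> 3 * ((norm a + norm b) * (norm a - norm b)\<^sup>2)" by simp
    thus ?thesis by (simp add: power2_eq_square power3_eq_cube algebra_simps)
  qed
  finally show ?thesis .
qed

lemma add_mod_cancel:
  fixes x y j K :: nat
  assumes "x \<le> y" "y < x + K" "(j + x) mod K = (j + y) mod K"
  shows "x = y"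
proof -
  have "K dvd (j + y) - (j + x)" using assms mod_eq_dvd_iff_nat[of "j + x" "j + y" K] by simp
  thus ?thesis using assms by (auto dest: dvd_imp_le)
qed

text \<open>From each of \<open>m\<close> groups of \<open>K\<close> vectors one vector is drawn. The sum of the drawn vectors
  is the sum of the group means, which is the full sum divided by \<open>K\<close>, plus independent
  centred errors. An error in group \<open>g\<close> is at most twice the Euclidean norm of the whole
  group. This overestimates its variance by a factor of order \<open>K\<close>, which is affordable as
  \<open>K\<close> will be a small power of the scale.\<close>

lemma third_moment_shifted_sampling:
  fixes f :: "nat \<Rightarrow> nat \<Rightarrow> 'a::real_inner"
  assumes "K > 0"
  shows "(\<Sum>h\<in>PiE {..<m} (\<lambda>_. {..<K}). norm (\<Sum>g<m. f g ((j + h g) mod K)) ^ 3)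
     \<le> real K ^ m * (4 / real K ^ 3 * norm (\<Sum>g<m. \<Sum>k<K. f g k) ^ 3
         + 80 * sqrt (\<Sum>g<m. \<Sum>k<K. (norm (f g k))\<^sup>2) ^ 3)"
proof -
  let ?H = "PiE {..<m} (\<lambda>_. {..<K})"
  define \<mu> where "\<mu> g = (1 / real K) *\<^sub>R (\<Sum>k<K. f g k)" for g
  define Y where "Y g k = f g ((j + k) mod K) - \<mu> g" for g k
  define b where "b g = 4 * (\<Sum>k<K. (norm (f g k))\<^sup>2)" for g
  have shift: "(\<Sum>k<K. f g ((j + k) mod K)) = (\<Sum>k<K. f g k)" for g
  proof (rule sum.reindex_bij_betw[where h = "\<lambda>k. (j + k) mod K"])
    have "inj_on (\<lambda>k. (j + k) mod K) {..<K}"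
    proof (rule inj_onI)
      fix x y assume "x \<in> {..<K}" "y \<in> {..<K}" "(j + x) mod K = (j + y) mod K"
      thus "x = y" using add_mod_cancel[of x y K j] add_mod_cancel[of y x K j] by (cases "x \<le> y") simp_all
    qed
    moreover have "(\<lambda>k. (j + k) mod K) ` {..<K} \<subseteq> {..<K}" using assms by auto
    ultimately show "bij_betw (\<lambda>k. (j + k) mod K) {..<K} {..<K}"
      using endo_inj_surj[of "{..<K}" "\<lambda>k. (j + k) mod K"] by (simp add: bij_betw_def)
  qed
  have mean0: "(\<Sum>k<K. Y g k) = 0" for g
    using assms by (simp add: Y_def sum_subtractf shift \<mu>_def sum_constant_scaleR)
  have bd: "(norm (Y g k))\<^sup>2 \<le> b g" for g k
  proof -
    define s where "s = sqrt (\<Sum>k<K. (norm (f g k))\<^sup>2)"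
    have s: "s\<^sup>2 = (\<Sum>k<K. (norm (f g k))\<^sup>2)" by (simp add: s_def sum_nonneg)
    have fs: "norm (f g i) \<le> s" if "i < K" for i
      unfolding s_def by (rule real_le_rsqrt, rule member_le_sum) (use that in auto)
    have "norm (\<mu> g) \<le> (1 / real K) * (\<Sum>k<K. norm (f g k))"
      unfolding \<mu>_def using norm_sum[of "f g" "{..<K}"] by (simp add: divide_right_mono)
    also have "\<dots> \<le> (1 / real K) * (real K * s)"
      using sum_bounded_above[of "{..<K}" "\<lambda>k. norm (f g k)" s] fs by (intro mult_left_mono) auto
    also have "\<dots> = s" using assms by simp
    finally have "norm (Y g k) \<le> 2 * s"
      unfolding Y_def using norm_triangle_ineq4[of "f g ((j + k) mod K)" "\<mu> g"] fs[of "(j + k) mod K"] assms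
      by simp
    from power_mono[OF this, of 2] show ?thesis by (simp add: b_def power_mult_distrib s)
  qed
  have sumb: "(\<Sum>g<m. b g) = 4 * (\<Sum>g<m. \<Sum>k<K. (norm (f g k))\<^sup>2)"
    by (simp add: b_def sum_distrib_left)
  have sqrt4: "sqrt (\<Sum>g<m. b g) = 2 * sqrt (\<Sum>g<m. \<Sum>k<K. (norm (f g k))\<^sup>2)"
    unfolding sumb by (simp add: real_sqrt_mult)
  have tot: "(\<Sum>g<m. \<mu> g) = (1 / real K) *\<^sub>R (\<Sum>g<m. \<Sum>k<K. f g k)"
    unfolding \<mu>_def by (simp add: scaleR_sum_right)
  have ntot: "norm (\<Sum>g<m. \<mu> g) ^ 3 = norm (\<Sum>g<m. \<Sum>k<K. f g k) ^ 3 / real K ^ 3"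
    unfolding tot by (simp add: power_divide)
  have "(\<Sum>h\<in>?H. norm (\<Sum>g<m. f g ((j + h g) mod K)) ^ 3)
      \<le> (\<Sum>h\<in>?H. 4 * norm (\<Sum>g<m. \<mu> g) ^ 3 + 4 * norm (\<Sum>g<m. Y g (h g)) ^ 3)"
  proof (rule sum_mono)
    fix h
    have "(\<Sum>g<m. f g ((j + h g) mod K)) = (\<Sum>g<m. \<mu> g) + (\<Sum>g<m. Y g (h g))"
      by (simp add: Y_def sum.distrib[symmetric])
    thus "norm (\<Sum>g<m. f g ((j + h g) mod K)) ^ 3
        \<le> 4 * norm (\<Sum>g<m. \<mu> g) ^ 3 + 4 * norm (\<Sum>g<m. Y g (h g)) ^ 3"
      using norm_add_pow3_le[of "\<Sum>g<m. \<mu> g" "\<Sum>g<m. Y g (h g)"] by simp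
  qed
  also have "\<dots> = real K ^ m * (4 * norm (\<Sum>g<m. \<mu> g) ^ 3) + 4 * (\<Sum>h\<in>?H. norm (\<Sum>g<m. Y g (h g)) ^ 3)"
    by (simp add: sum.distrib sum_distrib_left card_PiE)
  also have "\<dots> \<le> real K ^ m * (4 * norm (\<Sum>g<m. \<mu> g) ^ 3) + 4 * (5 / 2 * real K ^ m * sqrt (\<Sum>g<m. b g) ^ 3)"
    using third_moment_independent_sum[where Y = Y and b = b and K = K and m = m] assms mean0 bd by simp
  also have "\<dots> = real K ^ m * (4 / real K ^ 3 * norm (\<Sum>g<m. \<Sum>k<K. f g k) ^ 3
         + 80 * sqrt (\<Sum>g<m. \<Sum>k<K. (norm (f g k))\<^sup>2) ^ 3)"
    unfolding ntot sqrt4 by (simp add: power_mult_distrib algebra_simps)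
  finally show ?thesis .
qed

section \<open>The extension operator\<close>

lemma norm_e [simp]: "norm (e t) = 1"
  by (simp add: e_def norm_exp_eq_Re)

lemma e_add: "e (s + t) = e s * e t"
  by (simp add: e_def exp_add[symmetric] algebra_simps)

lemma e_0 [simp]: "e 0 = 1"
  by (simp add: e_def)

lemma continuous_on_e [continuous_intros]: "continuous_on A f \<Longrightarrow> continuous_on A (\<lambda>x. e (f x))"
  unfolding e_def by (intro continuous_intros)

lemma borel_measurable_e [measurable]: "e \<in> borel_measurable borel"
  by (intro borel_measurable_continuous_onI continuous_intros)

lemma borel_measurable_vec_nth_real [measurable]: "(\<lambda>x::real^'n. x $ k) \<in> borel_measurable borel"
  by (intro borel_measurable_continuous_onI continuous_intros)

lemma norm_vec2_sq: "(norm (\<xi>::real^2))\<^sup>2 = (\<xi> $ 1)\<^sup>2 + (\<xi> $ 2)\<^sup>2"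
  unfolding power2_norm_eq_inner by (simp add: inner_vec_def sum_2 power2_eq_square)

lemma paraboloid_point_inner:
  "paraboloid_point \<xi> \<bullet> x = \<xi> $ 1 * x $ 1 + \<xi> $ 2 * x $ 2 + ((\<xi> $ 1)\<^sup>2 + (\<xi> $ 2)\<^sup>2) * x $ 3"
  by (simp add: paraboloid_point_def inner_vec_def sum_3 norm_vec2_sq)

lemma continuous_on_paraboloid_inner [continuous_intros]:
  assumes "continuous_on A f" "continuous_on A g"
  shows "continuous_on A (\<lambda>z. paraboloid_point (f z) \<bullet> g z)"
  unfolding paraboloid_point_inner by (intro continuous_intros assms)

lemma in_unit_square_iff: "\<xi> \<in> unit_square \<longleftrightarrow> 0 \<le> \<xi> $ 1 \<and> \<xi> $ 1 \<le> 1 \<and> 0 \<le> \<xi> $ 2 \<and> \<xi> $ 2 \<le> 1"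
  unfolding unit_square_def mem_box_cart by (auto simp: forall_2)

lemma borel_measurable_lebesgue_on_continuous:
  fixes f :: "'a::euclidean_space \<Rightarrow> 'b::topological_space"
  assumes "continuous_on UNIV f"
  shows "f \<in> borel_measurable (lebesgue_on S)"
  by (intro measurable_restrict_space1 measurable_completion)
     (simp add: borel_measurable_continuous_onI assms)

lemma integrable_extension_integrand:
  assumes "integrable (lebesgue_on S) F"
  shows "integrable (lebesgue_on S) (\<lambda>\<xi>. F \<xi> * e (paraboloid_point \<xi> \<bullet> x))"
proof (rule Bochner_Integration.integrable_bound[OF assms])
  have "(\<lambda>\<xi>. e (paraboloid_point \<xi> \<bullet> x)) \<in> borel_measurable (lebesgue_on S)"
    by (intro borel_measurable_lebesgue_on_continuous continuous_intros)
  thus "(\<lambda>\<xi>. F \<xi> * e (paraboloid_point \<xi> \<bullet> x)) \<in> borel_measurable (lebesgue_on S)"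
    using assms by (intro borel_measurable_times) auto
qed (auto simp: norm_mult)

lemma norm_extension_on_le:
  "norm (extension_on S F x) \<le> (LINT \<xi>|lebesgue_on S. norm (F \<xi>))"
  unfolding extension_on_def
  using integral_norm_bound[of "lebesgue_on S" "\<lambda>\<xi>. F \<xi> * e (paraboloid_point \<xi> \<bullet> x)"]
  by (simp add: norm_mult)

lemma continuous_on_extension_on:
  assumes "integrable (lebesgue_on S) F"
  shows "continuous_on UNIV (extension_on S F)"
  unfolding continuous_on_sequentially
proof (intro allI ballI impI, unfold comp_def)
  fix u :: "nat \<Rightarrow> real^3" and x assume "(\<forall>n. u n \<in> UNIV) \<and> u \<longlonglongrightarrow> x"
  hence u: "u \<longlonglongrightarrow> x" by simp
  have ce: "continuous_on UNIV e" by (intro continuous_intros)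
  show "(\<lambda>n. extension_on S F (u n)) \<longlonglongrightarrow> extension_on S F x"
    unfolding extension_on_def
  proof (rule integral_dominated_convergence[where w = "\<lambda>\<xi>. norm (F \<xi>)"])
    show "AE \<xi> in lebesgue_on S. (\<lambda>n. F \<xi> * e (paraboloid_point \<xi> \<bullet> u n)) \<longlonglongrightarrow> F \<xi> * e (paraboloid_point \<xi> \<bullet> x)"
      by (intro always_eventually allI tendsto_intros continuous_on_tendsto_compose[OF ce] u) auto
  qed (use assms integrable_extension_integrand[OF assms] in
        \<open>auto simp: norm_mult intro: borel_measurable_integrable\<close>)
qed

lemma extension_on_eq_indicator:
  assumes "S \<in> sets lebesgue"
  shows "extension_on S F x = (LINT \<xi>|lebesgue. indicator S \<xi> *\<^sub>R (F \<xi> * e (paraboloid_point \<xi> \<bullet> x)))"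
  unfolding extension_on_def using assms by (subst integral_restrict_space) auto

lemma integrable_lebesgue_on_subset:
  fixes F :: "'a::euclidean_space \<Rightarrow> 'b::euclidean_space"
  assumes "integrable (lebesgue_on S) F" "T \<subseteq> S" "S \<in> sets lebesgue" "T \<in> sets lebesgue"
  shows "integrable (lebesgue_on T) F"
proof -
  have "set_integrable lebesgue S F"
    using assms unfolding set_integrable_def by (subst (asm) integrable_restrict_space) auto
  hence "set_integrable lebesgue T F" using assms by (intro set_integrable_subset[of lebesgue S F T]) auto
  thus ?thesis
    using assms unfolding set_integrable_def by (subst integrable_restrict_space) auto
qed

section \<open>The grid of squares\<close>

text \<open>A single index, running along the rows, makes it possible to cut the list of squares into
  consecutive groups of equal size.\<close>

definition cell :: "nat \<Rightarrow> nat \<Rightarrow> (real^2) set" where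
  "cell N a = grid_square (N\<^sup>2) (a mod N) (a div N)"

lemma in_grid_square_iff:
  assumes "N > 0"
  shows "\<xi> \<in> grid_square (N\<^sup>2) j i \<longleftrightarrow>
    real j \<le> real N * \<xi> $ 1 \<and> real N * \<xi> $ 1 \<le> real j + 1 \<and> real i \<le> real N * \<xi> $ 2 \<and> real N * \<xi> $ 2 \<le> real i + 1"
  unfolding grid_square_def mem_box_cart using assms
  by (auto simp: forall_2 field_simps)

lemma grid_square_subset_iff:
  assumes "N > 0"
  shows "grid_square (N\<^sup>2) j i \<subseteq> unit_square \<longleftrightarrow> j < N \<and> i < N"
proof
  assume *: "grid_square (N\<^sup>2) j i \<subseteq> unit_square"
  have "vector [(real j + 1) / real N, (real i + 1) / real N] \<in> grid_square (N\<^sup>2) j i"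
    using assms by (subst in_grid_square_iff) auto
  with * have "vector [(real j + 1) / real N, (real i + 1) / real N] \<in> unit_square" by blast
  thus "j < N \<and> i < N" using assms by (auto simp: in_unit_square_iff field_simps)
next
  assume ji: "j < N \<and> i < N"
  show "grid_square (N\<^sup>2) j i \<subseteq> unit_square"
  proof
    fix \<xi> assume "\<xi> \<in> grid_square (N\<^sup>2) j i"
    hence h: "real j \<le> real N * \<xi> $ 1" "real N * \<xi> $ 1 \<le> real j + 1" "real i \<le> real N * \<xi> $ 2" "real N * \<xi> $ 2 \<le> real i + 1"
      using assms by (auto simp: in_grid_square_iff)
    have b: "real N > 0" using assms by simp
    have "0 \<le> real N * \<xi> $ 1" "real N * \<xi> $ 1 \<le> real N * 1" "0 \<le> real N * \<xi> $ 2" "real N * \<xi> $ 2 \<le> real N * 1"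
      using h ji by linarith+
    hence "\<xi> $ 1 \<le> 1" "\<xi> $ 2 \<le> 1" "0 \<le> \<xi> $ 1" "0 \<le> \<xi> $ 2"
      using b by (simp_all only: mult_le_cancel_left_pos zero_le_mult_iff) auto
    thus "\<xi> \<in> unit_square" by (simp add: in_unit_square_iff)
  qed
qed

lemma grid_square_inj:
  assumes "N > 0" "grid_square (N\<^sup>2) j i = grid_square (N\<^sup>2) j' i'"
  shows "j = j' \<and> i = i'"
proof -
  have "vector [(real j + 1/2) / real N, (real i + 1/2) / real N] \<in> grid_square (N\<^sup>2) j i"
    using assms(1) by (subst in_grid_square_iff) auto
  hence "vector [(real j + 1/2) / real N, (real i + 1/2) / real N] \<in> grid_square (N\<^sup>2) j' i'"
    using assms by simp
  hence "real j' \<le> real j + 1/2" "real j + 1/2 \<le> real j' + 1" "real i' \<le> real i + 1/2" "real i + 1/2 \<le> real i' + 1"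
    using assms(1) by (auto simp: in_grid_square_iff)
  thus ?thesis by linarith
qed

lemma cell_index_less:
  fixes a N :: nat
  assumes "a < N\<^sup>2" shows "a mod N < N" "a div N < N"
proof -
  have "N > 0" using assms by (cases N) auto
  thus "a mod N < N" by simp
  show "a div N < N" using assms by (simp add: less_mult_imp_div_less power2_eq_square)
qed

lemma grid_eq_cells:
  assumes "N > 0" shows "grid (N\<^sup>2) = cell N ` {..<N\<^sup>2}"
proof (intro equalityI subsetI)
  fix Q assume "Q \<in> grid (N\<^sup>2)"
  then obtain j i where Q: "Q = grid_square (N\<^sup>2) j i" and ji: "j < N" "i < N"
    unfolding grid_def using grid_square_subset_iff[OF assms] by auto
  have "Q = cell N (i * N + j)" using ji by (simp add: cell_def Q)
  moreover have "i * N + j < N\<^sup>2"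
  proof -
    have "i * N + j < (i + 1) * N" using ji by simp
    also have "\<dots> \<le> N * N" using ji by (intro mult_right_mono) auto
    finally show ?thesis by (simp add: power2_eq_square)
  qed
  ultimately show "Q \<in> cell N ` {..<N\<^sup>2}" by blast
next
  fix Q assume "Q \<in> cell N ` {..<N\<^sup>2}"
  then obtain a where a: "a < N\<^sup>2" "Q = cell N a" by auto
  hence "Q \<subseteq> unit_square"
    using grid_square_subset_iff[OF assms] cell_index_less[OF a(1)] by (simp add: cell_def)
  thus "Q \<in> grid (N\<^sup>2)" using a unfolding grid_def cell_def by auto
qed

lemma inj_cell:
  assumes "N > 0" shows "inj (cell N)"
proof (rule injI)
  fix a b assume "cell N a = cell N b"
  hence "a mod N = b mod N \<and> a div N = b div N"
    using grid_square_inj[OF assms] by (simp add: cell_def)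
  thus "a = b" by (metis mult_div_mod_eq)
qed

lemma cell_subset_unit_square:
  assumes "N > 0" "a < N\<^sup>2" shows "cell N a \<subseteq> unit_square"
  using grid_square_subset_iff[OF assms(1)] cell_index_less[OF assms(2)] by (simp add: cell_def)

lemma cell_lebesgue [measurable]: "cell N a \<in> sets lebesgue"
  unfolding cell_def grid_square_def by simp

lemma cell_borel [measurable]: "cell N a \<in> sets borel"
  unfolding cell_def grid_square_def by simp

text \<open>The squares are closed and share edges; off the null set of grid lines, the square that
  contains a point is determined by rounding down.\<close>

lemma AE_cell_floor:
  assumes "N > 0"
  shows "AE \<xi> in lebesgue. \<forall>a. \<xi> \<in> cell N a \<longrightarrow>
    \<lfloor>real N * \<xi> $ 1\<rfloor> = int (a mod N) \<and> \<lfloor>real N * \<xi> $ 2\<rfloor> = int (a div N)"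
proof -
  define Z where "Z = (\<Union>k::nat. {\<xi>::real^2. axis 1 1 \<bullet> \<xi> = real k / real N} \<union> {\<xi>. axis 2 1 \<bullet> \<xi> = real k / real N})"
  have nz: "negligible Z"
    unfolding Z_def
    by (intro negligible_countable_Union negligible_Un negligible_hyperplane)
       (auto simp: axis_eq_0_iff intro!: negligible_Un negligible_hyperplane)
  have "\<lfloor>real N * \<xi> $ 1\<rfloor> = int (a mod N) \<and> \<lfloor>real N * \<xi> $ 2\<rfloor> = int (a div N)"
    if "\<xi> \<notin> Z" "\<xi> \<in> cell N a" for \<xi> a
  proof -
    have nk: "real N * \<xi> $ 1 \<noteq> real k" "real N * \<xi> $ 2 \<noteq> real k" for k
      using assms that(1) unfolding Z_def by (auto simp: inner_axis' field_simps)
    have "real N * \<xi> $ 1 \<noteq> real (a mod N) + 1" "real N * \<xi> $ 2 \<noteq> real (a div N) + 1"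
      using nk(1)[of "a mod N + 1"] nk(2)[of "a div N + 1"] by (auto simp: add_ac)
    moreover have "real (a mod N) \<le> real N * \<xi> $ 1" "real N * \<xi> $ 1 \<le> real (a mod N) + 1"
      "real (a div N) \<le> real N * \<xi> $ 2" "real N * \<xi> $ 2 \<le> real (a div N) + 1"
      using that(2) assms by (auto simp: cell_def in_grid_square_iff)
    ultimately show ?thesis by (auto simp: floor_eq_iff)
  qed
  hence "- {\<xi>. \<forall>a. \<xi> \<in> cell N a \<longrightarrow> \<lfloor>real N * \<xi> $ 1\<rfloor> = int (a mod N) \<and> \<lfloor>real N * \<xi> $ 2\<rfloor> = int (a div N)} \<subseteq> Z"
    by blast
  thus ?thesis using nz unfolding negligible_iff_null_sets
    by (intro AE_I'[of Z]) auto
qed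

lemma AE_cells_disjoint:
  assumes "N > 0"
  shows "AE \<xi> in lebesgue. \<forall>a b. \<xi> \<in> cell N a \<longrightarrow> \<xi> \<in> cell N b \<longrightarrow> a = b"
  using AE_cell_floor[OF assms]
proof eventually_elim
  case (elim \<xi>)
  show ?case
  proof (intro allI impI)
    fix a b assume "\<xi> \<in> cell N a" "\<xi> \<in> cell N b"
    with elim have "int (a mod N) = int (b mod N)" "int (a div N) = int (b div N)" by metis+
    thus "a = b" by (metis of_nat_eq_iff mult_div_mod_eq)
  qed
qed

lemma extension_on_Union_cells:
  assumes N: "N > 0" and I: "I \<subseteq> {..<N\<^sup>2}" and F: "integrable (lebesgue_on unit_square) F"
  shows "extension_on (\<Union>(cell N ` I)) F x = (\<Sum>a\<in>I. extension_on (cell N a) F x)"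
proof -
  have fin: "finite I" using I finite_subset by blast
  have intF: "integrable (lebesgue_on (cell N a)) F" if "a \<in> I" for a
    using F cell_subset_unit_square[OF N] I that
    by (intro integrable_lebesgue_on_subset[OF F]) (auto simp: unit_square_def)
  have int: "integrable lebesgue (\<lambda>\<xi>. indicator (cell N a) \<xi> *\<^sub>R (F \<xi> * e (paraboloid_point \<xi> \<bullet> x)))" if "a \<in> I" for a
    using integrable_extension_integrand[OF intF[OF that], of x]
    by (subst (asm) integrable_restrict_space) auto
  have eq: "AE \<xi> in lebesgue. (\<Sum>a\<in>I. indicator (cell N a) \<xi> *\<^sub>R (F \<xi> * e (paraboloid_point \<xi> \<bullet> x)))
      = indicator (\<Union>(cell N ` I)) \<xi> *\<^sub>R (F \<xi> * e (paraboloid_point \<xi> \<bullet> x))"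
    using AE_cells_disjoint[OF N]
  proof eventually_elim
    case (elim \<xi>)
    have "(\<Sum>a\<in>I. indicator (cell N a) \<xi>) = (indicator (\<Union>(cell N ` I)) \<xi> :: real)"
    proof (cases "\<exists>a\<in>I. \<xi> \<in> cell N a")
      case True
      then obtain a where a: "a \<in> I" "\<xi> \<in> cell N a" by blast
      have "(\<Sum>b\<in>I. indicator (cell N b) \<xi>) = (\<Sum>b\<in>I. if b = a then 1 else (0::real))"
        using elim a by (intro sum.cong) (auto simp: indicator_def)
      thus ?thesis using a fin by (auto simp: indicator_def)
    next
      case False
      thus ?thesis by (auto simp: indicator_def)
    qed
    thus ?case by (simp add: scaleR_sum_left[symmetric])
  qed
  have "extension_on (\<Union>(cell N ` I)) F x
     = (LINT \<xi>|lebesgue. indicator (\<Union>(cell N ` I)) \<xi> *\<^sub>R (F \<xi> * e (paraboloid_point \<xi> \<bullet> x)))"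
    using fin by (intro extension_on_eq_indicator) auto
  also have "\<dots> = (LINT \<xi>|lebesgue. (\<Sum>a\<in>I. indicator (cell N a) \<xi> *\<^sub>R (F \<xi> * e (paraboloid_point \<xi> \<bullet> x))))"
  proof (rule integral_cong_AE)
    show "AE \<xi> in lebesgue. indicator (\<Union>(cell N ` I)) \<xi> *\<^sub>R (F \<xi> * e (paraboloid_point \<xi> \<bullet> x))
        = (\<Sum>a\<in>I. indicator (cell N a) \<xi> *\<^sub>R (F \<xi> * e (paraboloid_point \<xi> \<bullet> x)))"
      using eq by eventually_elim simp
    have U: "\<Union>(cell N ` I) \<in> sets lebesgue" using fin by auto
    have "integrable (lebesgue_on (\<Union>(cell N ` I))) F"
      using cell_subset_unit_square[OF N] I U
      by (intro integrable_lebesgue_on_subset[OF F]) (auto simp: unit_square_def)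
    from integrable_extension_integrand[OF this, of x]
    show "(\<lambda>\<xi>. indicator (\<Union>(cell N ` I)) \<xi> *\<^sub>R (F \<xi> * e (paraboloid_point \<xi> \<bullet> x))) \<in> borel_measurable lebesgue"
      using U by (subst (asm) integrable_restrict_space) auto
    show "(\<lambda>\<xi>. \<Sum>a\<in>I. indicator (cell N a) \<xi> *\<^sub>R (F \<xi> * e (paraboloid_point \<xi> \<bullet> x))) \<in> borel_measurable lebesgue"
      using int by (intro borel_measurable_sum) (blast intro: borel_measurable_integrable)
  qed
  also have "\<dots> = (\<Sum>a\<in>I. (LINT \<xi>|lebesgue. indicator (cell N a) \<xi> *\<^sub>R (F \<xi> * e (paraboloid_point \<xi> \<bullet> x))))"
    using int by (rule Bochner_Integration.integral_sum)
  also have "\<dots> = (\<Sum>a\<in>I. extension_on (cell N a) F x)"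
    by (simp add: extension_on_eq_indicator)
  finally show ?thesis .
qed

lemma Union_cells:
  assumes "N > 0" shows "\<Union>(cell N ` {..<N\<^sup>2}) = unit_square"
proof (intro equalityI subsetI)
  fix \<xi> assume "\<xi> \<in> \<Union>(cell N ` {..<N\<^sup>2})"
  thus "\<xi> \<in> unit_square" using cell_subset_unit_square[OF assms] by blast
next
  fix \<xi> assume u: "\<xi> \<in> unit_square"
  have ex: "\<exists>j<N. real j \<le> real N * t \<and> real N * t \<le> real j + 1" if "0 \<le> t" "t \<le> 1" for t
  proof (cases "t = 1")
    case True
    thus ?thesis using assms by (intro exI[of _ "N - 1"]) auto
  next
    case False
    define j where "j = nat \<lfloor>real N * t\<rfloor>"
    have nn: "0 \<le> real N * t" using that by simp
    have "real j \<le> real N * t" "real N * t < real j + 1" unfolding j_def using nn by linarith+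
    moreover have "real N * t < real N" using False that assms by simp
    ultimately have "j < N" by linarith
    thus ?thesis using \<open>real j \<le> real N * t\<close> \<open>real N * t < real j + 1\<close> by (intro exI[of _ j]) auto
  qed
  from ex[of "\<xi> $ 1"] ex[of "\<xi> $ 2"] u obtain j i where
    "j < N" "i < N" "\<xi> \<in> grid_square (N\<^sup>2) j i"
    using assms by (auto simp: in_unit_square_iff in_grid_square_iff)
  hence "grid_square (N\<^sup>2) j i \<in> grid (N\<^sup>2)" using grid_square_subset_iff[OF assms] by (auto simp: grid_def)
  thus "\<xi> \<in> \<Union>(cell N ` {..<N\<^sup>2})"
    using grid_eq_cells[OF assms] \<open>\<xi> \<in> grid_square (N\<^sup>2) j i\<close> by blast
qed

section \<open>Lebesgue measure in coordinates and decaying weights\<close>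

lemma prod_Basis_cart: "(\<Prod>b\<in>Basis. f (b :: real^'n)) = (\<Prod>i\<in>UNIV. f (axis i 1))"
proof -
  have "Basis = range (\<lambda>i::'n. axis i (1::real))" by (auto simp: Basis_vec_def)
  moreover have "inj (\<lambda>i::'n. axis i (1::real))" by (auto simp: inj_def axis_eq_axis)
  ultimately show ?thesis using prod.reindex[of "\<lambda>i::'n. axis i (1::real)" UNIV f] by (simp add: o_def)
qed

lemma continuous_on_vector3 [continuous_intros]:
  assumes "continuous_on A f" "continuous_on A g" "continuous_on A h"
  shows "continuous_on A (\<lambda>z. vector [f z, g z, h z] :: real^3)"
proof -
  have eq: "(\<lambda>z. vector [f z, g z, h z] :: real^3) = (\<lambda>z. \<chi> i. if i = 1 then f z else if i = 2 then g z else h z)"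
    by (auto simp: vec_eq_iff forall_3)
  have c: "continuous_on A (\<lambda>z. if i = 1 then f z else if i = 2 then g z else h z)" for i :: 3
    using assms by (cases "i = 1"; cases "i = 2") simp_all
  show ?thesis unfolding eq by (intro continuous_on_vec_lambda c)
qed

lemma borel_measurable_vector3:
  "(\<lambda>(t, x, y). vector [x, y, t] :: real^3) \<in> borel_measurable (lborel \<Otimes>\<^sub>M (lborel \<Otimes>\<^sub>M lborel))"
  unfolding case_prod_beta
  by (simp add: lborel_prod) (intro borel_measurable_continuous_onI continuous_intros)

lemma sigma_finite_lborel_pair: "sigma_finite_measure (lborel \<Otimes>\<^sub>M lborel :: (real \<times> real) measure)"
  unfolding lborel_prod by (rule lborel.sigma_finite_measure_axioms)

text \<open>The vertical coordinate \<open>t\<close> is put first, so that iterated integrals have horizontal planes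
  as their inner domain: there the square function below is a product of functions of \<open>x\<close>
  and of \<open>y\<close>.\<close>

lemma lborel_vec3:
  "(lborel :: (real^3) measure) =
     distr (lborel \<Otimes>\<^sub>M (lborel \<Otimes>\<^sub>M lborel)) borel (\<lambda>(t, x, y). vector [x, y, t])"
proof (rule lborel_eqI)
  let ?P = "lborel \<Otimes>\<^sub>M (lborel \<Otimes>\<^sub>M lborel) :: (real \<times> real \<times> real) measure"
  let ?g = "\<lambda>(t, x, y). vector [x, y, t] :: real^3"
  fix l u :: "real^3"
  assume le: "\<And>b. b \<in> Basis \<Longrightarrow> l \<bullet> b \<le> u \<bullet> b"
  have le': "l $ i \<le> u $ i" for i using le[of "axis i 1"] by (simp add: inner_axis)
  have "emeasure (distr ?P borel ?g) (box l u) = emeasure ?P (?g -` box l u \<inter> space ?P)"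
    using borel_measurable_vector3 by (intro emeasure_distr) auto
  also have "?g -` box l u \<inter> space ?P = {l$3<..<u$3} \<times> ({l$1<..<u$1} \<times> {l$2<..<u$2})"
    by (auto simp: space_pair_measure mem_box_cart forall_3)
  also have "emeasure ?P \<dots> = emeasure lborel {l$3<..<u$3} * (emeasure lborel {l$1<..<u$1} * emeasure lborel {l$2<..<u$2})"
    by (simp add: lborel.emeasure_pair_measure_Times
        sigma_finite_measure.emeasure_pair_measure_Times[OF sigma_finite_lborel_pair])
  also have "\<dots> = ennreal (\<Prod>b\<in>Basis. (u - l) \<bullet> b)"
  proof -
    have "(\<Prod>b\<in>Basis. (u - l) \<bullet> b) = (u$3 - l$3) * ((u$1 - l$1) * (u$2 - l$2))"
      unfolding prod_Basis_cart UNIV_3 by (simp add: inner_axis)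
    thus ?thesis using le'[of 1] le'[of 2] le'[of 3] by (simp add: ennreal_mult)
  qed
  finally show "emeasure (distr ?P borel ?g) (box l u) = ennreal (\<Prod>b\<in>Basis. (u - l) \<bullet> b)" .
qed simp

lemma nn_integral_vec3:
  fixes f :: "real^3 \<Rightarrow> ennreal"
  assumes [measurable]: "f \<in> borel_measurable borel"
  shows "(\<integral>\<^sup>+x. f x \<partial>lborel) = (\<integral>\<^sup>+t. \<integral>\<^sup>+x. \<integral>\<^sup>+y. f (vector [x, y, t]) \<partial>lborel \<partial>lborel \<partial>lborel)"
proof -
  note borel_measurable_vector3[measurable]
  have m: "(\<lambda>z. f ((\<lambda>(t, x, y). vector [x, y, t]) z)) \<in> borel_measurable (lborel \<Otimes>\<^sub>M (lborel \<Otimes>\<^sub>M lborel))"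
    by measurable
  have "(\<integral>\<^sup>+x. f x \<partial>lborel) = (\<integral>\<^sup>+z. f ((\<lambda>(t, x, y). vector [x, y, t]) z) \<partial>(lborel \<Otimes>\<^sub>M (lborel \<Otimes>\<^sub>M lborel)))"
    by (subst lborel_vec3, subst nn_integral_distr) (auto intro: borel_measurable_vector3)
  also have "\<dots> = (\<integral>\<^sup>+t. \<integral>\<^sup>+xy. f (vector [fst xy, snd xy, t]) \<partial>(lborel \<Otimes>\<^sub>M lborel) \<partial>lborel)"
    using m by (subst sigma_finite_measure.nn_integral_fst[OF sigma_finite_lborel_pair, symmetric]) (auto simp: case_prod_beta)
  also have "\<dots> = (\<integral>\<^sup>+t. \<integral>\<^sup>+x. \<integral>\<^sup>+y. f (vector [x, y, t]) \<partial>lborel \<partial>lborel \<partial>lborel)"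
  proof (rule nn_integral_cong)
    fix t :: real
    have "(\<lambda>xy. f (vector [fst xy, snd xy, t])) \<in> borel_measurable (lborel \<Otimes>\<^sub>M lborel)"
      by (rule measurable_compose[of _ _ borel])
         (auto simp: lborel_prod intro!: borel_measurable_continuous_onI continuous_intros)
    thus "(\<integral>\<^sup>+xy. f (vector [fst xy, snd xy, t]) \<partial>(lborel \<Otimes>\<^sub>M lborel)) = (\<integral>\<^sup>+x. \<integral>\<^sup>+y. f (vector [x, y, t]) \<partial>lborel \<partial>lborel)"
      by (subst lborel.nn_integral_fst[symmetric]) auto
  qed
  finally show ?thesis .
qed

text \<open>The weight of a ball centred at the origin is the case \<open>k = 100\<close>. The much slower decay
  \<open>k = 10\<close> gives a weight that is reproduced, up to constants, when the ball weights are
  averaged over their centres.\<close>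

definition decay :: "real \<Rightarrow> real \<Rightarrow> 'a::real_normed_vector \<Rightarrow> real" where
  "decay r k z = (1 + norm z / r) powr (- k)"

lemma continuous_on_decay [continuous_intros]:
  "r > 0 \<Longrightarrow> continuous_on A f \<Longrightarrow> continuous_on A (\<lambda>x. decay r k (f x))"
  unfolding decay_def
  by (intro continuous_intros) (auto simp: add_nonneg_eq_0_iff)

lemma borel_measurable_decay [measurable]:
  "(decay r k :: 'a::euclidean_space \<Rightarrow> real) \<in> borel_measurable borel"
  unfolding decay_def[abs_def] by measurable

lemma decay_nonneg [simp]: "decay r k z \<ge> 0" by (simp add: decay_def)

lemma decay_add: "decay r k z * decay r l z = decay r (k + l) z"
  by (simp add: decay_def powr_add[symmetric])

lemma decay_mono:
  assumes "r > 0" "k \<le> l" shows "decay r l z \<le> decay r k z"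
  unfolding decay_def by (rule powr_mono) (use assms in auto)

text \<open>The reason is \<open>1 + |x + y| / r \<le> (1 + |x| / r) (1 + |y| / r)\<close>.\<close>

lemma decay_submult:
  assumes "r > 0" "k \<ge> 0"
  shows "decay r k x * decay r k y \<le> decay r k (x + y)"
proof -
  have p: "1 + norm (x + y) / r > 0" using assms by (simp add: add_pos_nonneg)
  have "(1 + norm (x + y) / r) \<le> 1 + norm x / r + norm y / r"
    using divide_right_mono[OF norm_triangle_ineq[of x y], of r] assms by (simp add: add_divide_distrib)
  also have "\<dots> \<le> (1 + norm x / r) * (1 + norm y / r)"
    using assms by (simp add: algebra_simps)
  finally have "((1 + norm x / r) * (1 + norm y / r)) powr (- k) \<le> (1 + norm (x + y) / r) powr (- k)"
    using assms p by (intro powr_mono2') auto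
  thus ?thesis using assms by (simp add: decay_def powr_mult)
qed

lemma nn_integral_lborel_even:
  fixes f :: "real \<Rightarrow> ennreal"
  assumes [measurable]: "f \<in> borel_measurable borel" and even: "\<And>z. f (- z) = f z"
  shows "(\<integral>\<^sup>+z. f z \<partial>lborel) = 2 * (\<integral>\<^sup>+z. f z * indicator {0..} z \<partial>lborel)"
proof -
  have neg: "(\<integral>\<^sup>+z. f z * indicator {..0} z \<partial>lborel) = (\<integral>\<^sup>+z. f z * indicator {0..} z \<partial>lborel)"
  proof -
    have "(\<integral>\<^sup>+z. f z * indicator {..0} z \<partial>lborel) = (\<integral>\<^sup>+z. f (0 + (-1) * z) * indicator {..0} (0 + (-1) * z :: real) \<partial>lborel)"
      by (subst nn_integral_real_affine[where c = "-1" and t = 0]) simp_all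
    also have "\<dots> = (\<integral>\<^sup>+z. f z * indicator {0..} z \<partial>lborel)"
      by (intro nn_integral_cong) (auto simp: even indicator_def)
    finally show ?thesis .
  qed
  have "(\<integral>\<^sup>+z. f z \<partial>lborel) = (\<integral>\<^sup>+z. f z * indicator {0..} z + f z * indicator {..0} z \<partial>lborel)"
  proof (rule nn_integral_cong_AE)
    show "AE z in lborel. f z = f z * indicator {0..} z + f z * indicator {..0} z"
      using AE_lborel_singleton[of 0] by eventually_elim (auto simp: indicator_def)
  qed
  also have "\<dots> = 2 * (\<integral>\<^sup>+z. f z * indicator {0..} z \<partial>lborel)"
    by (subst nn_integral_add) (auto simp: neg mult_2)
  finally show ?thesis .
qed

lemma nn_integral_decay2_real:
  assumes "r > 0"
  shows "(\<integral>\<^sup>+z. ennreal (decay r 2 (z::real)) \<partial>lborel) = ennreal (2 * r)"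
proof -
  have half: "(\<integral>\<^sup>+z. ennreal (decay r 2 (z::real)) * indicator {0..} z \<partial>lborel) = ennreal r"
  proof -
    have "(\<integral>\<^sup>+z. ennreal (decay r 2 (z::real)) * indicator {0..} z \<partial>lborel)
        = (\<integral>\<^sup>+z. ennreal ((1 + z / r) powr (-2)) * indicator {0..} z \<partial>lborel)"
      by (intro nn_integral_cong) (auto simp: decay_def indicator_def)
    also have "\<dots> = ennreal (0 - (- r / (1 + 0 / r)))"
    proof (rule nn_integral_FTC_atLeast)
      show "(\<lambda>z. (1 + z / r) powr (-2)) \<in> borel_measurable borel" by measurable
      show "((\<lambda>z. - r / (1 + z / r)) has_real_derivative (1 + z / r) powr (-2)) (at z)" if "0 \<le> z" for z
      proof -
        have p: "1 + z / r > 0" using that assms by (simp add: add_pos_nonneg)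
        have "((\<lambda>z. - r / (1 + z / r)) has_real_derivative 1 / (1 + z / r)\<^sup>2) (at z)"
          using p assms by (auto intro!: derivative_eq_intros simp: power2_eq_square)
        thus ?thesis using p by (simp add: powr_minus_divide)
      qed
      have "filterlim (\<lambda>z. 1 + z / r) at_top at_top"
        using assms by (intro filterlim_tendsto_add_at_top[OF tendsto_const] filterlim_at_top_mult_tendsto_pos filterlim_ident)
           (auto simp: divide_inverse intro!: filterlim_at_top_mult_tendsto_pos[OF tendsto_const _ filterlim_ident])
      thus "((\<lambda>z. - r / (1 + z / r)) \<longlongrightarrow> 0) at_top"
        by (intro real_tendsto_divide_at_top[OF tendsto_const])
    qed (use assms in auto)
    finally show ?thesis by simp
  qed
  have "(\<integral>\<^sup>+z. ennreal (decay r 2 (z::real)) \<partial>lborel) = 2 * ennreal r"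
    by (subst nn_integral_lborel_even) (simp_all add: half, simp add: decay_def)
  thus ?thesis using assms by (simp add: ennreal_mult)
qed

lemma decay_vec3_le:
  assumes "r > 0" "k \<ge> 6"
  shows "decay r k (z :: real^3) \<le> decay r 2 (z $ 1) * decay r 2 (z $ 2) * decay r 2 (z $ 3)"
proof -
  have 1: "decay r 2 z \<le> decay r 2 (z $ i)" for i
    unfolding decay_def using component_le_norm_cart[of z i] assms
    by (intro powr_mono2') (auto simp: add_pos_nonneg divide_right_mono)
  have "decay r k z \<le> decay r 6 z" using assms by (intro decay_mono)
  also have "\<dots> = decay r 2 z * decay r 2 z * decay r 2 z" by (simp add: decay_add)
  also have "\<dots> \<le> decay r 2 (z $ 1) * decay r 2 (z $ 2) * decay r 2 (z $ 3)"
    by (intro mult_mono 1) auto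
  finally show ?thesis .
qed

lemma nn_integral_decay_vec3:
  assumes "r > 0" "k \<ge> 6"
  shows "(\<integral>\<^sup>+z. ennreal (decay r k (z :: real^3)) \<partial>lborel) \<le> ennreal (8 * r ^ 3)"
proof -
  have le: "ennreal (decay r k (vector [x, y, t] :: real^3)) \<le> ennreal (decay r 2 t) * (ennreal (decay r 2 x) * ennreal (decay r 2 y))" for t x y
    using decay_vec3_le[OF assms, of "vector [x, y, t]"]
    by (simp add: ennreal_mult[symmetric] ennreal_leI mult_ac)
  have "(\<integral>\<^sup>+z. ennreal (decay r k (z :: real^3)) \<partial>lborel)
     = (\<integral>\<^sup>+t. \<integral>\<^sup>+x. \<integral>\<^sup>+y. ennreal (decay r k (vector [x, y, t] :: real^3)) \<partial>lborel \<partial>lborel \<partial>lborel)"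
    by (rule nn_integral_vec3) measurable
  also have "\<dots> \<le> (\<integral>\<^sup>+t. \<integral>\<^sup>+x. \<integral>\<^sup>+y. ennreal (decay r 2 (t::real)) * (ennreal (decay r 2 (x::real)) * ennreal (decay r 2 (y::real))) \<partial>lborel \<partial>lborel \<partial>lborel)"
    by (intro nn_integral_mono le)
  also have "\<dots> = ennreal (2 * r) * (ennreal (2 * r) * ennreal (2 * r))"
    by (simp add: nn_integral_cmult nn_integral_multc nn_integral_decay2_real[OF assms(1)])
  also have "\<dots> = ennreal (8 * r ^ 3)"
    using assms by (simp add: ennreal_mult[symmetric] power3_eq_cube mult_ac)
  finally show ?thesis .
qed

section \<open>Partitions from cyclic shifts\<close>

text \<open>The squares are listed in consecutive groups of \<open>K\<close>. Part number \<open>j\<close> takes from group \<open>g\<close>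
  the square in position \<open>j + h g\<close>, counted cyclically. For fixed \<open>h\<close> the parts with
  \<open>1 \<le> j \<le> K\<close> form a partition, whatever the shifts are, and the shifts of different groups
  can be chosen independently.\<close>

definition shifted_index :: "nat \<Rightarrow> (nat \<Rightarrow> nat) \<Rightarrow> nat \<Rightarrow> nat \<Rightarrow> nat" where
  "shifted_index K h j g = g * K + (j + h g) mod K"

definition shifted_part :: "nat \<Rightarrow> nat \<Rightarrow> nat \<Rightarrow> (nat \<Rightarrow> nat) \<Rightarrow> nat \<Rightarrow> (real^2) set set" where
  "shifted_part N K M h j = cell N ` shifted_index K h j ` {..<M}"

lemma shifted_index_inj:
  assumes "K > 0" "j \<in> {1..K}" "j' \<in> {1..K}" "shifted_index K h j g = shifted_index K h j' g'"
  shows "j = j' \<and> g = g'"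
proof -
  have "shifted_index K h i g div K = g" for i g using assms(1) by (simp add: shifted_index_def)
  hence g: "g = g'" using assms(4) by metis
  hence m: "(h g + j) mod K = (h g + j') mod K" using assms(4) by (simp add: shifted_index_def add.commute)
  have "j = j'"
  proof (cases "j \<le> j'")
    case True
    show ?thesis by (rule add_mod_cancel[OF True _ m]) (use assms in simp)
  next
    case False
    have "j' = j" by (rule add_mod_cancel[OF _ _ m[symmetric]]) (use assms False in simp_all)
    thus ?thesis by simp
  qed
  thus ?thesis using g by simp
qed

lemma shifted_index_less:
  assumes "K > 0" "g < M" shows "shifted_index K h j g < K * M"
proof -
  have "shifted_index K h j g < g * K + K" using assms by (simp add: shifted_index_def)
  also have "\<dots> = K * (g + 1)" by simp
  also have "\<dots> \<le> K * M" using assms by (intro mult_left_mono) auto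
  finally show ?thesis .
qed

lemma shifted_index_onto:
  assumes "K > 0"
  shows "(\<lambda>(j, g). shifted_index K h j g) ` ({1..K} \<times> {..<M}) = {..<K * M}"
proof (rule card_subset_eq)
  have "inj_on (\<lambda>(j, g). shifted_index K h j g) ({1..K} \<times> {..<M})"
  proof (rule inj_onI, clarify)
    fix j g j' g'
    assume "shifted_index K h j g = shifted_index K h j' g'" "j \<in> {1..K}" "j' \<in> {1..K}"
    thus "j = j' \<and> g = g'" by (intro shifted_index_inj[OF assms]) auto
  qed
  thus "card ((\<lambda>(j, g). shifted_index K h j g) ` ({1..K} \<times> {..<M})) = card {..<K * M}"
    by (simp add: card_image)
qed (use shifted_index_less[OF assms] in auto)

lemma shifted_partition:
  assumes N: "N > 0" and K: "K > 0" and M: "M > 0" and NKM: "N\<^sup>2 = K * M"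
  shows "M_set_partition (N\<^sup>2) M (shifted_part N K M h)"
proof -
  have RM: "N\<^sup>2 div M = K" using NKM M by simp
  have inj: "inj (cell N)" by (rule inj_cell[OF N])
  have "M_set (N\<^sup>2) M (shifted_part N K M h j)" if "j \<in> {1..K}" for j
  proof -
    have "inj_on (shifted_index K h j) {..<M}"
      using shifted_index_inj[OF K that that] by (intro inj_onI) blast
    hence "card (shifted_part N K M h j) = M"
      unfolding shifted_part_def by (simp add: card_image inj_on_subset[OF inj])
    moreover have "shifted_part N K M h j \<subseteq> grid (N\<^sup>2)"
      unfolding grid_eq_cells[OF N] shifted_part_def using shifted_index_less[OF K] NKM by auto
    ultimately show ?thesis by (simp add: M_set_def shifted_part_def)
  qed
  moreover have "disjoint_family_on (shifted_part N K M h) {1..K}"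
    unfolding disjoint_family_on_def
  proof (intro ballI impI)
    fix j j' assume j: "j \<in> {1..K}" "j' \<in> {1..K}" "j \<noteq> j'"
    have "shifted_index K h j g \<noteq> shifted_index K h j' g'" for g g'
      using shifted_index_inj[OF K j(1,2), of h g g'] j(3) by auto
    thus "shifted_part N K M h j \<inter> shifted_part N K M h j' = {}"
      unfolding shifted_part_def using inj by (auto simp: inj_def)
  qed
  moreover have "(\<Union>j\<in>{1..K}. shifted_part N K M h j) = grid (N\<^sup>2)"
  proof -
    have "(\<Union>j\<in>{1..K}. shifted_part N K M h j) = cell N ` (\<lambda>(j, g). shifted_index K h j g) ` ({1..K} \<times> {..<M})"
      unfolding shifted_part_def by auto
    thus ?thesis by (simp only: shifted_index_onto[OF K] grid_eq_cells[OF N] NKM[symmetric])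
  qed
  ultimately show ?thesis unfolding M_set_partition_def RM by blast
qed

definition square_function :: "nat \<Rightarrow> (real^2 \<Rightarrow> complex) \<Rightarrow> real^3 \<Rightarrow> real" where
  "square_function N F x = sqrt (\<Sum>a<N\<^sup>2. (norm (extension_on (cell N a) F x))\<^sup>2)"

lemma integrable_on_cell:
  fixes F :: "real^2 \<Rightarrow> complex"
  assumes "N > 0" "a < N\<^sup>2" "integrable (lebesgue_on unit_square) F"
  shows "integrable (lebesgue_on (cell N a)) F"
  using cell_subset_unit_square[OF assms(1,2)]
  by (intro integrable_lebesgue_on_subset[OF assms(3)]) (auto simp: unit_square_def)

lemma continuous_on_square_function:
  assumes "N > 0" "integrable (lebesgue_on unit_square) F"
  shows "continuous_on UNIV (square_function N F)"
  unfolding square_function_def using assms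
  by (intro continuous_intros continuous_on_extension_on integrable_on_cell) auto

lemma extension_eq_sum_cells:
  assumes "N > 0" "integrable (lebesgue_on unit_square) F"
  shows "extension F x = (\<Sum>a<N\<^sup>2. extension_on (cell N a) F x)"
  using extension_on_Union_cells[OF assms(1) subset_refl assms(2), of x] Union_cells[OF assms(1)] by simp

lemma sum_lessThan_mult:
  fixes \<phi> :: "nat \<Rightarrow> 'z::comm_monoid_add"
  shows "(\<Sum>g<M. \<Sum>k<K. \<phi> (g * K + k)) = (\<Sum>a<K * M. \<phi> a)"
proof -
  have "(\<Sum>k<K. \<phi> (g * K + k)) = sum \<phi> {g * K..<g * K + K}" for g
    using sum.shift_bounds_nat_ivl[of \<phi> 0 "g * K" K] by (simp add: atLeast0LessThan add.commute)
  thus ?thesis using sum.nat_group[of \<phi> K M] by (simp add: mult.commute)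
qed

text \<open>Averaged over all shifts, the contribution of one part is that of \<open>extension F x / K\<close>, as if
  the squares were distributed perfectly evenly, plus a fluctuation which is controlled by the
  square function.\<close>

lemma average_over_shifted_partitions:
  assumes N: "N > 0" and K: "K > 0" and NKM: "N\<^sup>2 = K * M"
    and F: "integrable (lebesgue_on unit_square) F"
  shows "(\<Sum>h\<in>PiE {..<M} (\<lambda>_. {..<K}). \<Sum>j=1..K. norm (extension_on (\<Union>(shifted_part N K M h j)) F x) ^ 3)
    \<le> real K ^ M * (real K * (4 / real K ^ 3 * norm (extension F x) ^ 3 + 80 * square_function N F x ^ 3))"
proof -
  let ?H = "PiE {..<M} (\<lambda>_. {..<K})"
  define f where "f g k = extension_on (cell N (g * K + k)) F x" for g k
  have group: "(\<Sum>g<M. \<Sum>k<K. \<phi> (g * K + k)) = (\<Sum>a<N\<^sup>2. \<phi> a)" for \<phi> :: "nat \<Rightarrow> 'z::comm_monoid_add"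
    unfolding NKM by (rule sum_lessThan_mult)
  have part: "extension_on (\<Union>(shifted_part N K M h j)) F x = (\<Sum>g<M. f g ((j + h g) mod K))"
    if "j \<in> {1..K}" for h j
  proof -
    have "shifted_index K h j ` {..<M} \<subseteq> {..<N\<^sup>2}" using shifted_index_less[OF K] NKM by auto
    from extension_on_Union_cells[OF N this F, of x]
    have "extension_on (\<Union>(shifted_part N K M h j)) F x = (\<Sum>a\<in>shifted_index K h j ` {..<M}. extension_on (cell N a) F x)"
      by (simp add: shifted_part_def)
    also have "\<dots> = (\<Sum>g<M. extension_on (cell N (shifted_index K h j g)) F x)"
      using shifted_index_inj[OF K that that] by (subst sum.reindex) (blast intro: inj_onI, simp)
    finally show ?thesis by (simp add: f_def shifted_index_def)
  qed
  have tot: "(\<Sum>g<M. \<Sum>k<K. f g k) = extension F x"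
    unfolding f_def extension_eq_sum_cells[OF N F] by (rule group)
  have sq: "sqrt (\<Sum>g<M. \<Sum>k<K. (norm (f g k))\<^sup>2) = square_function N F x"
    unfolding f_def square_function_def by (rule arg_cong[where f = sqrt], rule group)
  have "(\<Sum>h\<in>?H. \<Sum>j=1..K. norm (extension_on (\<Union>(shifted_part N K M h j)) F x) ^ 3)
      = (\<Sum>h\<in>?H. \<Sum>j=1..K. norm (\<Sum>g<M. f g ((j + h g) mod K)) ^ 3)"
    by (intro sum.cong refl) (simp add: part)
  also have "\<dots> = (\<Sum>j=1..K. \<Sum>h\<in>?H. norm (\<Sum>g<M. f g ((j + h g) mod K)) ^ 3)"
    by (rule sum.swap)
  also have "\<dots> \<le> (\<Sum>j=1..K. real K ^ M * (4 / real K ^ 3 * norm (extension F x) ^ 3 + 80 * square_function N F x ^ 3))"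
    using third_moment_shifted_sampling[OF K, where m = M and f = f] by (intro sum_mono) (simp add: tot sq)
  finally show ?thesis by (simp add: mult_ac)
qed

section \<open>Averaging over partitions and over ball centres\<close>

lemma Lp_norm_3_cubed:
  assumes f: "continuous_on UNIV f" and w: "w \<in> borel_measurable borel" "\<And>x. w x \<ge> 0"
  shows "Lp_norm 3 w f ^ 3 = (LINT x|lborel. norm (f x) ^ 3 * w x)"
proof -
  have fm: "f \<in> borel_measurable borel" using f by (rule borel_measurable_continuous_onI)
  have p3: "norm (f x) powr 3 = norm (f x) ^ 3" for x
    by (cases "f x = 0") (auto simp: powr_numeral)
  have "(LINT x|lebesgue. norm (f x) powr 3 * w x) = (LINT x|lborel. norm (f x) ^ 3 * w x)"
  proof -
    have "(\<lambda>x. norm (f x) ^ 3 * w x) \<in> borel_measurable lborel" using fm w(1) by simp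
    thus ?thesis unfolding p3 by (rule integral_completion)
  qed
  moreover have nn: "(LINT x|lborel. norm (f x) ^ 3 * w x) \<ge> 0"
    using w by (intro Bochner_Integration.integral_nonneg) auto
  ultimately have "Lp_norm 3 w f ^ 3 = ((LINT x|lborel. norm (f x) ^ 3 * w x) powr (1/3)) ^ 3"
    by (simp add: Lp_norm_def)
  also have "\<dots> = (LINT x|lborel. norm (f x) ^ 3 * w x)"
    using nn by (cases "(LINT x|lborel. norm (f x) ^ 3 * w x) = 0")
      (auto simp: powr_powr simp flip: powr_numeral)
  finally show ?thesis .
qed

lemma nn_integral_lborel_shift:
  fixes f :: "'a::euclidean_space \<Rightarrow> ennreal"
  assumes [measurable]: "f \<in> borel_measurable borel"
  shows "(\<integral>\<^sup>+x. f (x - c) \<partial>lborel) = (\<integral>\<^sup>+x. f x \<partial>lborel)"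
proof -
  have "(\<integral>\<^sup>+x. f (x - c) \<partial>lborel) = (\<integral>\<^sup>+x. f (x - c) \<partial>distr lborel borel ((+) c))"
    by (simp only: lborel_distr_plus)
  also have "\<dots> = (\<integral>\<^sup>+x. f x \<partial>lborel)" by (subst nn_integral_distr) simp_all
  finally show ?thesis .
qed

lemma ball_weight_eq_decay: "ball_weight c r x = decay r 100 (x - c)"
  by (simp add: ball_weight_def decay_def)

lemma integrable_decay_vec3:
  assumes "r > 0" "k \<ge> 6"
  shows "integrable lborel (\<lambda>x::real^3. decay r k (x - c))"
proof (rule integrableI_nonneg)
  show "(\<lambda>x. decay r k (x - c)) \<in> borel_measurable lborel"
    by simp
  have m: "(\<lambda>x::real^3. ennreal (decay r k x)) \<in> borel_measurable borel"
    by measurable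
  have "(\<integral>\<^sup>+x. ennreal (decay r k (x - c)) \<partial>lborel) = (\<integral>\<^sup>+x. ennreal (decay r k (x :: real^3)) \<partial>lborel)"
    by (rule nn_integral_lborel_shift[OF m])
  also have "\<dots> < \<infinity>" using nn_integral_decay_vec3[OF assms] by (rule le_less_trans) simp
  finally show "(\<integral>\<^sup>+x. ennreal (decay r k (x - c)) \<partial>lborel) < \<infinity>" .
qed simp

lemma integrable_bounded_mult:
  fixes f w :: "'a::euclidean_space \<Rightarrow> real"
  assumes "f \<in> borel_measurable borel" "\<And>x. norm (f x) \<le> B" "integrable lborel w"
  shows "integrable lborel (\<lambda>x. f x * w x)"
proof (rule Bochner_Integration.integrable_bound)
  show "integrable lborel (\<lambda>x. B * w x)" using assms by simp
  show "(\<lambda>x. f x * w x) \<in> borel_measurable lborel" using assms by simp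
  have "B \<ge> 0" using assms(2)[of undefined] norm_ge_zero order_trans by blast
  thus "AE x in lborel. norm (f x * w x) \<le> norm (B * w x)"
    using assms(2) by (auto simp: abs_mult intro!: mult_right_mono)
qed

lemma integrable_extension_cube:
  fixes w :: "real^3 \<Rightarrow> real"
  assumes "integrable (lebesgue_on S) F" "integrable lborel w"
  shows "integrable lborel (\<lambda>x. norm (extension_on S F x) ^ 3 * w x)"
proof (rule integrable_bounded_mult[OF _ _ assms(2)])
  show "(\<lambda>x. norm (extension_on S F x) ^ 3) \<in> borel_measurable borel"
    by (intro borel_measurable_continuous_onI continuous_intros continuous_on_extension_on assms)
  show "norm (norm (extension_on S F x) ^ 3) \<le> (LINT \<xi>|lebesgue_on S. norm (F \<xi>)) ^ 3" for x
    using norm_extension_on_le[of S F x] by (simp add: power_mono)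
qed

lemma square_function_nonneg [simp]: "square_function N F x \<ge> 0"
  by (simp add: square_function_def sum_nonneg)

lemma square_function_bounded: "\<exists>B. \<forall>x. square_function N F x \<le> B"
proof (intro exI allI)
  fix x
  show "square_function N F x \<le> sqrt (\<Sum>a<N\<^sup>2. (LINT \<xi>|lebesgue_on (cell N a). norm (F \<xi>))\<^sup>2)"
    unfolding square_function_def
    by (intro real_sqrt_le_mono sum_mono power_mono norm_extension_on_le) auto
qed

lemma integrable_square_function_cube:
  fixes w :: "real^3 \<Rightarrow> real"
  assumes "N > 0" "integrable (lebesgue_on unit_square) F" "integrable lborel w"
  shows "integrable lborel (\<lambda>x. square_function N F x ^ 3 * w x)"
proof -
  obtain B where B: "\<And>x. square_function N F x \<le> B" using square_function_bounded[of N F] by blast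
  show ?thesis
  proof (rule integrable_bounded_mult[OF _ _ assms(3)])
    show "(\<lambda>x. square_function N F x ^ 3) \<in> borel_measurable borel"
      by (intro borel_measurable_continuous_onI continuous_intros continuous_on_square_function assms)
    show "norm (square_function N F x ^ 3) \<le> B ^ 3" for x
      using B[of x] by (simp add: power_mono)
  qed
qed

text \<open>The assumed inequality is used for every partition made of cyclic shifts, and the results are
  averaged. The factor \<open>real K\<close> counts the parts.\<close>

lemma randomised_inequality:
  assumes N: "N > 0" and K: "K > 0" and M: "M > 0" and NKM: "N\<^sup>2 = K * M"
    and F: "integrable (lebesgue_on unit_square) F" and B: "B \<ge> 0" and r: "r > 0"
    and hyp: "\<And>P. M_set_partition (N\<^sup>2) M P \<Longrightarrow>
       Lp_norm 3 (indicator (ball c r)) (extension F) ^ 3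
         \<le> B * (\<Sum>j=1..K. Lp_norm 3 (ball_weight c r) (extension_on (\<Union>(P j)) F) ^ 3)"
  shows "(LINT x|lborel. norm (extension F x) ^ 3 * indicator (ball c r) x)
    \<le> (LINT x|lborel. B * real K * (4 / real K ^ 3 * norm (extension F x) ^ 3 + 80 * square_function N F x ^ 3) * decay r 100 (x - c))"
proof -
  let ?H = "PiE {..<M} (\<lambda>_. {..<K})"
  let ?L = "LINT x|lborel. norm (extension F x) ^ 3 * indicator (ball c r) x"
  let ?G = "\<lambda>x. 4 / real K ^ 3 * norm (extension F x) ^ 3 + 80 * square_function N F x ^ 3"
  let ?X = "\<lambda>h j x. norm (extension_on (\<Union>(shifted_part N K M h j)) F x) ^ 3"
  let ?w = "\<lambda>x. decay r 100 (x - c)"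
  have wint: "integrable lborel ?w" using r by (intro integrable_decay_vec3) auto
  have wm: "?w \<in> borel_measurable borel" using wint by (auto dest: borel_measurable_integrable)
  have Fp: "integrable (lebesgue_on (\<Union>(shifted_part N K M h j))) F" if "j \<in> {1..K}" for h j
  proof (rule integrable_lebesgue_on_subset[OF F])
    have "M_set (N\<^sup>2) M (shifted_part N K M h j)"
      using shifted_partition[OF N K M NKM, of h] that NKM M by (simp add: M_set_partition_def)
    hence *: "shifted_part N K M h j \<subseteq> grid (N\<^sup>2)" "finite (shifted_part N K M h j)" by (auto simp: M_set_def)
    show "\<Union>(shifted_part N K M h j) \<subseteq> unit_square" using *(1) by (auto simp: grid_def)
    show "\<Union>(shifted_part N K M h j) \<in> sets lebesgue"
      by (auto simp: shifted_part_def)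
  qed (simp add: unit_square_def)
  have Xint: "integrable lborel (\<lambda>x. ?X h j x * ?w x)" if "j \<in> {1..K}" for h j
    using Fp[OF that] wint by (rule integrable_extension_cube)
  have each: "?L \<le> (LINT x|lborel. B * ((\<Sum>j=1..K. ?X h j x) * ?w x))" for h
  proof -
    have "?L = Lp_norm 3 (indicator (ball c r)) (extension F) ^ 3"
      by (rule Lp_norm_3_cubed[symmetric]) (auto intro!: continuous_on_extension_on F borel_measurable_indicator borel_open)
    also have "\<dots> \<le> B * (\<Sum>j=1..K. Lp_norm 3 (ball_weight c r) (extension_on (\<Union>(shifted_part N K M h j)) F) ^ 3)"
      by (intro hyp shifted_partition N K M NKM)
    also have "(\<Sum>j=1..K. Lp_norm 3 (ball_weight c r) (extension_on (\<Union>(shifted_part N K M h j)) F) ^ 3)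
        = (\<Sum>j=1..K. (LINT x|lborel. ?X h j x * ?w x))"
      using wm by (intro sum.cong refl, subst Lp_norm_3_cubed)
        (auto simp: ball_weight_eq_decay[abs_def] intro!: continuous_on_extension_on Fp)
    also have "\<dots> = (LINT x|lborel. (\<Sum>j=1..K. ?X h j x) * ?w x)"
      unfolding sum_distrib_right by (rule Bochner_Integration.integral_sum[symmetric]) (rule Xint)
    finally show ?thesis by simp
  qed
  have Eint: "integrable lborel (\<lambda>x. norm (extension F x) ^ 3 * ?w x)"
    using F wint by (rule integrable_extension_cube)
  have Sint: "integrable lborel (\<lambda>x. square_function N F x ^ 3 * ?w x)"
    using N F wint by (rule integrable_square_function_cube)
  have Gint: "integrable lborel (\<lambda>x. ?G x * ?w x)"
    using Bochner_Integration.integrable_add[OF integrable_mult_right[OF Eint, of "4 / real K ^ 3"] integrable_mult_right[OF Sint, of 80]]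
    by (simp add: algebra_simps)
  have sint: "integrable lborel (\<lambda>x. B * ((\<Sum>j=1..K. ?X h j x) * ?w x))" for h
    unfolding sum_distrib_right by (intro integrable_mult_right Bochner_Integration.integrable_sum Xint)
  have cardH: "real (card ?H) = real K ^ M" by (simp add: card_PiE)
  have "real K ^ M * ?L = (\<Sum>h\<in>?H. ?L)" by (simp add: cardH)
  also have "\<dots> \<le> (\<Sum>h\<in>?H. (LINT x|lborel. B * ((\<Sum>j=1..K. ?X h j x) * ?w x)))"
    by (intro sum_mono each)
  also have "\<dots> = (LINT x|lborel. (\<Sum>h\<in>?H. B * ((\<Sum>j=1..K. ?X h j x) * ?w x)))"
    by (rule Bochner_Integration.integral_sum[symmetric]) (rule sint)
  also have "\<dots> \<le> (LINT x|lborel. real K ^ M * (B * real K * ?G x * ?w x))"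
  proof (rule integral_mono)
    show "integrable lborel (\<lambda>x. \<Sum>h\<in>?H. B * ((\<Sum>j=1..K. ?X h j x) * ?w x))"
      by (intro Bochner_Integration.integrable_sum sint)
    show "integrable lborel (\<lambda>x. real K ^ M * (B * real K * ?G x * ?w x))"
      using integrable_mult_right[OF Gint, of "real K ^ M * (B * real K)"] by (simp add: mult_ac)
    fix x
    have "(\<Sum>h\<in>?H. B * ((\<Sum>j=1..K. ?X h j x) * ?w x)) = B * ?w x * (\<Sum>h\<in>?H. \<Sum>j=1..K. ?X h j x)"
      by (simp add: sum_distrib_left mult_ac)
    also have "\<dots> \<le> B * ?w x * (real K ^ M * (real K * ?G x))"
      using average_over_shifted_partitions[OF N K NKM F, of x] B by (intro mult_left_mono) auto
    finally show "(\<Sum>h\<in>?H. B * ((\<Sum>j=1..K. ?X h j x) * ?w x)) \<le> real K ^ M * (B * real K * ?G x * ?w x)"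
      by (simp add: mult_ac)
  qed
  also have "\<dots> = real K ^ M * (LINT x|lborel. B * real K * ?G x * ?w x)" by simp
  finally show ?thesis using K by simp
qed

lemma decay_mass_lower:
  assumes "r > 0"
  shows "ennreal (r ^ 3 / 256 * decay r 10 (x :: real^3))
     \<le> (\<integral>\<^sup>+c. ennreal (decay r 10 c) * indicator (ball c r) x \<partial>lborel)"
proof -
  have "ennreal (r ^ 3 / 256 * decay r 10 x) \<le> ennreal (decay r 10 x / 1024) * ennreal (unit_ball_vol (real DIM(real^3)) * r ^ DIM(real^3))"
  proof -
    have "4 \<le> unit_ball_vol 3" using pi_gt3 by (simp add: unit_ball_vol_3)
    hence "r ^ 3 / 256 * decay r 10 x \<le> decay r 10 x / 1024 * (unit_ball_vol 3 * r ^ 3)"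
      using assms mult_right_mono[of 4 "unit_ball_vol 3" "decay r 10 x / 1024 * r ^ 3"] by (simp add: mult_ac)
    thus ?thesis using assms by (simp add: ennreal_mult[symmetric] ennreal_leI)
  qed
  also have "\<dots> = (\<integral>\<^sup>+c. ennreal (decay r 10 x / 1024) * indicator (ball x r) c \<partial>lborel)"
    using assms by (subst nn_integral_cmult_indicator) (auto simp: emeasure_ball)
  also have "\<dots> \<le> (\<integral>\<^sup>+c. ennreal (decay r 10 c) * indicator (ball c r) x \<partial>lborel)"
  proof (rule nn_integral_mono)
    fix c :: "real^3"
    have "decay r 10 x / 1024 \<le> decay r 10 c" if d: "dist x c < r"
    proof -
      have "decay r 10 x * decay r 10 (c - x) \<le> decay r 10 (x + (c - x))"
        using assms by (intro decay_submult) auto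
      moreover have "1 / 1024 \<le> decay r 10 (c - x)"
      proof -
        have "norm (c - x) / r \<le> 1" using d assms by (simp add: dist_norm norm_minus_commute)
        hence "(2::real) powr (- 10) \<le> decay r 10 (c - x)"
          unfolding decay_def using assms by (intro powr_mono2') (auto simp: add_pos_nonneg)
        thus ?thesis by (simp add: powr_minus_divide)
      qed
      ultimately show ?thesis
        using mult_left_mono[of "1 / 1024" "decay r 10 (c - x)" "decay r 10 x"] by simp
    qed
    thus "ennreal (decay r 10 x / 1024) * indicator (ball x r) c \<le> ennreal (decay r 10 c) * indicator (ball c r) x"
      by (auto simp: indicator_def dist_commute ennreal_leI)
  qed
  finally show ?thesis .
qed

text \<open>Of the decay of order \<open>100\<close>, order \<open>10\<close> is spent on moving the weight from \<open>c\<close> to \<open>x\<close>; the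
  remaining order \<open>90\<close> is integrable.\<close>

lemma decay_mass_upper:
  assumes "r > 0"
  shows "(\<integral>\<^sup>+c. ennreal (decay r 10 c) * ennreal (decay r 100 (x - c)) \<partial>lborel)
     \<le> ennreal (8 * r ^ 3 * decay r 10 (x :: real^3))"
proof -
  have m: "(\<lambda>c::real^3. ennreal (decay r 90 c)) \<in> borel_measurable borel"
    by measurable
  have m': "(\<lambda>c::real^3. ennreal (decay r 90 (c - x))) \<in> borel_measurable lborel"
    by measurable
  have "(\<integral>\<^sup>+c. ennreal (decay r 10 c) * ennreal (decay r 100 (x - c)) \<partial>lborel)
      \<le> (\<integral>\<^sup>+c. ennreal (decay r 10 x) * ennreal (decay r 90 (c - x)) \<partial>lborel)"
  proof (rule nn_integral_mono)
    fix c :: "real^3"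
    have "decay r 10 c * decay r 100 (x - c) = decay r 10 c * decay r 10 (x - c) * decay r 90 (c - x)"
      using decay_add[of r 10 "x - c" 90] by (simp add: decay_def norm_minus_commute)
    also have "\<dots> \<le> decay r 10 (c + (x - c)) * decay r 90 (c - x)"
      using assms by (intro mult_right_mono decay_submult) auto
    finally show "ennreal (decay r 10 c) * ennreal (decay r 100 (x - c)) \<le> ennreal (decay r 10 x) * ennreal (decay r 90 (c - x))"
      by (simp add: ennreal_mult[symmetric] ennreal_leI)
  qed
  also have "\<dots> = ennreal (decay r 10 x) * (\<integral>\<^sup>+c. ennreal (decay r 90 (c - x)) \<partial>lborel)"
    using m' by (rule nn_integral_cmult)
  also have "\<dots> = ennreal (decay r 10 x) * (\<integral>\<^sup>+c. ennreal (decay r 90 (c :: real^3)) \<partial>lborel)"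
    using nn_integral_lborel_shift[OF m, of x] by simp
  also have "\<dots> \<le> ennreal (decay r 10 x) * ennreal (8 * r ^ 3)"
    using assms by (intro mult_left_mono nn_integral_decay_vec3) auto
  also have "\<dots> = ennreal (8 * r ^ 3 * decay r 10 x)"
    using assms by (simp add: ennreal_mult[symmetric] mult_ac)
  finally show ?thesis .
qed

text \<open>An inequality that bounds a sharp cutoff to a ball by a weight with tails cannot be
  iterated or absorbed. Integrating it in the centre \<open>c\<close> against \<open>decay r 10\<close> produces the
  same weight on both sides.\<close>

lemma average_over_balls:
  fixes f g :: "real^3 \<Rightarrow> real"
  assumes r: "r > 0" and f: "continuous_on UNIV f" "\<And>x. f x \<ge> 0"
    and g: "continuous_on UNIV g" "\<And>x. g x \<ge> 0"
    and le: "\<And>c. (\<integral>\<^sup>+x. ennreal (f x) * indicator (ball c r) x \<partial>lborel)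
        \<le> (\<integral>\<^sup>+x. ennreal (g x) * ennreal (decay r 100 (x - c)) \<partial>lborel)"
  shows "(\<integral>\<^sup>+x. ennreal (f x * decay r 10 x) \<partial>lborel) \<le> 2048 * (\<integral>\<^sup>+x. ennreal (g x * decay r 10 x) \<partial>lborel)"
proof -
  have [measurable]: "f \<in> borel_measurable borel" "g \<in> borel_measurable borel"
    using f(1) g(1) by (auto intro: borel_measurable_continuous_onI)
  have "(\<integral>\<^sup>+x. ennreal (r ^ 3 / 256) * ennreal (f x * decay r 10 x) \<partial>lborel)
      \<le> (\<integral>\<^sup>+x. ennreal (f x) * (\<integral>\<^sup>+c. ennreal (decay r 10 c) * indicator (ball c r) x \<partial>lborel) \<partial>lborel)"
  proof (rule nn_integral_mono)
    fix x
    have "ennreal (r ^ 3 / 256) * ennreal (f x * decay r 10 x) = ennreal (f x) * ennreal (r ^ 3 / 256 * decay r 10 x)"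
      using r f(2)[of x] by (simp add: ennreal_mult[symmetric] mult_ac)
    also have "\<dots> \<le> ennreal (f x) * (\<integral>\<^sup>+c. ennreal (decay r 10 c) * indicator (ball c r) x \<partial>lborel)"
      by (intro mult_left_mono decay_mass_lower r) auto
    finally show "ennreal (r ^ 3 / 256) * ennreal (f x * decay r 10 x)
      \<le> ennreal (f x) * (\<integral>\<^sup>+c. ennreal (decay r 10 c) * indicator (ball c r) x \<partial>lborel)" .
  qed
  also have "\<dots> = (\<integral>\<^sup>+x. \<integral>\<^sup>+c. ennreal (decay r 10 c) * (ennreal (f x) * (if dist c x < r then 1 else 0)) \<partial>lborel \<partial>lborel)"
    by (subst nn_integral_cmult[symmetric]) (auto simp: indicator_def mult_ac intro!: nn_integral_cong)
  also have "\<dots> = (\<integral>\<^sup>+c. \<integral>\<^sup>+x. ennreal (decay r 10 c) * (ennreal (f x) * (if dist c x < r then 1 else 0)) \<partial>lborel \<partial>lborel)"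
    by (rule lborel_pair.Fubini') measurable
  also have "\<dots> = (\<integral>\<^sup>+c. ennreal (decay r 10 c) * (\<integral>\<^sup>+x. ennreal (f x) * indicator (ball c r) x \<partial>lborel) \<partial>lborel)"
    by (subst nn_integral_cmult) (auto simp: indicator_def intro!: nn_integral_cong arg_cong2[where f = times])
  also have "\<dots> \<le> (\<integral>\<^sup>+c. ennreal (decay r 10 c) * (\<integral>\<^sup>+x. ennreal (g x) * ennreal (decay r 100 (x - c)) \<partial>lborel) \<partial>lborel)"
    by (intro nn_integral_mono mult_left_mono le) auto
  also have "\<dots> = (\<integral>\<^sup>+c. \<integral>\<^sup>+x. ennreal (decay r 10 c) * (ennreal (g x) * ennreal (decay r 100 (x - c))) \<partial>lborel \<partial>lborel)"
    by (subst nn_integral_cmult) auto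
  also have "\<dots> = (\<integral>\<^sup>+x. \<integral>\<^sup>+c. ennreal (decay r 10 c) * (ennreal (g x) * ennreal (decay r 100 (x - c))) \<partial>lborel \<partial>lborel)"
    by (rule lborel_pair.Fubini'[symmetric]) measurable
  also have "\<dots> = (\<integral>\<^sup>+x. ennreal (g x) * (\<integral>\<^sup>+c. ennreal (decay r 10 c) * ennreal (decay r 100 (x - c)) \<partial>lborel) \<partial>lborel)"
    by (subst nn_integral_cmult[symmetric]) (auto simp: mult_ac)
  also have "\<dots> \<le> (\<integral>\<^sup>+x. ennreal (8 * r ^ 3) * ennreal (g x * decay r 10 x) \<partial>lborel)"
  proof (rule nn_integral_mono)
    fix x
    have "ennreal (g x) * (\<integral>\<^sup>+c. ennreal (decay r 10 c) * ennreal (decay r 100 (x - c)) \<partial>lborel)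
       \<le> ennreal (g x) * ennreal (8 * r ^ 3 * decay r 10 x)"
      by (intro mult_left_mono decay_mass_upper r) auto
    also have "\<dots> = ennreal (8 * r ^ 3) * ennreal (g x * decay r 10 x)"
      using r g(2)[of x] by (simp add: ennreal_mult[symmetric] mult_ac)
    finally show "ennreal (g x) * (\<integral>\<^sup>+c. ennreal (decay r 10 c) * ennreal (decay r 100 (x - c)) \<partial>lborel)
       \<le> ennreal (8 * r ^ 3) * ennreal (g x * decay r 10 x)" .
  qed
  also have "\<dots> = ennreal (8 * r ^ 3) * (\<integral>\<^sup>+x. ennreal (g x * decay r 10 x) \<partial>lborel)"
    by (rule nn_integral_cmult) measurable
  finally have main: "ennreal (r ^ 3 / 256) * (\<integral>\<^sup>+x. ennreal (f x * decay r 10 x) \<partial>lborel)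
      \<le> ennreal (8 * r ^ 3) * (\<integral>\<^sup>+x. ennreal (g x * decay r 10 x) \<partial>lborel)"
    by (subst (asm) nn_integral_cmult) auto
  have "ennreal (256 / r ^ 3) * (ennreal (r ^ 3 / 256) * (\<integral>\<^sup>+x. ennreal (f x * decay r 10 x) \<partial>lborel))
      \<le> ennreal (256 / r ^ 3) * (ennreal (8 * r ^ 3) * (\<integral>\<^sup>+x. ennreal (g x * decay r 10 x) \<partial>lborel))"
    by (rule mult_left_mono[OF main]) simp
  thus ?thesis using r by (simp add: mult.assoc[symmetric] ennreal_mult[symmetric])
qed

text \<open>The integral on the left reappears on the right with a factor of order \<open>B / K\<^sup>2\<close>, which will
  be smaller than one.\<close>

lemma weighted_inequality:
  assumes N: "N > 0" and K: "K > 0" and M: "M > 0" and NKM: "N\<^sup>2 = K * M"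
    and F: "integrable (lebesgue_on unit_square) F" and B: "B \<ge> 0" and r: "r > 0"
    and hyp: "\<And>c P. M_set_partition (N\<^sup>2) M P \<Longrightarrow>
       Lp_norm 3 (indicator (ball c r)) (extension F) ^ 3
         \<le> B * (\<Sum>j=1..K. Lp_norm 3 (ball_weight c r) (extension_on (\<Union>(P j)) F) ^ 3)"
  shows "(LINT x|lborel. norm (extension F x) ^ 3 * decay r 10 x)
    \<le> 2048 * (B * real K * (4 / real K ^ 3 * (LINT x|lborel. norm (extension F x) ^ 3 * decay r 10 x)
         + 80 * (LINT x|lborel. square_function N F x ^ 3 * decay r 10 x)))"
proof -
  let ?f = "\<lambda>x. norm (extension F x) ^ 3"
  let ?s = "\<lambda>x. square_function N F x ^ 3"
  let ?g = "\<lambda>x. B * real K * (4 / real K ^ 3 * ?f x + 80 * ?s x)"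
  have v: "integrable lborel (\<lambda>x::real^3. decay r k (x - c))" if "k \<ge> 6" for c k
    using r that by (intro integrable_decay_vec3) auto
  have ind: "integrable lborel (\<lambda>x::real^3. indicator (ball c r) x :: real)" for c
    using r by (intro integrable_real_indicator) (auto simp: emeasure_ball)
  have fint: "integrable lborel (\<lambda>x. ?f x * w x)" if "integrable lborel w" for w :: "real^3 \<Rightarrow> real"
    using F that by (rule integrable_extension_cube)
  have sint: "integrable lborel (\<lambda>x. ?s x * w x)" if "integrable lborel w" for w :: "real^3 \<Rightarrow> real"
    using N F that by (rule integrable_square_function_cube)
  have gint: "integrable lborel (\<lambda>x. ?g x * w x)"
    and geq: "(LINT x|lborel. ?g x * w x) = B * real K * (4 / real K ^ 3 * (LINT x|lborel. ?f x * w x) + 80 * (LINT x|lborel. ?s x * w x))"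
    if "integrable lborel w" for w :: "real^3 \<Rightarrow> real"
  proof -
    have eq: "?g x * w x = B * real K * (4 / real K ^ 3 * (?f x * w x) + 80 * (?s x * w x))" for x
      by (simp add: algebra_simps)
    note i = integrable_mult_right[OF fint[OF that], of "4 / real K ^ 3"] integrable_mult_right[OF sint[OF that], of 80]
    show "integrable lborel (\<lambda>x. ?g x * w x)"
      unfolding eq by (intro integrable_mult_right Bochner_Integration.integrable_add i)
    show "(LINT x|lborel. ?g x * w x) = B * real K * (4 / real K ^ 3 * (LINT x|lborel. ?f x * w x) + 80 * (LINT x|lborel. ?s x * w x))"
      unfolding eq using i by simp
  qed
  have g0: "?g x \<ge> 0" for x using B by (intro mult_nonneg_nonneg add_nonneg_nonneg) auto
  have gd: "?g x * decay r k z \<ge> 0" for x k and z :: "real^3" by (rule mult_nonneg_nonneg[OF g0]) simp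
  have "(\<integral>\<^sup>+x. ennreal (?f x * decay r 10 x) \<partial>lborel) \<le> 2048 * (\<integral>\<^sup>+x. ennreal (?g x * decay r 10 x) \<partial>lborel)"
  proof (rule average_over_balls[OF r])
    fix c
    have "(\<integral>\<^sup>+x. ennreal (?f x) * indicator (ball c r) x \<partial>lborel) = (\<integral>\<^sup>+x. ennreal (?f x * indicator (ball c r) x) \<partial>lborel)"
      by (intro nn_integral_cong) (auto simp: indicator_def)
    also have "\<dots> = ennreal (LINT x|lborel. ?f x * indicator (ball c r) x)"
      by (rule nn_integral_eq_integral[OF fint[OF ind]]) auto
    also have "\<dots> \<le> ennreal (LINT x|lborel. ?g x * decay r 100 (x - c))"
      using randomised_inequality[OF N K M NKM F B r hyp] by (intro ennreal_leI)
    also have "\<dots> = (\<integral>\<^sup>+x. ennreal (?g x * decay r 100 (x - c)) \<partial>lborel)"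
      by (intro nn_integral_eq_integral[symmetric] gint v AE_I2 gd) simp
    also have "\<dots> = (\<integral>\<^sup>+x. ennreal (?g x) * ennreal (decay r 100 (x - c)) \<partial>lborel)"
      using g0 by (intro nn_integral_cong ennreal_mult g0) simp
    finally show "(\<integral>\<^sup>+x. ennreal (?f x) * indicator (ball c r) x \<partial>lborel) \<le> (\<integral>\<^sup>+x. ennreal (?g x) * ennreal (decay r 100 (x - c)) \<partial>lborel)" .
  qed (use g0 N F K in \<open>auto intro!: continuous_intros continuous_on_extension_on continuous_on_square_function\<close>)
  also have "(\<integral>\<^sup>+x. ennreal (?f x * decay r 10 x) \<partial>lborel) = ennreal (LINT x|lborel. ?f x * decay r 10 x)"
    using fint[OF v[of 10 0]] by (intro nn_integral_eq_integral) auto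
  also have "(\<integral>\<^sup>+x. ennreal (?g x * decay r 10 x) \<partial>lborel) = ennreal (LINT x|lborel. ?g x * decay r 10 x)"
    by (intro nn_integral_eq_integral AE_I2 gd) (use gint[OF v[of 10 0]] in simp)
  finally have "ennreal (LINT x|lborel. ?f x * decay r 10 x) \<le> ennreal (2048 * (LINT x|lborel. ?g x * decay r 10 x))"
    by (simp add: ennreal_mult')
  moreover have "(LINT x|lborel. ?g x * decay r 10 x) \<ge> 0"
    by (intro Bochner_Integration.integral_nonneg gd)
  ultimately have "(LINT x|lborel. ?f x * decay r 10 x) \<le> 2048 * (LINT x|lborel. ?g x * decay r 10 x)"
    by (subst (asm) ennreal_le_iff) auto
  thus ?thesis using geq[OF v[of 10 0]] by simp
qed

section \<open>The square function of a piecewise constant function\<close>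

lemma continuous_on_vector2 [continuous_intros]:
  assumes "continuous_on A f" "continuous_on A g"
  shows "continuous_on A (\<lambda>z. vector [f z, g z] :: real^2)"
proof -
  have eq: "(\<lambda>z. vector [f z, g z] :: real^2) = (\<lambda>z. \<chi> i. if i = 1 then f z else g z)"
    by (auto simp: vec_eq_iff forall_2)
  have c: "continuous_on A (\<lambda>z. if i = 1 then f z else g z)" for i :: 2
    using assms by (cases "i = 1") simp_all
  show ?thesis unfolding eq by (intro continuous_on_vec_lambda c)
qed

lemma borel_measurable_vector2:
  "(\<lambda>(x, y). vector [x, y] :: real^2) \<in> borel_measurable (lborel \<Otimes>\<^sub>M lborel)"
  unfolding case_prod_beta
  by (simp add: lborel_prod) (intro borel_measurable_continuous_onI continuous_intros)

lemma lborel_vec2: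
  "(lborel :: (real^2) measure) = distr (lborel \<Otimes>\<^sub>M lborel) borel (\<lambda>(x, y). vector [x, y])"
proof (rule lborel_eqI)
  let ?P = "lborel \<Otimes>\<^sub>M lborel :: (real \<times> real) measure"
  let ?g = "\<lambda>(x, y). vector [x, y] :: real^2"
  fix l u :: "real^2"
  assume le: "\<And>b. b \<in> Basis \<Longrightarrow> l \<bullet> b \<le> u \<bullet> b"
  have le': "l $ i \<le> u $ i" for i using le[of "axis i 1"] by (simp add: inner_axis)
  have "emeasure (distr ?P borel ?g) (box l u) = emeasure ?P (?g -` box l u \<inter> space ?P)"
    using borel_measurable_vector2 by (intro emeasure_distr) auto
  also have "?g -` box l u \<inter> space ?P = {l$1<..<u$1} \<times> {l$2<..<u$2}"
    by (auto simp: space_pair_measure mem_box_cart forall_2)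
  also have "emeasure ?P \<dots> = emeasure lborel {l$1<..<u$1} * emeasure lborel {l$2<..<u$2}"
    by (simp add: lborel.emeasure_pair_measure_Times)
  also have "\<dots> = ennreal (\<Prod>b\<in>Basis. (u - l) \<bullet> b)"
  proof -
    have "(\<Prod>b\<in>Basis. (u - l) \<bullet> b) = (u$1 - l$1) * (u$2 - l$2)"
      unfolding prod_Basis_cart UNIV_2 by (simp add: inner_axis)
    thus ?thesis using le'[of 1] le'[of 2] by (simp add: ennreal_mult)
  qed
  finally show "emeasure (distr ?P borel ?g) (box l u) = ennreal (\<Prod>b\<in>Basis. (u - l) \<bullet> b)" .
qed simp

definition quad_integral :: "nat \<Rightarrow> nat \<Rightarrow> real \<Rightarrow> real \<Rightarrow> complex" where
  "quad_integral N j x t = integral {real j / real N..(real j + 1) / real N} (\<lambda>u. e (u * x + u\<^sup>2 * t))"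

text \<open>Since \<open>|\<xi>|\<^sup>2\<close> is a sum of one-variable functions, the integral over a square factors.\<close>

lemma extension_on_cell_one:
  assumes N: "N > 0"
  shows "extension_on (cell N a) (\<lambda>_. 1) x
    = quad_integral N (a mod N) (x $ 1) (x $ 3) * quad_integral N (a div N) (x $ 2) (x $ 3)"
proof -
  let ?I = "{real (a mod N) / real N..(real (a mod N) + 1) / real N}"
  let ?J = "{real (a div N) / real N..(real (a div N) + 1) / real N}"
  define f where "f u = indicator ?I u *\<^sub>R e (u * x $ 1 + u\<^sup>2 * x $ 3)" for u
  define g where "g u = indicator ?J u *\<^sub>R e (u * x $ 2 + u\<^sup>2 * x $ 3)" for u
  have cont: "continuous_on UNIV (\<lambda>u. e (u * y + u\<^sup>2 * t))" for y t by (intro continuous_intros)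
  have set_int: "(LINT u|lborel. indicator {c..d} u *\<^sub>R e (u * y + u\<^sup>2 * t)) = integral {c..d} (\<lambda>u. e (u * y + u\<^sup>2 * t))" for c d y t
    using set_borel_integral_eq_integral(2)[OF borel_integrable_atLeastAtMost', of c d "\<lambda>u. e (u * y + u\<^sup>2 * t)"]
      continuous_on_subset[OF cont] by (simp add: set_lebesgue_integral_def)
  have fi: "integrable lborel f" and gi: "integrable lborel g"
    unfolding f_def g_def using borel_integrable_atLeastAtMost'[OF continuous_on_subset[OF cont]]
    by (auto simp: set_integrable_def)
  have fgi: "integrable (lborel \<Otimes>\<^sub>M lborel) (\<lambda>(u, v). f u * g v)"
  proof (rule lborel_pair.Fubini_integrable)
    show "(\<lambda>(u, v). f u * g v) \<in> borel_measurable (lborel \<Otimes>\<^sub>M lborel)"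
      using fi gi by (auto intro!: borel_measurable_times measurable_compose[OF measurable_fst] measurable_compose[OF measurable_snd] simp: case_prod_beta)
    show "integrable lborel (\<lambda>u. LINT v|lborel. norm (case (u, v) of (u, v) \<Rightarrow> f u * g v))"
      using fi by (simp add: norm_mult)
    show "AE u in lborel. integrable lborel (\<lambda>v. case (u, v) of (u, v) \<Rightarrow> f u * g v)"
      using gi by simp
  qed
  have ind: "indicator (cell N a) (vector [u, v] :: real^2) = (indicator ?I u * indicator ?J v :: real)" for u v
    using N unfolding cell_def in_grid_square_iff[OF N] indicator_def
    by (auto simp: in_grid_square_iff field_simps)
  have pt: "indicator (cell N a) (vector [u, v] :: real^2) *\<^sub>R e (paraboloid_point (vector [u, v]) \<bullet> x) = f u * g v" for u v
    unfolding ind paraboloid_point_inner f_def g_def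
    by (simp add: e_add[symmetric] algebra_simps)
  have m: "(\<lambda>\<xi>. indicator (cell N a) \<xi> *\<^sub>R e (paraboloid_point \<xi> \<bullet> x)) \<in> borel_measurable borel"
    by (intro borel_measurable_scaleR borel_measurable_indicator borel_measurable_continuous_onI continuous_intros) simp
  have "extension_on (cell N a) (\<lambda>_. 1) x = (LINT \<xi>|lebesgue. indicator (cell N a) \<xi> *\<^sub>R e (paraboloid_point \<xi> \<bullet> x))"
    by (simp add: extension_on_eq_indicator)
  also have "\<dots> = (LINT \<xi>|lborel. indicator (cell N a) \<xi> *\<^sub>R e (paraboloid_point \<xi> \<bullet> x))"
    using m by (intro integral_completion) simp
  also have "\<dots> = (LINT z|(lborel \<Otimes>\<^sub>M lborel). (\<lambda>(u, v). f u * g v) z)"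
    using m borel_measurable_vector2
    by (subst lborel_vec2, subst integral_distr) (auto simp: case_prod_unfold pt)
  also have "\<dots> = (LINT u|lborel. LINT v|lborel. f u * g v)"
    using lborel_pair.integral_fst'[OF fgi] by simp
  also have "\<dots> = (LINT u|lborel. f u) * (LINT v|lborel. g v)"
    by simp
  finally show ?thesis by (simp add: f_def g_def set_int quad_integral_def)
qed

lemma continuous_quad_phase: "continuous_on A (\<lambda>u. e (u * x + u\<^sup>2 * t))"
  by (intro continuous_intros)

lemma norm_quad_integral_le:
  assumes N: "N > 0"
  shows "norm (quad_integral N j x t) \<le> 1 / real N"
proof -
  have "norm (quad_integral N j x t) \<le> 1 * ((real j + 1) / real N - real j / real N)"
    unfolding quad_integral_def
    by (rule integral_bound) (use N in \<open>auto intro!: continuous_quad_phase simp: divide_right_mono\<close>)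
  thus ?thesis using N by (simp add: field_simps)
qed

text \<open>At the left endpoint \<open>j / N\<close> the phase \<open>u x + u\<^sup>2 t\<close> has derivative \<open>x + 2 t j / N\<close>. Over the
  interval the derivative varies by at most \<open>2 |t| / N\<close>, so one integration by parts gives
  first order decay, with a loss that is bounded as long as \<open>|t| \<le> N\<^sup>2\<close>.\<close>

lemma quad_integral_by_parts:
  assumes N: "N > 0"
  shows "\<bar>x + 2 * t * (real j / real N)\<bar> * norm (quad_integral N j x t) \<le> 1 + 2 * \<bar>t\<bar> / (real N)\<^sup>2"
proof -
  define a b where "a = real j / real N" and "b = (real j + 1) / real N"
  have ab: "a \<le> b" "b - a = 1 / real N" using N by (auto simp: a_def b_def field_simps)
  define \<phi> where "\<phi> u = e (u * x + u\<^sup>2 * t)" for u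
  have c\<phi>: "continuous_on A \<phi>" for A unfolding \<phi>_def by (rule continuous_quad_phase)
  define d where "d u = (2 * of_real pi * \<i> * of_real (x + 2 * u * t)) * \<phi> u" for u
  have "(d has_integral (\<phi> b - \<phi> a)) {a..b}"
  proof (rule fundamental_theorem_of_calculus[OF ab(1)])
    fix u
    have "((\<lambda>u. 2 * of_real pi * \<i> * of_real (u * x + u\<^sup>2 * t)) has_vector_derivative
        2 * of_real pi * \<i> * of_real (x + 2 * u * t)) (at u within {a..b})"
      by (intro has_vector_derivative_mult_right has_vector_derivative_of_real)
         (auto intro!: derivative_eq_intros simp flip: has_real_derivative_iff_has_vector_derivative)
    from field_vector_diff_chain_within[OF this DERIV_exp[THEN DERIV_subset, OF subset_UNIV]]
    show "(\<phi> has_vector_derivative d u) (at u within {a..b})"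
      by (simp add: \<phi>_def[abs_def] d_def e_def o_def)
  qed
  hence 1: "integral {a..b} d = \<phi> b - \<phi> a" by (rule integral_unique)
  have i1: "(\<lambda>u. of_real (x + 2 * a * t) * \<phi> u) integrable_on {a..b}"
    and i2: "(\<lambda>u. of_real (2 * (u - a) * t) * \<phi> u) integrable_on {a..b}"
    by (intro integrable_continuous_real continuous_intros c\<phi>)+
  \<comment> \<open>The derivative of the phase is split into its value at \<open>a\<close> and the deviation from it.\<close>
  have d_eq: "d = (\<lambda>u. 2 * of_real pi * \<i> * (of_real (x + 2 * a * t) * \<phi> u + of_real (2 * (u - a) * t) * \<phi> u))"
    by (auto simp: d_def fun_eq_iff algebra_simps)
  have "integral {a..b} d = 2 * of_real pi * \<i> * (of_real (x + 2 * a * t) * integral {a..b} \<phi>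
      + integral {a..b} (\<lambda>u. of_real (2 * (u - a) * t) * \<phi> u))"
    unfolding d_eq integral_mult_right integral_add[OF i1 i2] ..
  hence eqn: "of_real (x + 2 * a * t) * integral {a..b} \<phi>
     = (\<phi> b - \<phi> a) / (2 * of_real pi * \<i>) - integral {a..b} (\<lambda>u. of_real (2 * (u - a) * t) * \<phi> u)"
    unfolding 1 by (simp add: field_simps)
  have "norm (of_real (x + 2 * a * t) * integral {a..b} \<phi>)
     \<le> norm ((\<phi> b - \<phi> a) / (2 * of_real pi * \<i>)) + norm (integral {a..b} (\<lambda>u. of_real (2 * (u - a) * t) * \<phi> u))"
    unfolding eqn by (rule norm_triangle_ineq4)
  also have "norm ((\<phi> b - \<phi> a) / (2 * of_real pi * \<i>)) \<le> 1"
  proof -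
    have "norm (\<phi> b - \<phi> a) \<le> 2" using norm_triangle_ineq4[of "\<phi> b" "\<phi> a"] by (simp add: \<phi>_def)
    also have "\<dots> \<le> 2 * pi" using pi_gt3 by simp
    finally show ?thesis by (simp add: norm_divide norm_mult divide_le_eq)
  qed
  also have "norm (integral {a..b} (\<lambda>u. of_real (2 * (u - a) * t) * \<phi> u)) \<le> (2 * (1 / real N) * \<bar>t\<bar>) * (b - a)"
  proof (rule integral_bound[OF ab(1)])
    show "continuous_on {a..b} (\<lambda>u. of_real (2 * (u - a) * t) * \<phi> u)" by (intro continuous_intros c\<phi>)
    fix u assume u: "u \<in> {a..b}"
    hence "\<bar>u - a\<bar> \<le> 1 / real N" using ab(2) by auto
    hence "\<bar>u - a\<bar> * \<bar>t\<bar> \<le> 1 / real N * \<bar>t\<bar>" by (rule mult_right_mono) simp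
    moreover have "norm (of_real (2 * (u - a) * t) * \<phi> u) = 2 * (\<bar>u - a\<bar> * \<bar>t\<bar>)"
      by (simp only: norm_mult norm_of_real abs_mult \<phi>_def norm_e abs_numeral mult_1_right mult.assoc)
    ultimately show "norm (of_real (2 * (u - a) * t) * \<phi> u) \<le> 2 * (1 / real N) * \<bar>t\<bar>" by simp
  qed
  also have "(2 * (1 / real N) * \<bar>t\<bar>) * (b - a) = 2 * \<bar>t\<bar> / (real N)\<^sup>2"
    unfolding ab(2) by (simp add: power2_eq_square)
  finally show ?thesis
    unfolding quad_integral_def a_def[symmetric] b_def[symmetric] \<phi>_def[symmetric, abs_def]
    by (simp add: norm_mult mult_ac flip: of_real_add of_real_mult)
qed

text \<open>The profile of the horizontal slice at height \<open>t\<close>, in one coordinate, of the tube of width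
  \<open>N\<close> on which the extension of the indicator function of a square is concentrated.\<close>

definition bump :: "nat \<Rightarrow> nat \<Rightarrow> real \<Rightarrow> real \<Rightarrow> real" where
  "bump N j x t = 1 / (1 + ((x + 2 * t * (real j / real N)) / real N)\<^sup>2)"

lemma bump_pos: "bump N j x t > 0" and bump_le_1: "bump N j x t \<le> 1"
  by (auto simp: bump_def add_pos_nonneg)

text \<open>The trivial bound \<open>1 / N\<close> and the bound obtained by parts are combined; squaring turns first
  order decay into the integrable and summable profile \<open>bump\<close>.\<close>

lemma quad_integral_sq_le:
  assumes N: "N > 0"
  shows "(norm (quad_integral N j x t))\<^sup>2 \<le> 5 / (real N)\<^sup>2 * (1 + \<bar>t\<bar> / (real N)\<^sup>2)\<^sup>2 * bump N j x t"
proof -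
  define s y J where "s = \<bar>t\<bar> / (real N)\<^sup>2" and "y = (x + 2 * t * (real j / real N)) / real N"
    and "J = real N * norm (quad_integral N j x t)"
  have s0: "s \<ge> 0" by (simp add: s_def)
  have J0: "J \<ge> 0" by (simp add: J_def)
  have J1: "J \<le> 1" using norm_quad_integral_le[OF N, of j x t] N by (simp add: J_def field_simps)
  have "\<bar>y\<bar> * J = \<bar>x + 2 * t * (real j / real N)\<bar> * norm (quad_integral N j x t)"
    using N by (simp add: y_def J_def abs_divide)
  hence yJ: "\<bar>y\<bar> * J \<le> 2 * (1 + s)"
    using quad_integral_by_parts[OF N, of x t j] by (simp add: s_def)
  have "(\<bar>y\<bar> * J)\<^sup>2 \<le> (2 * (1 + s))\<^sup>2" using yJ J0 by (intro power_mono) auto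
  moreover have "(\<bar>y\<bar> * J)\<^sup>2 = y\<^sup>2 * J\<^sup>2" "(2 * (1 + s))\<^sup>2 = 4 * (1 + s)\<^sup>2"
    by (simp_all only: power_mult_distrib) simp_all
  ultimately have "y\<^sup>2 * J\<^sup>2 \<le> 4 * (1 + s)\<^sup>2" by simp
  moreover have "J\<^sup>2 \<le> 1" using J0 J1 by (simp add: power_le_one)
  moreover have "1 \<le> (1 + s)\<^sup>2" using s0 by (simp add: one_le_power)
  ultimately have "J\<^sup>2 * (1 + y\<^sup>2) \<le> 5 * (1 + s)\<^sup>2" by (simp add: algebra_simps)
  hence "J\<^sup>2 \<le> 5 * (1 + s)\<^sup>2 * bump N j x t"
    unfolding bump_def y_def[symmetric] by (simp add: pos_le_divide_eq add_pos_nonneg)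
  thus ?thesis using N unfolding J_def s_def[symmetric]
    by (simp add: power_mult_distrib field_simps)
qed

definition bump_sum :: "nat \<Rightarrow> real \<Rightarrow> real \<Rightarrow> real" where
  "bump_sum N x t = (\<Sum>j<N. bump N j x t)"

lemma bump_sum_nonneg [simp]: "bump_sum N x t \<ge> 0"
  unfolding bump_sum_def by (intro sum_nonneg) (use bump_pos less_imp_le in blast)

lemma bump_sum_le_N: "bump_sum N x t \<le> real N"
  unfolding bump_sum_def using sum_bounded_above[of "{..<N}" "\<lambda>j. bump N j x t" 1] bump_le_1 by simp

text \<open>Each term is compared with the increment of \<open>arctan\<close> over a step of length \<open>\<delta>\<close>; the increments
  telescope to at most \<open>pi\<close>.\<close>

lemma sum_inverse_quadratic_le:
  fixes \<alpha> \<delta> :: real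
  assumes "\<delta> > 0"
  shows "(\<Sum>j<n. 1 / (1 + (\<alpha> + real j * \<delta>)\<^sup>2)) \<le> 2 * pi * (1 + \<delta>\<^sup>2) / \<delta>"
proof -
  define A where "A j = arctan (\<alpha> + real j * \<delta>)" for j
  have step: "1 / (1 + (\<alpha> + real j * \<delta>)\<^sup>2) \<le> 2 * (1 + \<delta>\<^sup>2) / \<delta> * (A (Suc j) - A j)" for j
  proof -
    define p where "p = \<alpha> + real j * \<delta>"
    have lt: "p < p + \<delta>" using assms by simp
    obtain z where z: "p < z" "z < p + \<delta>" "arctan (p + \<delta>) - arctan p = (p + \<delta> - p) * inverse (1 + z\<^sup>2)"
      using MVT2[OF lt, of arctan "\<lambda>z. inverse (1 + z\<^sup>2)"] DERIV_arctan by blast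
    have "1 + z\<^sup>2 \<le> 2 * (1 + \<delta>\<^sup>2) * (1 + p\<^sup>2)"
    proof -
      have "(z - p)\<^sup>2 \<le> \<delta>\<^sup>2" using z by (intro power_mono) auto
      moreover have "z\<^sup>2 \<le> 2 * p\<^sup>2 + 2 * (z - p)\<^sup>2"
        using zero_le_power2[of "z - 2 * p"] by (simp add: power2_eq_square algebra_simps)
      moreover have "0 \<le> \<delta>\<^sup>2 * p\<^sup>2" by simp
      moreover have "2 * (1 + \<delta>\<^sup>2) * (1 + p\<^sup>2) = 2 + 2 * p\<^sup>2 + 2 * \<delta>\<^sup>2 + 2 * (\<delta>\<^sup>2 * p\<^sup>2)"
        by (simp add: algebra_simps)
      ultimately show ?thesis by linarith
    qed
    hence "inverse (2 * (1 + \<delta>\<^sup>2) * (1 + p\<^sup>2)) \<le> inverse (1 + z\<^sup>2)"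
      by (intro le_imp_inverse_le) (auto simp: add_pos_nonneg)
    hence "\<delta> * inverse (2 * (1 + \<delta>\<^sup>2) * (1 + p\<^sup>2)) \<le> A (Suc j) - A j"
      using z(3) assms by (simp add: A_def p_def algebra_simps)
    from mult_left_mono[OF this, of "2 * (1 + \<delta>\<^sup>2) / \<delta>"] show ?thesis
      using assms unfolding p_def[symmetric]
      by (simp add: add_pos_nonneg divide_simps add_nonneg_eq_0_iff split: if_splits)
  qed
  have "(\<Sum>j<n. 1 / (1 + (\<alpha> + real j * \<delta>)\<^sup>2)) \<le> (\<Sum>j<n. 2 * (1 + \<delta>\<^sup>2) / \<delta> * (A (Suc j) - A j))"
    by (intro sum_mono step)
  also have "\<dots> = 2 * (1 + \<delta>\<^sup>2) / \<delta> * (A n - A 0)"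
    unfolding sum_distrib_left[symmetric] by (subst sum_lessThan_telescope) simp
  also have "\<dots> \<le> 2 * (1 + \<delta>\<^sup>2) / \<delta> * pi"
    using assms arctan_ubound[of "\<alpha> + real n * \<delta>"] arctan_lbound[of \<alpha>]
    by (intro mult_left_mono) (auto simp: A_def)
  finally show ?thesis by (simp add: field_simps)
qed

text \<open>How many tubes meet at height \<open>t\<close>: their centres are \<open>2 |t| / N\<close> apart and their width is
  \<open>N\<close>, so about \<open>1 / s\<close> of them overlap, and never more than all \<open>N\<close>. The factor
  \<open>(1 + s)\<^sup>2\<close> matters only beyond the height \<open>N\<^sup>2\<close>.\<close>

lemma bump_sum_le:
  assumes N: "N > 0"
  defines "s \<equiv> \<lambda>t. \<bar>t\<bar> / (real N)\<^sup>2"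
  shows "bump_sum N x t \<le> 8 * pi * (1 + s t)\<^sup>2 * real N / (1 + real N * s t)"
proof -
  have s0: "s t \<ge> 0" by (simp add: s_def)
  have pi1: "1 \<le> 8 * pi" using pi_gt3 by simp
  have q: "1 + real N * s t > 0" using s0 by (simp add: add_pos_nonneg)
  have sq1: "1 \<le> (1 + s t)\<^sup>2" using s0 by (simp add: one_le_power)
  show ?thesis
  proof (cases "real N * s t \<le> 1")
    case True
    have "bump_sum N x t * (1 + real N * s t) \<le> real N * 2"
      using True by (intro mult_mono bump_sum_le_N) (use s0 in auto)
    also have "\<dots> \<le> 8 * pi * (1 + s t)\<^sup>2 * real N"
    proof -
      have "2 * 1 \<le> 8 * pi * (1 + s t)\<^sup>2" using pi_gt3 sq1 by (intro mult_mono) auto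
      from mult_right_mono[OF this, of "real N"] show ?thesis by (simp add: mult_ac)
    qed
    finally show ?thesis using q by (simp add: pos_le_divide_eq)
  next
    case False
    hence sp: "s t > 0" using s0 by (cases "s t = 0") auto
    hence t0: "t \<noteq> 0" by (auto simp: s_def)
    define \<delta> where "\<delta> = 2 * s t"
    \<comment> \<open>Only squares enter the profile, so for negative \<open>t\<close> the progression may be reflected.\<close>
    define \<alpha> where "\<alpha> = sgn t * x / real N"
    have "bump_sum N x t = (\<Sum>j<N. 1 / (1 + (\<alpha> + real j * \<delta>)\<^sup>2))"
      unfolding bump_sum_def bump_def
    proof (intro sum.cong refl)
      fix j
      have "\<alpha> + real j * \<delta> = sgn t * ((x + 2 * t * (real j / real N)) / real N)"
        using N by (simp add: \<alpha>_def \<delta>_def s_def field_simps power2_eq_square abs_sgn)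
      moreover have "(sgn t)\<^sup>2 = 1" using t0 by (simp add: sgn_if)
      ultimately have "(\<alpha> + real j * \<delta>)\<^sup>2 = ((x + 2 * t * (real j / real N)) / real N)\<^sup>2"
        by (simp only: power_mult_distrib mult_1)
      thus "1 / (1 + ((x + 2 * t * (real j / real N)) / real N)\<^sup>2) = 1 / (1 + (\<alpha> + real j * \<delta>)\<^sup>2)" by simp
    qed
    also have "\<dots> \<le> 2 * pi * (1 + \<delta>\<^sup>2) / \<delta>"
      using sp by (intro sum_inverse_quadratic_le) (simp add: \<delta>_def)
    also have "\<dots> \<le> 4 * pi * (1 + s t)\<^sup>2 / s t"
    proof -
      have "1 + \<delta>\<^sup>2 \<le> 4 * (1 + s t)\<^sup>2" using s0 by (simp add: \<delta>_def power2_eq_square algebra_simps)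
      hence "2 * pi * (1 + \<delta>\<^sup>2) \<le> 2 * pi * (4 * (1 + s t)\<^sup>2)" by (intro mult_left_mono) auto
      hence "2 * pi * (1 + \<delta>\<^sup>2) / \<delta> \<le> 2 * pi * (4 * (1 + s t)\<^sup>2) / \<delta>"
        using sp by (intro divide_right_mono) (auto simp: \<delta>_def)
      thus ?thesis using sp by (simp add: \<delta>_def)
    qed
    also have "\<dots> \<le> 8 * pi * (1 + s t)\<^sup>2 * real N / (1 + real N * s t)"
    proof -
      have "1 + real N * s t \<le> 2 * (real N * s t)" using False by simp
      from mult_left_mono[OF this, of "4 * pi * (1 + s t)\<^sup>2"]
      have "4 * pi * (1 + s t)\<^sup>2 * (1 + real N * s t) \<le> 8 * pi * (1 + s t)\<^sup>2 * real N * s t" by (simp add: mult_ac)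
      thus ?thesis using sp q by (simp add: pos_le_divide_eq pos_divide_le_eq)
    qed
    finally show ?thesis .
  qed
qed

lemma nn_integral_bump_sum:
  assumes N: "N > 0"
  shows "(\<integral>\<^sup>+x. ennreal (bump_sum N x t) \<partial>lborel) \<le> ennreal (4 * (real N)\<^sup>2)"
proof -
  have m: "(\<lambda>z::real. ennreal (decay (real N) 2 z)) \<in> borel_measurable borel"
    by measurable
  have "(\<integral>\<^sup>+x. ennreal (bump N j x t) \<partial>lborel) \<le> ennreal (4 * real N)" for j
  proof -
    define h where "h = 2 * t * (real j / real N)"
    have "(\<integral>\<^sup>+x. ennreal (bump N j x t) \<partial>lborel) \<le> (\<integral>\<^sup>+x. 2 * ennreal (decay (real N) 2 (x - (- h))) \<partial>lborel)"
    proof (rule nn_integral_mono)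
      fix x
      define y where "y = (x + h) / real N"
      have "(1 + \<bar>y\<bar>)\<^sup>2 \<le> 2 * (1 + y\<^sup>2)"
        using zero_le_power2[of "1 - \<bar>y\<bar>"] by (simp add: power2_eq_square algebra_simps)
      hence "1 / (1 + y\<^sup>2) \<le> 2 / (1 + \<bar>y\<bar>)\<^sup>2"
        by (simp add: divide_simps add_pos_nonneg add_nonneg_eq_0_iff)
      also have "2 / (1 + \<bar>y\<bar>)\<^sup>2 = 2 * decay (real N) 2 (x - (- h))"
        using N by (simp add: decay_def y_def powr_minus_divide abs_divide)
      finally have "bump N j x t \<le> 2 * decay (real N) 2 (x - (- h))"
        by (simp add: bump_def y_def h_def)
      hence "ennreal (bump N j x t) \<le> ennreal (2 * decay (real N) 2 (x - (- h)))" by (rule ennreal_leI)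
      thus "ennreal (bump N j x t) \<le> 2 * ennreal (decay (real N) 2 (x - (- h)))" by (simp add: ennreal_mult')
    qed
    also have "\<dots> = 2 * (\<integral>\<^sup>+x. ennreal (decay (real N) 2 (x - (- h))) \<partial>lborel)"
      using m by (intro nn_integral_cmult) simp
    also have "(\<integral>\<^sup>+x. ennreal (decay (real N) 2 (x - (- h))) \<partial>lborel) = ennreal (2 * real N)"
      unfolding nn_integral_lborel_shift[OF m] using N by (intro nn_integral_decay2_real) simp
    finally show ?thesis using ennreal_mult'[of 2 "2 * real N"] by simp
  qed
  hence "(\<Sum>j<N. (\<integral>\<^sup>+x. ennreal (bump N j x t) \<partial>lborel)) \<le> (\<Sum>j<N. ennreal (4 * real N))" by (intro sum_mono)
  also have "\<dots> = ennreal (4 * (real N)\<^sup>2)"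
    by (subst sum_ennreal) (auto simp: power2_eq_square mult_ac)
  also have "(\<Sum>j<N. (\<integral>\<^sup>+x. ennreal (bump N j x t) \<partial>lborel)) = (\<integral>\<^sup>+x. (\<Sum>j<N. ennreal (bump N j x t)) \<partial>lborel)"
    by (rule nn_integral_sum[symmetric]) (simp add: bump_def)
  also have "\<dots> = (\<integral>\<^sup>+x. ennreal (bump_sum N x t) \<partial>lborel)"
    unfolding bump_sum_def using bump_pos by (intro nn_integral_cong sum_ennreal) (auto intro: less_imp_le)
  finally show ?thesis .
qed

text \<open>By partial fractions the kernel is a difference of two functions \<open>1 / (const + t)\<close>, whose
  antiderivatives grow by \<open>ln N\<close> in total. This is the only place where a logarithm is lost.\<close>

lemma nn_integral_log_kernel:
  assumes N: "N \<ge> 2"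
  defines "s \<equiv> \<lambda>t. \<bar>t\<bar> / (real N)\<^sup>2"
  shows "(\<integral>\<^sup>+t. ennreal (1 / (real N * ((1 + s t) * (1 + real N * s t)))) \<partial>lborel) \<le> ennreal (4 * ln (real N))"
proof -
  let ?k = "\<lambda>t. 1 / (real N * ((1 + s t) * (1 + real N * s t)))"
  let ?c = "real N / (real N - 1)"
  have N1: "real N > 1" using N by simp
  have [measurable]: "?k \<in> borel_measurable borel" unfolding s_def by measurable
  have half: "(\<integral>\<^sup>+t. ennreal (?k t) * indicator {0..} t \<partial>lborel) = ennreal (?c * ln (real N))"
  proof -
    have "(\<integral>\<^sup>+t. ennreal (?k t) * indicator {0..} t \<partial>lborel)
        = ennreal (?c * ln (real N) - ?c * (ln (real N + 0) - ln ((real N)\<^sup>2 + 0) + ln (real N)))"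
    proof (rule nn_integral_FTC_atLeast)
      show "?k \<in> borel_measurable borel" by measurable
      show "0 \<le> ?k t" for t by (simp add: s_def)
      show "((\<lambda>t. ?c * (ln (real N + t) - ln ((real N)\<^sup>2 + t) + ln (real N))) has_real_derivative ?k t) (at t)"
        if "0 \<le> t" for t
      proof -
        have p: "real N + t > 0" "(real N)\<^sup>2 + t > 0" using N1 that by (auto simp: add_pos_nonneg)
        have "((\<lambda>t. ?c * (ln (real N + t) - ln ((real N)\<^sup>2 + t) + ln (real N))) has_real_derivative
            ?c * (1 / (real N + t) - 1 / ((real N)\<^sup>2 + t))) (at t)"
          using p N1 by (auto intro!: derivative_eq_intros)
        also have "?c * (1 / (real N + t) - 1 / ((real N)\<^sup>2 + t)) = ?k t"
        proof -
          have "1 / (real N + t) - 1 / ((real N)\<^sup>2 + t) = (real N * (real N - 1)) / ((real N + t) * ((real N)\<^sup>2 + t))"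
            using p by (simp add: field_simps power2_eq_square)
          moreover have "real N * ((1 + s t) * (1 + real N * s t)) = (real N + t) * ((real N)\<^sup>2 + t) / (real N)\<^sup>2"
            using that N1 by (simp add: s_def field_simps power2_eq_square)
          ultimately show ?thesis using N N1 by (simp add: power2_eq_square)
        qed
        finally show ?thesis .
      qed
      have "((\<lambda>t. ln (real N + t) - ln ((real N)\<^sup>2 + t)) \<longlongrightarrow> 0) at_top" by real_asymp
      hence "((\<lambda>t. ?c * (ln (real N + t) - ln ((real N)\<^sup>2 + t) + ln (real N))) \<longlongrightarrow> ?c * (0 + ln (real N))) at_top"
        by (intro tendsto_intros)
      thus "((\<lambda>t. ?c * (ln (real N + t) - ln ((real N)\<^sup>2 + t) + ln (real N))) \<longlongrightarrow> ?c * ln (real N)) at_top" by simp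
    qed
    also have "ln (real N + 0) - ln ((real N)\<^sup>2 + 0) + ln (real N) = 0"
      using N1 by (simp add: ln_realpow)
    finally show ?thesis by simp
  qed
  have "(\<integral>\<^sup>+t. ennreal (?k t) \<partial>lborel) = 2 * ennreal (?c * ln (real N))"
    by (subst nn_integral_lborel_even) (simp_all add: half, simp add: s_def)
  also have "\<dots> = ennreal (2 * (?c * ln (real N)))"
    using N1 by (simp only: ennreal_mult' ennreal_numeral zero_le_numeral)
  also have "\<dots> \<le> ennreal (4 * ln (real N))"
  proof (rule ennreal_leI)
    have "?c \<le> 2" using N by (simp add: divide_le_eq)
    thus "2 * (?c * ln (real N)) \<le> 4 * ln (real N)"
      using N1 mult_right_mono[of ?c 2 "ln (real N)"] by simp
  qed
  finally show ?thesis .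
qed

text \<open>Neighbouring closed squares share an edge, so that constancy on them is only required
  almost everywhere.\<close>

definition piecewise_constant :: "nat \<Rightarrow> (real^2 \<Rightarrow> complex) \<Rightarrow> bool" where
  "piecewise_constant N G \<longleftrightarrow> integrable (lebesgue_on unit_square) G \<and>
     (\<forall>a<N\<^sup>2. \<exists>\<alpha>. norm \<alpha> \<le> 1 \<and> (AE \<xi> in lebesgue. \<xi> \<in> cell N a \<longrightarrow> G \<xi> = \<alpha>))"

lemma norm_extension_on_cell_le:
  assumes N: "N > 0" and G: "piecewise_constant N G" and a: "a < N\<^sup>2"
  shows "norm (extension_on (cell N a) G x)
     \<le> norm (quad_integral N (a mod N) (x $ 1) (x $ 3)) * norm (quad_integral N (a div N) (x $ 2) (x $ 3))"
proof -
  have Gi: "integrable (lebesgue_on unit_square) G" using G by (simp add: piecewise_constant_def)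
  obtain \<alpha> where \<alpha>: "norm \<alpha> \<le> 1" "AE \<xi> in lebesgue. \<xi> \<in> cell N a \<longrightarrow> G \<xi> = \<alpha>"
    using G a unfolding piecewise_constant_def by blast
  have m1: "(\<lambda>\<xi>. indicator (cell N a) \<xi> *\<^sub>R (G \<xi> * e (paraboloid_point \<xi> \<bullet> x))) \<in> borel_measurable lebesgue"
    using integrable_extension_integrand[OF integrable_on_cell[OF N a Gi], of x]
    by (subst (asm) integrable_restrict_space) auto
  have m2: "(\<lambda>\<xi>. indicator (cell N a) \<xi> *\<^sub>R (1 * e (paraboloid_point \<xi> \<bullet> x))) \<in> borel_measurable lebesgue"
    by (intro measurable_completion) (simp, intro borel_measurable_scaleR borel_measurable_indicator borel_measurable_continuous_onI continuous_intros, simp)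
  have "extension_on (cell N a) G x = (LINT \<xi>|lebesgue. indicator (cell N a) \<xi> *\<^sub>R (G \<xi> * e (paraboloid_point \<xi> \<bullet> x)))"
    by (simp add: extension_on_eq_indicator)
  also have "\<dots> = (LINT \<xi>|lebesgue. \<alpha> * (indicator (cell N a) \<xi> *\<^sub>R (1 * e (paraboloid_point \<xi> \<bullet> x))))"
  proof (rule integral_cong_AE[OF m1])
    show "(\<lambda>\<xi>. \<alpha> * (indicator (cell N a) \<xi> *\<^sub>R (1 * e (paraboloid_point \<xi> \<bullet> x)))) \<in> borel_measurable lebesgue"
      using m2 by (intro borel_measurable_times) auto
    show "AE \<xi> in lebesgue. indicator (cell N a) \<xi> *\<^sub>R (G \<xi> * e (paraboloid_point \<xi> \<bullet> x))
        = \<alpha> * (indicator (cell N a) \<xi> *\<^sub>R (1 * e (paraboloid_point \<xi> \<bullet> x)))"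
      using \<alpha>(2) by eventually_elim (auto simp: indicator_def)
  qed
  also have "\<dots> = \<alpha> * extension_on (cell N a) (\<lambda>_. 1) x"
    by (simp only: integral_mult_right_zero extension_on_eq_indicator[OF cell_lebesgue])
  finally have "norm (extension_on (cell N a) G x) = norm \<alpha> * norm (extension_on (cell N a) (\<lambda>_. 1) x)"
    by (simp add: norm_mult)
  also have "\<dots> \<le> 1 * norm (extension_on (cell N a) (\<lambda>_. 1) x)"
    using \<alpha>(1) by (intro mult_right_mono) auto
  finally show ?thesis by (simp add: extension_on_cell_one[OF N] norm_mult)
qed

lemma square_function_sq_le:
  assumes N: "N > 0" and G: "piecewise_constant N G"
  shows "(square_function N G x)\<^sup>2
     \<le> (5 / (real N)\<^sup>2 * (1 + \<bar>x $ 3\<bar> / (real N)\<^sup>2)\<^sup>2)\<^sup>2 * (bump_sum N (x $ 1) (x $ 3) * bump_sum N (x $ 2) (x $ 3))"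
proof -
  define c where "c = 5 / (real N)\<^sup>2 * (1 + \<bar>x $ 3\<bar> / (real N)\<^sup>2)\<^sup>2"
  have c0: "c \<ge> 0" by (simp add: c_def)
  let ?f = "\<lambda>j. c * bump N j (x $ 1) (x $ 3)" and ?g = "\<lambda>j. c * bump N j (x $ 2) (x $ 3)"
  have "(square_function N G x)\<^sup>2 = (\<Sum>a<N\<^sup>2. (norm (extension_on (cell N a) G x))\<^sup>2)"
    by (simp add: square_function_def sum_nonneg)
  also have "\<dots> \<le> (\<Sum>a<N\<^sup>2. ?f (a mod N) * ?g (a div N))"
  proof (rule sum_mono)
    fix a assume "a \<in> {..<N\<^sup>2}"
    hence a: "a < N\<^sup>2" by simp
    have "(norm (extension_on (cell N a) G x))\<^sup>2
       \<le> (norm (quad_integral N (a mod N) (x $ 1) (x $ 3)) * norm (quad_integral N (a div N) (x $ 2) (x $ 3)))\<^sup>2"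
      by (intro power_mono norm_extension_on_cell_le[OF N G a]) simp
    also have "\<dots> \<le> ?f (a mod N) * ?g (a div N)"
      unfolding power_mult_distrib c_def
      by (intro mult_mono quad_integral_sq_le N mult_nonneg_nonneg) (auto intro: less_imp_le bump_pos)
    finally show "(norm (extension_on (cell N a) G x))\<^sup>2 \<le> ?f (a mod N) * ?g (a div N)" .
  qed
  also have "\<dots> = (\<Sum>a<N * N. ?f (a mod N) * ?g (a div N))" by (simp add: power2_eq_square)
  also have "\<dots> = (\<Sum>i<N. \<Sum>j<N. ?f ((i * N + j) mod N) * ?g ((i * N + j) div N))"
    by (rule sum_lessThan_mult[symmetric])
  also have "\<dots> = (\<Sum>i<N. \<Sum>j<N. ?f j * ?g i)"
    by (intro sum.cong refl) auto
  also have "\<dots> = (\<Sum>j<N. ?f j) * (\<Sum>i<N. ?g i)"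
    by (subst sum.swap) (simp add: sum_product)
  also have "\<dots> = c\<^sup>2 * (bump_sum N (x $ 1) (x $ 3) * bump_sum N (x $ 2) (x $ 3))"
    by (simp add: bump_sum_def sum_distrib_left[symmetric] power2_eq_square mult_ac)
  finally show ?thesis unfolding c_def .
qed

text \<open>One factor of the cube of the square function is bounded by its supremum over the
  horizontal plane, the other two by the product of the one-variable sums; the weight
  absorbs all powers of \<open>1 + s\<close>.\<close>

lemma square_function_cube_decay_le:
  assumes N: "N > 0" and G: "piecewise_constant N G"
  defines "s \<equiv> \<lambda>t. \<bar>t\<bar> / (real N)\<^sup>2"
  shows "square_function N G x ^ 3 * decay ((real N)\<^sup>2) 10 x
     \<le> 1000 * pi / real N ^ 4 * (1 / (real N * ((1 + s (x $ 3)) * (1 + real N * s (x $ 3)))))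
         * (bump_sum N (x $ 1) (x $ 3) * bump_sum N (x $ 2) (x $ 3))"
proof -
  define \<sigma> where "\<sigma> = s (x $ 3)"
  have s0: "\<sigma> \<ge> 0" by (simp add: \<sigma>_def s_def)
  define c where "c = 5 / (real N)\<^sup>2 * (1 + \<sigma>)\<^sup>2"
  define m where "m = 8 * pi * (1 + \<sigma>)\<^sup>2 * real N / (1 + real N * \<sigma>)"
  let ?A = "bump_sum N (x $ 1) (x $ 3)" and ?B = "bump_sum N (x $ 2) (x $ 3)"
  let ?S = "square_function N G x"
  have c0: "c \<ge> 0" by (simp add: c_def)
  have m0: "m \<ge> 0" using s0 by (simp add: m_def)
  have AB: "?A \<le> m" "?B \<le> m" unfolding m_def \<sigma>_def s_def by (rule bump_sum_le[OF N])+
  have S2: "?S\<^sup>2 \<le> c\<^sup>2 * (?A * ?B)"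
    using square_function_sq_le[OF N G, of x] by (simp add: c_def \<sigma>_def s_def)
  also have "\<dots> \<le> c\<^sup>2 * (m * m)" using AB m0 by (intro mult_left_mono mult_mono) auto
  finally have "?S\<^sup>2 \<le> (c * m)\<^sup>2" by (simp add: power2_eq_square mult_ac)
  hence S1: "?S \<le> c * m" using c0 m0 by (simp add: power2_le_iff_abs_le)
  have "?S ^ 3 = ?S\<^sup>2 * ?S" by (simp add: power2_eq_square power3_eq_cube)
  also have "\<dots> \<le> (c\<^sup>2 * (?A * ?B)) * (c * m)"
    using S2 S1 by (intro mult_mono) auto
  also have "\<dots> = (c ^ 3 * m) * (?A * ?B)" by (simp add: power2_eq_square power3_eq_cube)
  finally have S3: "?S ^ 3 \<le> (c ^ 3 * m) * (?A * ?B)" .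
  have q: "1 + \<sigma> > 0" "1 + real N * \<sigma> > 0" using s0 by (auto simp: add_pos_nonneg)
  \<comment> \<open>The weight is used in the vertical direction only.\<close>
  have v: "decay ((real N)\<^sup>2) 10 x \<le> 1 / (1 + \<sigma>) ^ 10"
  proof -
    have "decay ((real N)\<^sup>2) 10 x \<le> (1 + \<sigma>) powr (- 10)"
      unfolding decay_def \<sigma>_def s_def using component_le_norm_cart[of x 3]
      by (intro powr_mono2') (auto simp: add_pos_nonneg divide_right_mono)
    thus ?thesis using q by (simp add: powr_minus_divide)
  qed
  have "?S ^ 3 * decay ((real N)\<^sup>2) 10 x \<le> ((c ^ 3 * m) * (?A * ?B)) * (1 / (1 + \<sigma>) ^ 10)"
    using S3 v c0 m0 by (intro mult_mono) auto
  also have "\<dots> = (c ^ 3 * m * (1 / (1 + \<sigma>) ^ 10)) * (?A * ?B)" by (simp add: mult_ac)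
  also have "\<dots> \<le> (1000 * pi / real N ^ 4 * (1 / (real N * ((1 + \<sigma>) * (1 + real N * \<sigma>))))) * (?A * ?B)"
  proof (rule mult_right_mono)
    have "c ^ 3 * m * (1 / (1 + \<sigma>) ^ 10) = 1000 * pi / real N ^ 4 * (1 / (real N * ((1 + \<sigma>)\<^sup>2 * (1 + real N * \<sigma>))))"
    proof -
      have "(5 / n\<^sup>2 * p\<^sup>2) ^ 3 * (8 * pi * p\<^sup>2 * n / r) * (1 / p ^ 10) = 1000 * pi / n ^ 4 * (1 / (n * (p\<^sup>2 * r)))"
        if "n > 0" "p > 0" "r > 0" for n p r :: real
        using that by (simp add: field_simps eval_nat_numeral)
      from this[of "real N" "1 + \<sigma>" "1 + real N * \<sigma>"] show ?thesis
        using q N unfolding c_def m_def by simp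
    qed
    also have "\<dots> \<le> 1000 * pi / real N ^ 4 * (1 / (real N * ((1 + \<sigma>) * (1 + real N * \<sigma>))))"
    proof (intro mult_left_mono divide_left_mono)
      have "1 + \<sigma> \<le> (1 + \<sigma>)\<^sup>2" using s0 by (simp add: power2_eq_square algebra_simps)
      thus "(1 + \<sigma>) * (1 + real N * \<sigma>) \<le> (1 + \<sigma>)\<^sup>2 * (1 + real N * \<sigma>)"
        using q by (intro mult_right_mono) auto
    qed (use q N in auto)
    finally show "c ^ 3 * m * (1 / (1 + \<sigma>) ^ 10) \<le> 1000 * pi / real N ^ 4 * (1 / (real N * ((1 + \<sigma>) * (1 + real N * \<sigma>))))" .
  qed simp
  finally show ?thesis unfolding \<sigma>_def .
qed

text \<open>For a piecewise constant function all the tubes pass through the origin. At distance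
  \<open>\<rho> N\<close> from it the squared square function has size about \<open>N ^ (-2) \<rho> ^ (-2)\<close>, so every
  dyadic shell \<open>1 \<le> \<rho> \<le> N\<close> contributes a bounded amount to the integral of the cube.
  Hence the bound on a ball of the large radius \<open>N\<^sup>2\<close> is only logarithmic.\<close>

lemma square_function_integral_le:
  assumes N: "N \<ge> 2" and G: "piecewise_constant N G"
  shows "(LINT x|lborel. square_function N G x ^ 3 * decay ((real N)\<^sup>2) 10 x) \<le> 64000 * pi * ln (real N)"
proof -
  have N0: "N > 0" using N by simp
  have Gi: "integrable (lebesgue_on unit_square) G" using G by (simp add: piecewise_constant_def)
  define s where "s = (\<lambda>t. \<bar>t\<bar> / (real N)\<^sup>2)"
  define k where "k = (\<lambda>t. 1 / (real N * ((1 + s t) * (1 + real N * s t))))"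
  have k0: "k t \<ge> 0" for t by (simp add: k_def s_def)
  have [measurable]: "k \<in> borel_measurable borel" unfolding k_def s_def by measurable
  have [measurable]: "(\<lambda>x. bump_sum N x t) \<in> borel_measurable borel" for t
    unfolding bump_sum_def bump_def by measurable
  let ?f = "\<lambda>x. square_function N G x ^ 3 * decay ((real N)\<^sup>2) 10 x"
  let ?C = "1000 * pi / real N ^ 4"
  have fi: "integrable lborel ?f"
    using integrable_decay_vec3[of "(real N)\<^sup>2" 10 0] N0
    by (intro integrable_square_function_cube Gi) auto
  have "ennreal (LINT x|lborel. ?f x) = (\<integral>\<^sup>+x. ennreal (?f x) \<partial>lborel)"
    by (rule nn_integral_eq_integral[symmetric, OF fi]) simp
  also have "\<dots> = (\<integral>\<^sup>+t. \<integral>\<^sup>+x. \<integral>\<^sup>+y. ennreal (?f (vector [x, y, t])) \<partial>lborel \<partial>lborel \<partial>lborel)"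
    using fi by (intro nn_integral_vec3) (auto dest: borel_measurable_integrable)
  also have "\<dots> \<le> (\<integral>\<^sup>+t. \<integral>\<^sup>+x. \<integral>\<^sup>+y. ennreal (?C * k t) * (ennreal (bump_sum N x t) * ennreal (bump_sum N y t)) \<partial>lborel \<partial>lborel \<partial>lborel)"
  proof (intro nn_integral_mono)
    fix t x y :: real
    have "?f (vector [x, y, t]) \<le> ?C * k t * (bump_sum N x t * bump_sum N y t)"
      using square_function_cube_decay_le[OF N0 G, of "vector [x, y, t]"] by (simp add: k_def s_def)
    hence "ennreal (?f (vector [x, y, t])) \<le> ennreal (?C * k t * (bump_sum N x t * bump_sum N y t))" by (rule ennreal_leI)
    also have "\<dots> = ennreal (?C * k t) * (ennreal (bump_sum N x t) * ennreal (bump_sum N y t))"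
    proof -
      have Ck: "0 \<le> ?C * k t" using k0[of t] by simp
      show ?thesis
        by (simp only: ennreal_mult[OF Ck mult_nonneg_nonneg[OF bump_sum_nonneg bump_sum_nonneg]]
              ennreal_mult[OF bump_sum_nonneg bump_sum_nonneg])
    qed
    finally show "ennreal (?f (vector [x, y, t])) \<le> ennreal (?C * k t) * (ennreal (bump_sum N x t) * ennreal (bump_sum N y t))" .
  qed
  also have "\<dots> = (\<integral>\<^sup>+t. ennreal (?C * k t) * ((\<integral>\<^sup>+x. ennreal (bump_sum N x t) \<partial>lborel) * (\<integral>\<^sup>+y. ennreal (bump_sum N y t) \<partial>lborel)) \<partial>lborel)"
    by (simp add: nn_integral_cmult nn_integral_multc)
  also have "\<dots> \<le> (\<integral>\<^sup>+t. ennreal (?C * k t) * (ennreal (4 * (real N)\<^sup>2) * ennreal (4 * (real N)\<^sup>2)) \<partial>lborel)"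
    by (intro nn_integral_mono mult_left_mono mult_mono nn_integral_bump_sum N0) auto
  also have "\<dots> = (\<integral>\<^sup>+t. ennreal (16000 * pi) * ennreal (k t) \<partial>lborel)"
  proof (rule nn_integral_cong)
    fix t
    have "?C * k t * (4 * (real N)\<^sup>2 * (4 * (real N)\<^sup>2)) = 16000 * pi * k t"
      using N0 by (simp add: field_simps eval_nat_numeral)
    thus "ennreal (?C * k t) * (ennreal (4 * (real N)\<^sup>2) * ennreal (4 * (real N)\<^sup>2)) = ennreal (16000 * pi) * ennreal (k t)"
      using k0[of t] by (simp add: ennreal_mult[symmetric])
  qed
  also have "\<dots> = ennreal (16000 * pi) * (\<integral>\<^sup>+t. ennreal (k t) \<partial>lborel)"
    by (rule nn_integral_cmult) measurable
  also have "\<dots> \<le> ennreal (16000 * pi) * ennreal (4 * ln (real N))"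
    using nn_integral_log_kernel[OF N] by (intro mult_left_mono) (auto simp: k_def s_def)
  also have "\<dots> = ennreal (64000 * pi * ln (real N))"
    using N by (simp add: ennreal_mult[symmetric])
  finally show ?thesis using N by (subst (asm) ennreal_le_iff) auto
qed

section \<open>From piecewise constant to bounded functions\<close>

definition ess_bounded :: "real \<Rightarrow> (real^2 \<Rightarrow> complex) \<Rightarrow> bool" where
  "ess_bounded A F \<longleftrightarrow> F \<in> borel_measurable (lebesgue_on unit_square) \<and>
     (AE \<xi> in lebesgue_on unit_square. norm (F \<xi>) \<le> A)"

lemma measure_unit_square: "measure lebesgue unit_square = 1"
  and unit_square_lmeasurable: "unit_square \<in> lmeasurable"
proof -
  have "unit_square \<noteq> {}" using in_unit_square_iff[of 0] by auto
  hence "measure lborel unit_square = 1"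
    unfolding unit_square_def by (subst content_cbox_cart) (auto simp: UNIV_2)
  thus "measure lebesgue unit_square = 1" by (simp add: unit_square_def)
qed (simp add: unit_square_def)

lemma finite_measure_unit_square: "finite_measure (lebesgue_on unit_square)"
  using unit_square_lmeasurable by (rule finite_measure_lebesgue_on)

lemma ess_bounded_integrable:
  assumes "ess_bounded A F" shows "integrable (lebesgue_on unit_square) F"
  using assms unfolding ess_bounded_def
  by (intro finite_measure.integrable_const_bound[OF finite_measure_unit_square]) auto

lemma norm_integral_lebesgue_on_le:
  fixes f :: "'a::euclidean_space \<Rightarrow> 'b::{banach, second_countable_topology}"
  assumes S: "S \<in> lmeasurable" and f: "integrable (lebesgue_on S) f" and le: "AE \<xi> in lebesgue_on S. norm (f \<xi>) \<le> B"
  shows "norm (LINT \<xi>|lebesgue_on S. f \<xi>) \<le> measure lebesgue S * B"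
proof -
  have "norm (LINT \<xi>|lebesgue_on S. f \<xi>) \<le> (LINT \<xi>|lebesgue_on S. norm (f \<xi>))"
    by (rule integral_norm_bound)
  also have "\<dots> \<le> (LINT \<xi>|lebesgue_on S. B)"
    using f le finite_measure.integrable_const[OF finite_measure_lebesgue_on[OF S]]
    by (intro integral_mono_AE) auto
  also have "\<dots> = measure lebesgue S * B" using S by (simp add: measure_restrict_space)
  finally show ?thesis .
qed

lemma norm_extension_le:
  assumes "ess_bounded A F" shows "norm (extension F x) \<le> A"
  using norm_integral_lebesgue_on_le[OF unit_square_lmeasurable
      integrable_extension_integrand[OF ess_bounded_integrable[OF assms]], of x A] assms
  by (simp add: ess_bounded_def extension_on_def norm_mult measure_unit_square)

lemma ess_bounded_mult:
  assumes F: "ess_bounded A F" and g: "g \<in> borel_measurable (lebesgue_on unit_square)"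
    and le: "\<And>\<xi>. \<xi> \<in> unit_square \<Longrightarrow> norm (g \<xi>) \<le> B" and A: "A \<ge> 0"
  shows "ess_bounded (A * B) (\<lambda>\<xi>. F \<xi> * g \<xi>)"
proof -
  have "AE \<xi> in lebesgue_on unit_square. \<xi> \<in> unit_square"
    by (rule AE_I2) (simp add: space_restrict_space)
  moreover have "AE \<xi> in lebesgue_on unit_square. norm (F \<xi>) \<le> A" using F by (simp add: ess_bounded_def)
  ultimately have "AE \<xi> in lebesgue_on unit_square. norm (F \<xi> * g \<xi>) \<le> A * B"
    by eventually_elim (auto simp: norm_mult intro!: mult_mono le A)
  thus ?thesis using F g by (auto simp: ess_bounded_def intro!: borel_measurable_times)
qed

lemma set_integrable_ball_continuous:
  fixes g :: "real^3 \<Rightarrow> real"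
  assumes "continuous_on UNIV g"
  shows "set_integrable lborel (ball c \<rho>) g"
proof -
  have "set_integrable lborel (cball c \<rho>) g"
    unfolding set_integrable_def using borel_integrable_compact[of "cball c \<rho>" g] assms
    by (auto intro: continuous_on_subset)
  thus ?thesis by (rule set_integrable_subset) auto
qed

definition ball_energy :: "real \<Rightarrow> (real^3 \<Rightarrow> complex) \<Rightarrow> real" where
  "ball_energy \<rho> f = (LINT x:ball 0 \<rho>|lborel. norm (f x) ^ 3)"

lemma set_integrable_cube:
  fixes f :: "real^3 \<Rightarrow> complex"
  assumes "continuous_on UNIV f" shows "set_integrable lborel (ball c \<rho>) (\<lambda>x. norm (f x) ^ 3)"
  using assms by (intro set_integrable_ball_continuous continuous_intros)

lemma ball_energy_nonneg [simp]: "ball_energy \<rho> f \<ge> 0"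
  unfolding ball_energy_def set_lebesgue_integral_def by (intro Bochner_Integration.integral_nonneg) simp

lemma ball_energy_bounded:
  assumes "continuous_on UNIV f" "\<And>x. norm (f x) \<le> A"
  shows "ball_energy \<rho> f \<le> A ^ 3 * measure lborel (ball (0::real^3) \<rho>)"
proof -
  have "ball_energy \<rho> f \<le> (LINT x:ball (0::real^3) \<rho>|lborel. A ^ 3)"
    unfolding ball_energy_def
    by (intro set_integral_mono set_integrable_cube assms power_mono norm_ge_zero set_integrable_ball_continuous continuous_intros)
  thus ?thesis by (simp add: mult.commute set_lebesgue_integral_def)
qed

lemma ball_energy_le:
  assumes "continuous_on UNIV f" "\<And>i. i \<in> I \<Longrightarrow> continuous_on UNIV (g i)" "finite I"
    and "\<And>x. x \<in> ball 0 \<rho> \<Longrightarrow> norm (f x) ^ 3 \<le> (\<Sum>i\<in>I. c i * norm (g i x) ^ 3)"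
  shows "ball_energy \<rho> f \<le> (\<Sum>i\<in>I. c i * ball_energy \<rho> (g i))"
proof -
  have "ball_energy \<rho> f \<le> (LINT x:ball 0 \<rho>|lborel. (\<Sum>i\<in>I. c i * norm (g i x) ^ 3))"
    unfolding ball_energy_def
    by (intro set_integral_mono set_integrable_cube assms set_integrable_ball_continuous continuous_intros)
  also have "\<dots> = (\<Sum>i\<in>I. (LINT x:ball 0 \<rho>|lborel. c i * norm (g i x) ^ 3))"
  proof -
    have "set_integrable lborel (ball 0 \<rho>) (\<lambda>x. c i * norm (g i x) ^ 3)" if "i \<in> I" for i
      using assms(2)[OF that] by (intro set_integrable_ball_continuous continuous_intros)
    thus ?thesis
      unfolding set_lebesgue_integral_def scaleR_sum_right set_integrable_def
      by (intro Bochner_Integration.integral_sum)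
  qed
  finally show ?thesis by (simp add: ball_energy_def)
qed

definition corner :: "nat \<Rightarrow> real \<Rightarrow> real" where
  "corner N u = real_of_int \<lfloor>real N * u\<rfloor> / real N"

text \<open>\<open>N\<close> times the difference between the point of the paraboloid above \<open>\<xi>\<close> and the point above
  the lower left corner of the square of \<open>\<xi>\<close>, in coordinates. The normalisation makes it
  bounded independently of \<open>N\<close>.\<close>

definition displacement :: "nat \<Rightarrow> 3 \<Rightarrow> real^2 \<Rightarrow> real" where
  "displacement N i \<xi> = (if i = 1 then real N * (\<xi> $ 1 - corner N (\<xi> $ 1))
     else if i = 2 then real N * (\<xi> $ 2 - corner N (\<xi> $ 2))
     else real N * ((\<xi> $ 1)\<^sup>2 - (corner N (\<xi> $ 1))\<^sup>2 + ((\<xi> $ 2)\<^sup>2 - (corner N (\<xi> $ 2))\<^sup>2)))"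

definition displacement_phase :: "nat \<Rightarrow> real^3 \<Rightarrow> real^2 \<Rightarrow> real" where
  "displacement_phase N x \<xi> = (\<Sum>i\<in>UNIV. x $ i / real N * displacement N i \<xi>)"

lemma borel_measurable_lebesgue_on: "f \<in> borel_measurable borel \<Longrightarrow> f \<in> borel_measurable (lebesgue_on S)"
  by (intro measurable_restrict_space1 measurable_completion) simp

lemma borel_measurable_displacement [measurable]: "displacement N i \<in> borel_measurable borel"
  unfolding displacement_def[abs_def] corner_def by (cases "i = 1"; cases "i = 2") simp_all

lemma borel_measurable_displacement_phase [measurable]: "displacement_phase N x \<in> borel_measurable borel"
  unfolding displacement_phase_def[abs_def] by measurable

lemma corner_bounds:
  assumes "N > 0" "0 \<le> u" "u \<le> 1"
  shows "0 \<le> real N * (u - corner N u)" "real N * (u - corner N u) \<le> 1" "0 \<le> corner N u" "corner N u \<le> 1" "corner N u \<le> u"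
proof -
  have N: "real N > 0" using assms by simp
  have eq: "real N * corner N u = real_of_int \<lfloor>real N * u\<rfloor>" using N by (simp add: corner_def)
  thus 1: "0 \<le> real N * (u - corner N u)" and "real N * (u - corner N u) \<le> 1"
    using floor_correct[of "real N * u"] by (auto simp: algebra_simps)
  show "0 \<le> corner N u" using assms by (simp add: corner_def)
  have "0 \<le> u - corner N u" using 1 N by (simp add: zero_le_mult_iff)
  thus "corner N u \<le> 1" "corner N u \<le> u" using assms by simp_all
qed

lemma displacement_bound:
  assumes N: "N > 0" and \<xi>: "\<xi> \<in> unit_square"
  shows "\<bar>displacement N i \<xi>\<bar> \<le> 4"
proof -
  have 1: "\<bar>real N * (u - corner N u)\<bar> \<le> 1" if "0 \<le> u" "u \<le> 1" for u
    using corner_bounds[OF N that] by simp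
  have 2: "\<bar>real N * (u\<^sup>2 - (corner N u)\<^sup>2)\<bar> \<le> 2" if u: "0 \<le> u" "u \<le> 1" for u
  proof -
    have eq: "real N * (u\<^sup>2 - (corner N u)\<^sup>2) = (real N * (u - corner N u)) * (u + corner N u)"
      by (simp add: power2_eq_square algebra_simps)
    have le: "(real N * (u - corner N u)) * (u + corner N u) \<le> 1 * 2"
      using corner_bounds[OF N u] u by (intro mult_mono) auto
    have ge: "0 \<le> (real N * (u - corner N u)) * (u + corner N u)"
      using corner_bounds[OF N u] u by (intro mult_nonneg_nonneg) auto
    show ?thesis unfolding eq abs_of_nonneg[OF ge] using le by simp
  qed
  have u: "0 \<le> \<xi> $ 1" "\<xi> $ 1 \<le> 1" "0 \<le> \<xi> $ 2" "\<xi> $ 2 \<le> 1" using \<xi> by (auto simp: in_unit_square_iff)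
  show ?thesis
    using 1[OF u(1,2)] 1[OF u(3,4)] 2[OF u(1,2)] 2[OF u(3,4)]
    unfolding displacement_def distrib_left by (simp only: split: if_split) linarith
qed

definition corner_phase :: "nat \<Rightarrow> real^3 \<Rightarrow> real^2 \<Rightarrow> real" where
  "corner_phase N x \<xi> = paraboloid_point (vector [corner N (\<xi> $ 1), corner N (\<xi> $ 2)]) \<bullet> x"

lemma displacement_phase_eq:
  assumes "N > 0"
  shows "displacement_phase N x \<xi> = paraboloid_point \<xi> \<bullet> x - corner_phase N x \<xi>"
  using assms
  by (simp add: displacement_phase_def corner_phase_def paraboloid_point_inner displacement_def sum_3 field_simps)

lemma ess_bounded_corner_phase:
  assumes H: "ess_bounded A H" and A: "A \<ge> 0"
  shows "ess_bounded A (\<lambda>\<xi>. H \<xi> * e (corner_phase N x \<xi>))"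
proof -
  have "(\<lambda>\<xi>. e (corner_phase N x \<xi>)) \<in> borel_measurable borel"
    unfolding corner_phase_def paraboloid_point_inner corner_def by simp
  from ess_bounded_mult[OF H borel_measurable_lebesgue_on[OF this] _ A, of 1] show ?thesis by simp
qed

definition taylor_term :: "nat \<Rightarrow> nat \<Rightarrow> (real^2 \<Rightarrow> complex) \<Rightarrow> real^3 \<Rightarrow> complex" where
  "taylor_term N k H x = extension (\<lambda>\<xi>. H \<xi> * of_real (displacement_phase N x \<xi>) ^ k) x"

lemma displacement_phase_bound:
  assumes N: "N > 0" and \<xi>: "\<xi> \<in> unit_square" and x: "norm x < \<delta> * real N"
  shows "\<bar>displacement_phase N x \<xi>\<bar> \<le> 12 * \<delta>"
proof -
  have xi: "\<bar>x $ i / real N\<bar> \<le> \<delta>" for i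
    using component_le_norm_cart[of x i] x N by (simp add: abs_divide divide_le_eq)
  have d0: "\<delta> \<ge> 0" using xi[of 1] abs_ge_zero order_trans by blast
  have "\<bar>displacement_phase N x \<xi>\<bar> \<le> (\<Sum>i\<in>UNIV. \<bar>x $ i / real N * displacement N i \<xi>\<bar>)"
    unfolding displacement_phase_def by (rule sum_abs)
  also have "\<dots> \<le> (\<Sum>i\<in>(UNIV::3 set). \<delta> * 4)"
    unfolding abs_mult by (intro sum_mono mult_mono xi displacement_bound N \<xi> d0) auto
  finally show ?thesis by simp
qed

lemma displacement_phase_bounded:
  assumes N: "N > 0" and \<xi>: "\<xi> \<in> unit_square"
  shows "\<bar>displacement_phase N x \<xi>\<bar> \<le> 12 * ((norm x + 1) / real N)"
  using N by (intro displacement_phase_bound assms) simp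

lemma ess_bounded_phase_power:
  assumes N: "N > 0" and H: "ess_bounded A H" and A: "A \<ge> 0"
  shows "\<exists>B. ess_bounded B (\<lambda>\<xi>. H \<xi> * of_real (displacement_phase N x \<xi>) ^ k)"
proof
  show "ess_bounded (A * (12 * ((norm x + 1) / real N)) ^ k) (\<lambda>\<xi>. H \<xi> * of_real (displacement_phase N x \<xi>) ^ k)"
  proof (rule ess_bounded_mult[OF H _ _ A])
    show "(\<lambda>\<xi>. complex_of_real (displacement_phase N x \<xi>) ^ k) \<in> borel_measurable (lebesgue_on unit_square)"
      by (intro borel_measurable_lebesgue_on) measurable
    show "norm (complex_of_real (displacement_phase N x \<xi>) ^ k) \<le> (12 * ((norm x + 1) / real N)) ^ k"
      if "\<xi> \<in> unit_square" for \<xi>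
      using displacement_phase_bounded[OF N that, of x] by (simp add: norm_power power_mono)
  qed
qed

text \<open>One factor of the phase is a combination of the numbers \<open>x $ i / N\<close>, which do not depend on
  \<open>\<xi>\<close>, with coefficients which are bounded functions of \<open>\<xi>\<close> and can be moved into \<open>H\<close>. The
  factor \<open>4\<close> keeps the new \<open>H\<close> below the old one.\<close>

lemma taylor_term_Suc:
  assumes N: "N > 0" and H: "ess_bounded A H" and A: "A \<ge> 0"
  shows "taylor_term N (Suc k) H x
     = (\<Sum>i\<in>UNIV. of_real (4 * x $ i / real N) * taylor_term N k (\<lambda>\<xi>. H \<xi> * of_real (displacement N i \<xi> / 4)) x)"
proof -
  let ?E = "\<lambda>\<xi>. e (paraboloid_point \<xi> \<bullet> x)"
  let ?\<theta> = "\<lambda>\<xi>. complex_of_real (displacement_phase N x \<xi>)"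
  let ?h = "\<lambda>i \<xi>. H \<xi> * of_real (displacement N i \<xi> / 4) * ?\<theta> \<xi> ^ k * ?E \<xi>"
  have int: "integrable (lebesgue_on unit_square) (?h i)" for i
  proof -
    have "ess_bounded (A * 1) (\<lambda>\<xi>. H \<xi> * of_real (displacement N i \<xi> / 4))"
      using displacement_bound[OF N, of _ i]
      by (intro ess_bounded_mult[OF H _ _ A] borel_measurable_lebesgue_on) (auto simp: norm_divide)
    from ess_bounded_phase_power[OF N this, of x k] A obtain B where
      "ess_bounded B (\<lambda>\<xi>. H \<xi> * of_real (displacement N i \<xi> / 4) * ?\<theta> \<xi> ^ k)" by auto
    thus ?thesis by (intro integrable_extension_integrand ess_bounded_integrable)
  qed
  have pt: "H \<xi> * ?\<theta> \<xi> ^ Suc k * ?E \<xi> = (\<Sum>i\<in>UNIV. of_real (4 * x $ i / real N) * ?h i \<xi>)" for \<xi>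
  proof -
    have "?\<theta> \<xi> = (\<Sum>i\<in>UNIV. of_real (4 * x $ i / real N) * of_real (displacement N i \<xi> / 4))"
      by (simp add: displacement_phase_def)
    hence "H \<xi> * ?\<theta> \<xi> ^ Suc k * ?E \<xi>
       = H \<xi> * (\<Sum>i\<in>UNIV. of_real (4 * x $ i / real N) * of_real (displacement N i \<xi> / 4)) * ?\<theta> \<xi> ^ k * ?E \<xi>"
      by (simp only: power_Suc mult.assoc)
    thus ?thesis by (simp add: sum_distrib_left sum_distrib_right mult_ac)
  qed
  have "taylor_term N (Suc k) H x = (LINT \<xi>|lebesgue_on unit_square. (\<Sum>i\<in>UNIV. of_real (4 * x $ i / real N) * ?h i \<xi>))"
    unfolding taylor_term_def extension_on_def pt ..
  also have "\<dots> = (\<Sum>i\<in>UNIV. (LINT \<xi>|lebesgue_on unit_square. of_real (4 * x $ i / real N) * ?h i \<xi>))"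
    by (intro Bochner_Integration.integral_sum integrable_mult_right int)
  also have "\<dots> = (\<Sum>i\<in>UNIV. of_real (4 * x $ i / real N) * (LINT \<xi>|lebesgue_on unit_square. ?h i \<xi>))"
    by (simp only: integral_mult_right_zero)
  finally show ?thesis by (simp only: taylor_term_def extension_on_def)
qed

lemma norm_sum3_pow3_le:
  fixes z :: "3 \<Rightarrow> complex"
  shows "norm (\<Sum>i\<in>UNIV. z i) ^ 3 \<le> 9 * (\<Sum>i\<in>UNIV. norm (z i) ^ 3)"
proof -
  have conv: "(a + b + c) ^ 3 \<le> 9 * (a ^ 3 + b ^ 3 + c ^ 3)" if "a \<ge> 0" "b \<ge> 0" "c \<ge> 0" for a b c :: real
  proof -
    have ab: "a * b * (a + b) \<le> a ^ 3 + b ^ 3" if "a \<ge> 0" "b \<ge> 0" for a b :: real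
    proof -
      have "0 \<le> (a + b) * (a - b)\<^sup>2" using that by (intro mult_nonneg_nonneg) auto
      also have "\<dots> = a ^ 3 + b ^ 3 - a * b * (a + b)" by (simp add: power2_eq_square power3_eq_cube algebra_simps)
      finally show ?thesis by simp
    qed
    have am: "3 * (a * b * c) \<le> a ^ 3 + b ^ 3 + c ^ 3"
    proof -
      have "0 \<le> (a + b + c) * ((a - b)\<^sup>2 + (b - c)\<^sup>2 + (c - a)\<^sup>2)" using that by simp
      also have "\<dots> = 2 * (a ^ 3 + b ^ 3 + c ^ 3 - 3 * (a * b * c))"
        by (simp add: power2_eq_square power3_eq_cube algebra_simps)
      finally show ?thesis by simp
    qed
    have "(a + b + c) ^ 3 = a ^ 3 + b ^ 3 + c ^ 3 + 3 * (a * b * (a + b)) + 3 * (b * c * (b + c)) + 3 * (a * c * (a + c)) + 6 * (a * b * c)"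
      by (simp add: power3_eq_cube algebra_simps)
    thus ?thesis using ab[of a b] ab[of b c] ab[of a c] am that by simp
  qed
  have "norm (\<Sum>i\<in>UNIV. z i) ^ 3 \<le> (\<Sum>i\<in>UNIV. norm (z i)) ^ 3"
    by (intro power_mono norm_sum) simp
  also have "\<dots> \<le> 9 * (\<Sum>i\<in>UNIV. norm (z i) ^ 3)"
    using conv[of "norm (z 1)" "norm (z 2)" "norm (z 3)"] by (simp add: sum_3)
  finally show ?thesis .
qed

text \<open>If \<open>Q\<close> bounds the energy of all extensions of functions bounded by one, then a Taylor term of
  order \<open>k\<close> gains the cube of \<open>(12 \<delta>) ^ k\<close> over it: on a ball of radius \<open>\<delta> N\<close> each factor of the
  phase yields three numbers of size at most \<open>4 \<delta>\<close>, times extensions in the same class.\<close>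

lemma taylor_term_energy:
  assumes N: "N > 0" and \<delta>: "\<delta> > 0" and Q: "\<And>F. ess_bounded 1 F \<Longrightarrow> ball_energy (\<delta> * real N) (extension F) \<le> Q"
    and H: "ess_bounded 1 H"
  shows "continuous_on UNIV (taylor_term N k H) \<and> ball_energy (\<delta> * real N) (taylor_term N k H) \<le> ((12 * \<delta>) ^ k) ^ 3 * Q"
  using H
proof (induction k arbitrary: H)
  case 0
  have "taylor_term N 0 H = extension H" by (simp add: taylor_term_def fun_eq_iff)
  thus ?case using 0 Q by (simp add: continuous_on_extension_on ess_bounded_integrable)
next
  case (Suc k)
  define H' where "H' i = (\<lambda>\<xi>. H \<xi> * complex_of_real (displacement N i \<xi> / 4))" for i
  have H': "ess_bounded 1 (H' i)" for i
  proof -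
    have "ess_bounded (1 * 1) (H' i)" unfolding H'_def
      using displacement_bound[OF N, of _ i]
      by (intro ess_bounded_mult[OF Suc.prems] borel_measurable_lebesgue_on) (auto simp: norm_divide)
    thus ?thesis by simp
  qed
  have eq: "taylor_term N (Suc k) H = (\<lambda>x. \<Sum>i\<in>UNIV. of_real (4 * x $ i / real N) * taylor_term N k (H' i) x)"
    unfolding H'_def fun_eq_iff by (intro allI taylor_term_Suc[OF N Suc.prems]) simp
  have cont: "continuous_on UNIV (taylor_term N k (H' i))"
    and en: "ball_energy (\<delta> * real N) (taylor_term N k (H' i)) \<le> ((12 * \<delta>) ^ k) ^ 3 * Q" for i
    using Suc.IH[OF H'] by auto
  have c: "continuous_on UNIV (taylor_term N (Suc k) H)"
    unfolding eq by (intro continuous_intros cont) (use N in auto)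
  have "ball_energy (\<delta> * real N) (taylor_term N (Suc k) H)
     \<le> (\<Sum>i\<in>UNIV. (9 * (4 * \<delta>) ^ 3) * ball_energy (\<delta> * real N) (taylor_term N k (H' i)))"
  proof (rule ball_energy_le[OF c cont])
    fix x :: "real^3" assume "x \<in> ball 0 (\<delta> * real N)"
    hence x: "norm x < \<delta> * real N" by simp
    have xi: "\<bar>4 * x $ i / real N\<bar> \<le> 4 * \<delta>" for i
      using component_le_norm_cart[of x i] x N by (simp add: abs_divide abs_mult divide_le_eq)
    have "norm (taylor_term N (Suc k) H x) ^ 3 \<le> 9 * (\<Sum>i\<in>UNIV. norm (of_real (4 * x $ i / real N) * taylor_term N k (H' i) x) ^ 3)"
      unfolding eq by (rule norm_sum3_pow3_le)
    also have "\<dots> \<le> 9 * (\<Sum>i\<in>UNIV. (4 * \<delta>) ^ 3 * norm (taylor_term N k (H' i) x) ^ 3)"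
      unfolding norm_mult norm_of_real power_mult_distrib[of "\<bar>_\<bar>"]
      by (intro mult_left_mono sum_mono mult_right_mono power_mono xi) auto
    finally show "norm (taylor_term N (Suc k) H x) ^ 3 \<le> (\<Sum>i\<in>UNIV. (9 * (4 * \<delta>) ^ 3) * norm (taylor_term N k (H' i) x) ^ 3)"
      by (simp add: sum_distrib_left mult.assoc)
  qed simp
  also have "\<dots> \<le> (\<Sum>i\<in>(UNIV::3 set). (9 * (4 * \<delta>) ^ 3) * (((12 * \<delta>) ^ k) ^ 3 * Q))"
    using \<delta> by (intro sum_mono mult_left_mono en) auto
  also have "\<dots> = ((12 * \<delta>) ^ Suc k) ^ 3 * Q"
    by (simp add: power_mult_distrib power3_eq_cube)
  finally show ?case using c by simp
qed

text \<open>A substitute for the triangle inequality in \<open>L\<^sup>3\<close>; the powers of \<open>4\<close> are harmless for series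
  with geometric decay.\<close>

lemma norm_sum_pow3_le:
  fixes z :: "nat \<Rightarrow> complex"
  shows "norm (\<Sum>k<n. z k) ^ 3 \<le> (\<Sum>k<n. 4 ^ Suc k * norm (z k) ^ 3)"
proof (induction n arbitrary: z)
  case (Suc n)
  have "norm (\<Sum>k<Suc n. z k) ^ 3 \<le> 4 * norm (z 0) ^ 3 + 4 * norm (\<Sum>k<n. z (Suc k)) ^ 3"
    unfolding sum.lessThan_Suc_shift by (rule norm_add_pow3_le)
  also have "\<dots> \<le> 4 * norm (z 0) ^ 3 + 4 * (\<Sum>k<n. 4 ^ Suc k * norm (z (Suc k)) ^ 3)"
    using Suc.IH[of "\<lambda>k. z (Suc k)"] by simp
  also have "\<dots> = (\<Sum>k<Suc n. 4 ^ Suc k * norm (z k) ^ 3)"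
    unfolding sum.lessThan_Suc_shift by (simp add: sum_distrib_left mult.assoc)
  finally show ?case .
qed simp

lemma measure_cell:
  assumes "N > 0" shows "measure lebesgue (cell N a) = 1 / (real N)\<^sup>2"
proof -
  have "vector [real (a mod N) / real N, real (a div N) / real N] \<in> cell N a"
    using assms by (simp add: cell_def in_grid_square_iff)
  hence "cell N a \<noteq> {}" by blast
  hence "measure lborel (cell N a) = 1 / (real N)\<^sup>2"
    unfolding cell_def grid_square_def
    by (subst content_cbox_cart) (auto simp: UNIV_2 power2_eq_square diff_divide_distrib[symmetric])
  thus ?thesis by (simp add: cell_def grid_square_def)
qed

lemma cell_lmeasurable: "cell N a \<in> lmeasurable"
  by (simp add: cell_def grid_square_def)

definition cell_mean :: "nat \<Rightarrow> (real^2 \<Rightarrow> complex) \<Rightarrow> nat \<Rightarrow> complex" where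
  "cell_mean N F a = of_nat (N\<^sup>2) * (LINT \<xi>|lebesgue_on (cell N a). F \<xi>)"

definition cell_average :: "nat \<Rightarrow> (real^2 \<Rightarrow> complex) \<Rightarrow> real^2 \<Rightarrow> complex" where
  "cell_average N F \<xi> = (\<Sum>a<N\<^sup>2. cell_mean N F a * of_real (indicator (cell N a) \<xi>))"

lemma norm_cell_mean_le:
  assumes N: "N > 0" and F: "ess_bounded A F" and a: "a < N\<^sup>2"
  shows "norm (cell_mean N F a) \<le> A"
proof -
  have sub: "cell N a \<subseteq> unit_square" by (rule cell_subset_unit_square[OF N a])
  have int: "integrable (lebesgue_on (cell N a)) F"
    by (rule integrable_on_cell[OF N a ess_bounded_integrable[OF F]])
  have "AE \<xi> in lebesgue_on unit_square. norm (F \<xi>) \<le> A" using F by (simp add: ess_bounded_def)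
  hence "AE \<xi> in lebesgue. \<xi> \<in> unit_square \<longrightarrow> norm (F \<xi>) \<le> A"
    by (subst (asm) AE_restrict_space_iff) (auto simp: unit_square_def)
  hence "AE \<xi> in lebesgue. \<xi> \<in> cell N a \<longrightarrow> norm (F \<xi>) \<le> A"
    by eventually_elim (use sub in blast)
  hence AE: "AE \<xi> in lebesgue_on (cell N a). norm (F \<xi>) \<le> A"
    by (subst AE_restrict_space_iff) auto
  have "norm (LINT \<xi>|lebesgue_on (cell N a). F \<xi>) \<le> 1 / (real N)\<^sup>2 * A"
    using norm_integral_lebesgue_on_le[OF cell_lmeasurable int AE] by (simp only: measure_cell[OF N])
  hence "(real N)\<^sup>2 * norm (LINT \<xi>|lebesgue_on (cell N a). F \<xi>) \<le> (real N)\<^sup>2 * (1 / (real N)\<^sup>2 * A)"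
    by (rule mult_left_mono) simp
  thus ?thesis using N by (simp add: cell_mean_def norm_mult norm_power)
qed

lemma AE_cell_average:
  assumes N: "N > 0"
  shows "AE \<xi> in lebesgue. \<forall>a<N\<^sup>2. \<xi> \<in> cell N a \<longrightarrow> cell_average N F \<xi> = cell_mean N F a"
  using AE_cells_disjoint[OF N]
proof eventually_elim
  case (elim \<xi>)
  show ?case
  proof (intro allI impI)
    fix a assume a: "a < N\<^sup>2" "\<xi> \<in> cell N a"
    have "cell_average N F \<xi> = (\<Sum>b<N\<^sup>2. if b = a then cell_mean N F a else 0)"
      unfolding cell_average_def using elim a(2) by (intro sum.cong) (auto simp: indicator_def)
    thus "cell_average N F \<xi> = cell_mean N F a" using a by simp
  qed
qed

lemma ess_bounded_cell_average:
  assumes N: "N > 0" and F: "ess_bounded A F"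
  shows "ess_bounded A (cell_average N F)"
proof -
  have "cell_average N F \<in> borel_measurable (lebesgue_on unit_square)"
    unfolding cell_average_def[abs_def] by (intro borel_measurable_lebesgue_on) measurable
  moreover have "AE \<xi> in lebesgue_on unit_square. norm (cell_average N F \<xi>) \<le> A"
  proof -
    have "AE \<xi> in lebesgue. \<xi> \<in> unit_square \<longrightarrow> norm (cell_average N F \<xi>) \<le> A"
      using AE_cell_average[OF N, of F]
    proof eventually_elim
      case (elim \<xi>)
      show ?case
      proof
        assume "\<xi> \<in> unit_square"
        then obtain a where a: "a < N\<^sup>2" "\<xi> \<in> cell N a" using Union_cells[OF N] by blast
        thus "norm (cell_average N F \<xi>) \<le> A" using elim norm_cell_mean_le[OF N F a(1)] by simp
      qed
    qed
    thus ?thesis by (subst AE_restrict_space_iff) (auto simp: unit_square_def)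
  qed
  ultimately show ?thesis by (simp add: ess_bounded_def)
qed

lemma piecewise_constant_cell_average:
  assumes N: "N > 0" and F: "ess_bounded 1 F"
  shows "piecewise_constant N (cell_average N F)"
  unfolding piecewise_constant_def
proof (intro conjI allI impI)
  show "integrable (lebesgue_on unit_square) (cell_average N F)"
    by (rule ess_bounded_integrable[OF ess_bounded_cell_average[OF N F]])
  fix a assume a: "a < N\<^sup>2"
  show "\<exists>\<alpha>. norm \<alpha> \<le> 1 \<and> (AE \<xi> in lebesgue. \<xi> \<in> cell N a \<longrightarrow> cell_average N F \<xi> = \<alpha>)"
  proof (intro exI conjI)
    show "norm (cell_mean N F a) \<le> 1" by (rule norm_cell_mean_le[OF N F a])
    show "AE \<xi> in lebesgue. \<xi> \<in> cell N a \<longrightarrow> cell_average N F \<xi> = cell_mean N F a"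
      using AE_cell_average[OF N, of F] by eventually_elim (use a in blast)
  qed
qed

lemma integral_cell_average:
  assumes N: "N > 0" and F: "ess_bounded A F" and a: "a < N\<^sup>2"
  shows "(LINT \<xi>|lebesgue_on (cell N a). cell_average N F \<xi>) = (LINT \<xi>|lebesgue_on (cell N a). F \<xi>)"
proof -
  have "AE \<xi> in lebesgue. \<xi> \<in> cell N a \<longrightarrow> cell_average N F \<xi> = cell_mean N F a"
    using AE_cell_average[OF N, of F] by eventually_elim (use a in blast)
  hence AE: "AE \<xi> in lebesgue_on (cell N a). cell_average N F \<xi> = cell_mean N F a"
    by (subst AE_restrict_space_iff) auto
  have "(LINT \<xi>|lebesgue_on (cell N a). cell_average N F \<xi>) = (LINT \<xi>|lebesgue_on (cell N a). cell_mean N F a)"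
    using AE integrable_on_cell[OF N a ess_bounded_integrable[OF ess_bounded_cell_average[OF N F]]]
    by (intro integral_cong_AE) auto
  also have "\<dots> = cell_mean N F a / of_nat (N\<^sup>2)"
    using measure_cell[OF N, of a] by (simp add: measure_restrict_space scaleR_conv_of_real)
  also have "\<dots> = (LINT \<xi>|lebesgue_on (cell N a). F \<xi>)"
    using N by (simp add: cell_mean_def)
  finally show ?thesis .
qed

text \<open>On a single square the corner phase is almost everywhere constant, so only the mean of \<open>H\<close>
  over the square enters.\<close>

lemma corner_phase_integral_zero:
  assumes N: "N > 0" and H: "ess_bounded A H" and A: "A \<ge> 0"
    and z: "\<And>a. a < N\<^sup>2 \<Longrightarrow> (LINT \<xi>|lebesgue_on (cell N a). H \<xi>) = 0"
  shows "(LINT \<xi>|lebesgue_on unit_square. H \<xi> * e (corner_phase N x \<xi>)) = 0"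
proof -
  define F where "F \<xi> = H \<xi> * e (corner_phase N x \<xi>)" for \<xi>
  have Fi: "integrable (lebesgue_on unit_square) F"
    unfolding F_def by (rule ess_bounded_integrable[OF ess_bounded_corner_phase[OF H A]])
  have e0: "extension_on S F 0 = (LINT \<xi>|lebesgue_on S. F \<xi>)" for S
    by (simp add: extension_on_def)
  have "(LINT \<xi>|lebesgue_on (cell N a). F \<xi>) = 0" if a: "a < N\<^sup>2" for a
  proof -
    define \<gamma> where "\<gamma> = e (paraboloid_point (vector [real (a mod N) / real N, real (a div N) / real N]) \<bullet> x)"
    have "AE \<xi> in lebesgue. \<xi> \<in> cell N a \<longrightarrow> F \<xi> = \<gamma> * H \<xi>"
      using AE_cell_floor[OF N]
      by eventually_elim (auto simp: F_def corner_phase_def corner_def \<gamma>_def)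
    hence AE: "AE \<xi> in lebesgue_on (cell N a). F \<xi> = \<gamma> * H \<xi>"
      by (subst AE_restrict_space_iff) auto
    have "(LINT \<xi>|lebesgue_on (cell N a). F \<xi>) = (LINT \<xi>|lebesgue_on (cell N a). \<gamma> * H \<xi>)"
      using AE integrable_on_cell[OF N a Fi] integrable_on_cell[OF N a ess_bounded_integrable[OF H]]
      by (intro integral_cong_AE) auto
    thus ?thesis using z[OF a] by simp
  qed
  thus ?thesis using extension_eq_sum_cells[OF N Fi, of 0] by (simp add: e0 F_def)
qed

text \<open>The phase of the extension is the corner phase plus the displacement phase. With the corner
  phase alone the integral vanishes; hence \<open>H\<close> may be integrated against
  \<open>e(phase) (1 - exp \<zeta>)\<close> instead, where \<open>\<zeta>\<close> is small, and the exponential series starts with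
  the term of order one.\<close>

lemma extension_taylor_remainder:
  assumes N: "N > 0" and H: "ess_bounded 2 H"
    and z: "\<And>a. a < N\<^sup>2 \<Longrightarrow> (LINT \<xi>|lebesgue_on (cell N a). H \<xi>) = 0"
    and x: "norm x < \<delta> * real N" and \<delta>: "24 * pi * \<delta> \<le> 1"
  shows "norm (extension H x + (\<Sum>k<n. (- (2 * of_real pi * \<i>)) ^ Suc k / fact (Suc k) * taylor_term N (Suc k) H x)) \<le> 2 / fact n"
proof -
  let ?E = "\<lambda>\<xi>. e (paraboloid_point \<xi> \<bullet> x)"
  let ?c = "- (2 * of_real pi * \<i>) :: complex"
  define \<zeta> where "\<zeta> \<xi> = ?c * of_real (displacement_phase N x \<xi>)" for \<xi>
  define g where "g k \<xi> = H \<xi> * of_real (displacement_phase N x \<xi>) ^ k * ?E \<xi>" for k \<xi>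
  have gi: "integrable (lebesgue_on unit_square) (g k)" for k
  proof -
    obtain B where "ess_bounded B (\<lambda>\<xi>. H \<xi> * of_real (displacement_phase N x \<xi>) ^ k)"
      using ess_bounded_phase_power[OF N H, of x k] by auto
    thus ?thesis unfolding g_def by (intro integrable_extension_integrand ess_bounded_integrable)
  qed
  have T: "taylor_term N k H x = (LINT \<xi>|lebesgue_on unit_square. g k \<xi>)" for k
    by (simp add: taylor_term_def extension_on_def g_def)
  have E0: "extension H x = (LINT \<xi>|lebesgue_on unit_square. g 0 \<xi>)"
    by (simp add: extension_on_def g_def)
  have expz: "e (corner_phase N x \<xi>) = ?E \<xi> * exp (\<zeta> \<xi>)" for \<xi>
  proof -
    have "corner_phase N x \<xi> = paraboloid_point \<xi> \<bullet> x + (- displacement_phase N x \<xi>)"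
      using displacement_phase_eq[OF N, of x \<xi>] by simp
    moreover have "e (- displacement_phase N x \<xi>) = exp (\<zeta> \<xi>)" by (simp add: e_def \<zeta>_def)
    ultimately show ?thesis by (simp only: e_add)
  qed
  have series: "g 0 \<xi> + (\<Sum>k<n. ?c ^ Suc k / fact (Suc k) * g (Suc k) \<xi>) = H \<xi> * ?E \<xi> * (\<Sum>k\<le>n. \<zeta> \<xi> ^ k / fact k)" for \<xi>
  proof -
    have "(\<Sum>k\<le>n. \<zeta> \<xi> ^ k / fact k) = (\<Sum>k<Suc n. \<zeta> \<xi> ^ k / fact k)" by (simp add: lessThan_Suc_atMost)
    also have "\<dots> = 1 + (\<Sum>k<n. \<zeta> \<xi> ^ Suc k / fact (Suc k))" by (subst sum.lessThan_Suc_shift) simp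
    finally have "H \<xi> * ?E \<xi> * (\<Sum>k\<le>n. \<zeta> \<xi> ^ k / fact k)
       = H \<xi> * ?E \<xi> + (\<Sum>k<n. H \<xi> * ?E \<xi> * (\<zeta> \<xi> ^ Suc k / fact (Suc k)))"
      by (simp only: distrib_left sum_distrib_left mult_1_right)
    also have "(\<Sum>k<n. H \<xi> * ?E \<xi> * (\<zeta> \<xi> ^ Suc k / fact (Suc k))) = (\<Sum>k<n. ?c ^ Suc k / fact (Suc k) * g (Suc k) \<xi>)"
    proof (intro sum.cong refl)
      fix k
      have "\<zeta> \<xi> ^ Suc k = ?c ^ Suc k * of_real (displacement_phase N x \<xi>) ^ Suc k"
        unfolding \<zeta>_def by (rule power_mult_distrib)
      thus "H \<xi> * ?E \<xi> * (\<zeta> \<xi> ^ Suc k / fact (Suc k)) = ?c ^ Suc k / fact (Suc k) * g (Suc k) \<xi>"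
        unfolding g_def by (simp only: times_divide_eq_right times_divide_eq_left mult_ac)
    qed
    finally show ?thesis by (simp add: g_def)
  qed
  define r where "r \<xi> = H \<xi> * ?E \<xi> * (\<Sum>k\<le>n. \<zeta> \<xi> ^ k / fact k) - H \<xi> * e (corner_phase N x \<xi>)" for \<xi>
  have gsum: "integrable (lebesgue_on unit_square) (\<lambda>\<xi>. g 0 \<xi> + (\<Sum>k<n. ?c ^ Suc k / fact (Suc k) * g (Suc k) \<xi>))"
    by (intro Bochner_Integration.integrable_add Bochner_Integration.integrable_sum integrable_mult_right gi)
  have ci: "integrable (lebesgue_on unit_square) (\<lambda>\<xi>. H \<xi> * e (corner_phase N x \<xi>))"
    by (rule ess_bounded_integrable[OF ess_bounded_corner_phase[OF H]]) simp
  have ri: "integrable (lebesgue_on unit_square) r"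
    unfolding r_def using gsum[unfolded series] ci by (rule Bochner_Integration.integrable_diff)
  have "extension H x + (\<Sum>k<n. ?c ^ Suc k / fact (Suc k) * taylor_term N (Suc k) H x)
      = (LINT \<xi>|lebesgue_on unit_square. g 0 \<xi> + (\<Sum>k<n. ?c ^ Suc k / fact (Suc k) * g (Suc k) \<xi>))"
    unfolding E0 T
    by (subst Bochner_Integration.integral_add, rule gi,
        intro Bochner_Integration.integrable_sum integrable_mult_right gi,
        subst Bochner_Integration.integral_sum, intro integrable_mult_right gi)
       (simp only: integral_mult_right_zero)
  also have "\<dots> = (LINT \<xi>|lebesgue_on unit_square. r \<xi>)"
    unfolding series r_def
    using corner_phase_integral_zero[OF N H _ z, of x]
    by (subst Bochner_Integration.integral_diff[OF gsum[unfolded series] ci]) simp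
  finally have eq: "extension H x + (\<Sum>k<n. ?c ^ Suc k / fact (Suc k) * taylor_term N (Suc k) H x) = (LINT \<xi>|lebesgue_on unit_square. r \<xi>)" .
  have rb: "AE \<xi> in lebesgue_on unit_square. norm (r \<xi>) \<le> 2 / fact n"
  proof -
    have "AE \<xi> in lebesgue_on unit_square. \<xi> \<in> unit_square" by (rule AE_I2) (simp add: space_restrict_space)
    moreover have "AE \<xi> in lebesgue_on unit_square. norm (H \<xi>) \<le> 2" using H by (simp add: ess_bounded_def)
    ultimately show ?thesis
    proof eventually_elim
      case (elim \<xi>)
      have "norm (\<zeta> \<xi>) = 2 * pi * \<bar>displacement_phase N x \<xi>\<bar>" by (simp add: \<zeta>_def norm_mult)
      also have "\<dots> \<le> 2 * pi * (12 * \<delta>)"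
        using displacement_phase_bound[OF N elim(1) x] by (intro mult_left_mono) auto
      also have "\<dots> \<le> 1" using \<delta> by simp
      finally have z1: "norm (\<zeta> \<xi>) \<le> 1" .
      have "norm (exp (\<zeta> \<xi>) - (\<Sum>k\<le>n. \<zeta> \<xi> ^ k / fact k)) \<le> exp \<bar>Re (\<zeta> \<xi>)\<bar> * norm (\<zeta> \<xi>) ^ Suc n / fact n"
        by (rule Taylor_exp)
      also have "\<dots> \<le> 1 / fact n"
        using z1 by (intro divide_right_mono) (auto simp: \<zeta>_def power_le_one mult_le_one simp del: power_Suc)
      finally have t: "norm (exp (\<zeta> \<xi>) - (\<Sum>k\<le>n. \<zeta> \<xi> ^ k / fact k)) \<le> 1 / fact n" .
      have "r \<xi> = - (H \<xi> * ?E \<xi> * (exp (\<zeta> \<xi>) - (\<Sum>k\<le>n. \<zeta> \<xi> ^ k / fact k)))"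
        unfolding r_def expz by (simp add: algebra_simps)
      hence "norm (r \<xi>) = norm (H \<xi>) * norm (exp (\<zeta> \<xi>) - (\<Sum>k\<le>n. \<zeta> \<xi> ^ k / fact k))"
        by (simp add: norm_mult)
      also have "\<dots> \<le> 2 * (1 / fact n)" using elim(2) t by (intro mult_mono) auto
      finally show ?case by simp
    qed
  qed
  show ?thesis unfolding eq
    using norm_integral_lebesgue_on_le[OF unit_square_lmeasurable ri rb] by (simp add: measure_unit_square)
qed

lemma ball_energy_add_le:
  assumes "continuous_on UNIV f" "continuous_on UNIV g"
  shows "ball_energy \<rho> (\<lambda>x. f x + g x) \<le> 4 * ball_energy \<rho> f + 4 * ball_energy \<rho> g"
proof -
  have "ball_energy \<rho> (\<lambda>x. f x + g x) \<le> (\<Sum>i\<in>(UNIV::bool set). 4 * ball_energy \<rho> (if i then f else g))"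
    by (rule ball_energy_le) (use assms in \<open>auto simp: UNIV_bool intro!: continuous_intros norm_add_pow3_le[THEN order_trans]\<close>)
  thus ?thesis by (simp add: UNIV_bool)
qed

lemma ball_energy_cmult: "ball_energy \<rho> (\<lambda>x. c * f x) = norm c ^ 3 * ball_energy \<rho> f"
  unfolding ball_energy_def by (simp add: norm_mult power_mult_distrib)

lemma ball_energy_sum_le:
  assumes "\<And>k. continuous_on UNIV (z k)"
  shows "ball_energy \<rho> (\<lambda>x. \<Sum>k<n. z k x) \<le> (\<Sum>k<n. 4 ^ Suc k * ball_energy \<rho> (z k))"
  by (rule ball_energy_le) (use assms in \<open>auto intro!: continuous_intros norm_sum_pow3_le simp del: power_Suc\<close>)

lemma sum_power_Suc_le:
  fixes q :: real
  assumes "0 \<le> q" "q \<le> 1/200" shows "(\<Sum>k<n. q ^ Suc k) \<le> 1 / 199"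
proof -
  have "(\<Sum>k<n. q ^ Suc k) \<le> (\<Sum>k<n. (1/200) ^ Suc k)"
    using assms by (intro sum_mono power_mono) auto
  also have "\<dots> = (1/200) * (\<Sum>k<n. (1/200::real) ^ k)" by (simp add: sum_distrib_left)
  also have "\<dots> = (1 - (1/200) ^ n) / 199" by (subst sum_gp_strict) simp
  also have "\<dots> \<le> 1 / 199" by (intro divide_right_mono) auto
  finally show ?thesis .
qed

text \<open>Replacing \<open>F\<close> by its averages over the squares leaves a function with mean zero on each
  square, whose Taylor terms on the small ball are a geometric series in terms of the bound
  \<open>Q\<close> for arbitrary bounded functions. The radius \<open>N / 1000\<close> makes the series small enough for
  the total coefficient of \<open>Q\<close> to be less than one.\<close>

lemma energy_step:
  assumes N: "N > 0"
    and X: "\<And>G. piecewise_constant N G \<Longrightarrow> ball_energy (real N / 1000) (extension G) \<le> X"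
    and Q: "\<And>F. ess_bounded 1 F \<Longrightarrow> ball_energy (real N / 1000) (extension F) \<le> Q" and Q0: "Q \<ge> 0"
    and F: "ess_bounded 1 F"
  shows "ball_energy (real N / 1000) (extension F)
    \<le> 4 * X + 3 / 4 * Q + 128 * ((2 / fact n) ^ 3 * ball_energy (real N / 1000) (\<lambda>_. 1))"
proof -
  define \<rho> where "\<rho> = real N / 1000"
  have \<rho>: "1 / 1000 * real N = \<rho>" by (simp add: \<rho>_def)
  define G where "G = cell_average N F"
  define H where "H \<xi> = (F \<xi> - G \<xi>) / 2" for \<xi>
  have Gb: "ess_bounded 1 G" unfolding G_def by (rule ess_bounded_cell_average[OF N F])
  have H1: "ess_bounded 1 H"
  proof -
    have "AE \<xi> in lebesgue_on unit_square. norm (F \<xi>) \<le> 1" "AE \<xi> in lebesgue_on unit_square. norm (G \<xi>) \<le> 1"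
      using F Gb by (auto simp: ess_bounded_def)
    hence "AE \<xi> in lebesgue_on unit_square. norm (H \<xi>) \<le> 1"
    proof eventually_elim
      case (elim \<xi>)
      thus ?case using norm_triangle_ineq4[of "F \<xi>" "G \<xi>"] by (simp add: H_def norm_divide)
    qed
    moreover have "H \<in> borel_measurable (lebesgue_on unit_square)"
      unfolding H_def[abs_def] using F Gb by (auto simp: ess_bounded_def intro!: borel_measurable_diff borel_measurable_divide)
    ultimately show ?thesis by (simp add: ess_bounded_def)
  qed
  have H2: "ess_bounded 2 H"
    using H1 unfolding ess_bounded_def by (auto elim!: eventually_mono)
  have z: "(LINT \<xi>|lebesgue_on (cell N a). H \<xi>) = 0" if a: "a < N\<^sup>2" for a
  proof -
    have "(LINT \<xi>|lebesgue_on (cell N a). F \<xi> - G \<xi>) = 0"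
      using integral_cell_average[OF N F a] integrable_on_cell[OF N a ess_bounded_integrable[OF F]]
        integrable_on_cell[OF N a ess_bounded_integrable[OF Gb]]
      by (simp add: G_def)
    thus ?thesis unfolding H_def by simp
  qed
  define c :: "nat \<Rightarrow> complex" where "c k = (- (2 * of_real pi * \<i>)) ^ Suc k / fact (Suc k)" for k
  define T where "T k = taylor_term N (Suc k) H" for k
  define r where "r x = extension H x + (\<Sum>k<n. c k * T k x)" for x
  have Hi: "integrable (lebesgue_on unit_square) H" by (rule ess_bounded_integrable[OF H1])
  have cE: "continuous_on UNIV (extension H)" by (rule continuous_on_extension_on[OF Hi])
  have Tc: "continuous_on UNIV (T k)" and Te: "ball_energy \<rho> (T k) \<le> ((12 * (1/1000)) ^ Suc k) ^ 3 * Q" for k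
    using taylor_term_energy[OF N _ _ H1, of "1/1000" Q "Suc k"] Q unfolding \<rho> T_def \<rho>_def[symmetric] by auto
  have rc: "continuous_on UNIV r" unfolding r_def by (intro continuous_intros cE Tc)
  have rb: "ball_energy \<rho> r \<le> (2 / fact n) ^ 3 * ball_energy \<rho> (\<lambda>_. 1)"
  proof -
    have "ball_energy \<rho> r \<le> (\<Sum>i\<in>{()}. (2 / fact n) ^ 3 * ball_energy \<rho> (\<lambda>_. 1))"
    proof (rule ball_energy_le[OF rc])
      fix x :: "real^3" assume "x \<in> ball 0 \<rho>"
      hence x: "norm x < 1 / 1000 * real N" by (simp add: \<rho>_def)
      have d: "24 * pi * (1 / 1000) \<le> 1" using pi_less_4 by simp
      have "norm (r x) \<le> 2 / fact n"
        using extension_taylor_remainder[OF N H2 z x d, of n] by (simp add: r_def c_def T_def)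
      hence "norm (r x) ^ 3 \<le> (2 / fact n) ^ 3" by (intro power_mono) auto
      thus "norm (r x) ^ 3 \<le> (\<Sum>i\<in>{()}. (2 / fact n) ^ 3 * norm (1::complex) ^ 3)" by simp
    qed auto
    thus ?thesis by simp
  qed
  have Tsum: "ball_energy \<rho> (\<lambda>x. \<Sum>k<n. c k * T k x) \<le> 1 / 199 * Q"
  proof -
    have "ball_energy \<rho> (\<lambda>x. \<Sum>k<n. c k * T k x) \<le> (\<Sum>k<n. 4 ^ Suc k * ball_energy \<rho> (\<lambda>x. c k * T k x))"
      by (intro ball_energy_sum_le continuous_intros Tc)
    also have "\<dots> \<le> (\<Sum>k<n. (4 * (8 * (12 * (1/1000))) ^ 3) ^ Suc k * Q)"
    proof (rule sum_mono)
      fix k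
      have "norm (c k) = (2 * pi) ^ Suc k / fact (Suc k)"
        by (simp add: c_def norm_divide norm_power norm_mult del: power_Suc fact_Suc)
      also have "\<dots> \<le> (2 * pi) ^ Suc k / 1"
        by (intro divide_left_mono) (auto simp del: power_Suc fact_Suc simp: fact_ge_1)
      also have "\<dots> \<le> 8 ^ Suc k" unfolding div_by_1 using pi_less_4 by (intro power_mono) auto
      finally have ck: "norm (c k) ^ 3 \<le> (8 ^ Suc k) ^ 3" by (intro power_mono) auto
      have "4 ^ Suc k * ball_energy \<rho> (\<lambda>x. c k * T k x) = 4 ^ Suc k * (norm (c k) ^ 3 * ball_energy \<rho> (T k))"
        by (simp add: ball_energy_cmult)
      also have "\<dots> \<le> 4 ^ Suc k * ((8 ^ Suc k) ^ 3 * (((12 * (1/1000)) ^ Suc k) ^ 3 * Q))"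
        by (intro mult_left_mono mult_mono ck Te) auto
      also have "\<dots> = (4 * (8 * (12 * (1/1000))) ^ 3) ^ Suc k * Q"
      proof -
        have comm: "(a ^ m) ^ 3 = (a ^ 3) ^ m" for a :: real and m
          by (metis power_mult mult.commute)
        show ?thesis by (simp only: comm power_mult_distrib mult.assoc)
      qed
      finally show "4 ^ Suc k * ball_energy \<rho> (\<lambda>x. c k * T k x) \<le> (4 * (8 * (12 * (1/1000))) ^ 3) ^ Suc k * Q" .
    qed
    also have "\<dots> = (\<Sum>k<n. (4 * (8 * (12 * (1/1000))) ^ 3) ^ Suc k) * Q" by (simp only: sum_distrib_right)
    also have "\<dots> \<le> 1 / 199 * Q"
      by (intro mult_right_mono sum_power_Suc_le Q0) (auto simp: power3_eq_cube)
    finally show ?thesis .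
  qed
  have EH: "ball_energy \<rho> (extension H) \<le> 4 * ((2 / fact n) ^ 3 * ball_energy \<rho> (\<lambda>_. 1)) + 4 * (1 / 199 * Q)"
  proof -
    have eq: "extension H = (\<lambda>x. r x + (-1) * (\<Sum>k<n. c k * T k x))" by (simp add: r_def fun_eq_iff)
    have cS: "continuous_on UNIV (\<lambda>x. (-1) * (\<Sum>k<n. c k * T k x))" by (intro continuous_intros Tc)
    have "ball_energy \<rho> (extension H) \<le> 4 * ball_energy \<rho> r + 4 * ball_energy \<rho> (\<lambda>x. (-1) * (\<Sum>k<n. c k * T k x))"
      by (subst eq) (rule ball_energy_add_le[OF rc cS])
    also have "ball_energy \<rho> (\<lambda>x. (-1) * (\<Sum>k<n. c k * T k x)) = ball_energy \<rho> (\<lambda>x. \<Sum>k<n. c k * T k x)"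
      unfolding ball_energy_cmult by simp
    finally show ?thesis using rb Tsum by linarith
  qed
  have "extension F x = extension G x + 2 * extension H x" for x
  proof -
    have "extension G x + 2 * extension H x
      = (LINT \<xi>|lebesgue_on unit_square. G \<xi> * e (paraboloid_point \<xi> \<bullet> x) + 2 * (H \<xi> * e (paraboloid_point \<xi> \<bullet> x)))"
      unfolding extension_on_def
      using integrable_extension_integrand[OF ess_bounded_integrable[OF Gb], of x] integrable_extension_integrand[OF Hi, of x]
      by simp
    also have "(\<lambda>\<xi>. G \<xi> * e (paraboloid_point \<xi> \<bullet> x) + 2 * (H \<xi> * e (paraboloid_point \<xi> \<bullet> x))) = (\<lambda>\<xi>. F \<xi> * e (paraboloid_point \<xi> \<bullet> x))"
      by (simp add: H_def fun_eq_iff field_simps)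
    finally show ?thesis by (simp add: extension_on_def)
  qed
  hence eq: "extension F = (\<lambda>x. extension G x + 2 * extension H x)" by (simp add: fun_eq_iff)
  have "ball_energy \<rho> (extension F) \<le> 4 * ball_energy \<rho> (extension G) + 4 * ball_energy \<rho> (\<lambda>x. 2 * extension H x)"
    unfolding eq
    by (intro ball_energy_add_le continuous_on_extension_on ess_bounded_integrable[OF Gb] continuous_intros cE)
  also have "ball_energy \<rho> (\<lambda>x. 2 * extension H x) = 8 * ball_energy \<rho> (extension H)"
    unfolding ball_energy_cmult by simp
  finally have "ball_energy \<rho> (extension F) \<le> 4 * ball_energy \<rho> (extension G) + 32 * ball_energy \<rho> (extension H)" by simp
  moreover have "ball_energy \<rho> (extension G) \<le> X"
    unfolding \<rho>_def by (rule X) (simp add: G_def piecewise_constant_cell_average[OF N F])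
  ultimately have "ball_energy \<rho> (extension F) \<le> 4 * X + 3 / 4 * Q + 128 * ((2 / fact n) ^ 3 * ball_energy \<rho> (\<lambda>_. 1))"
    using EH Q0 by linarith
  thus ?thesis unfolding \<rho>_def .
qed

text \<open>The supremum \<open>Q\<close> over all functions bounded by one is finite for trivial reasons and satisfies
  \<open>Q \<le> 4 X + 3 / 4 Q\<close>, so it can be absorbed.\<close>

lemma energy_le_piecewise_constant:
  assumes N: "N > 0"
    and X: "\<And>G. piecewise_constant N G \<Longrightarrow> ball_energy (real N / 1000) (extension G) \<le> X"
    and F: "ess_bounded 1 F"
  shows "ball_energy (real N / 1000) (extension F) \<le> 16 * X"
proof -
  let ?be = "\<lambda>F. ball_energy (real N / 1000) (extension F)"
  define Q where "Q = Sup (?be ` {F. ess_bounded 1 F})"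
  have bdd: "bdd_above (?be ` {F. ess_bounded 1 F})"
  proof (rule bdd_aboveI2)
    fix F assume "F \<in> {F. ess_bounded 1 F}"
    thus "?be F \<le> 1 ^ 3 * measure lborel (ball (0::real^3) (real N / 1000))"
      by (intro ball_energy_bounded continuous_on_extension_on ess_bounded_integrable norm_extension_le) auto
  qed
  have Q: "?be F \<le> Q" if "ess_bounded 1 F" for F
    unfolding Q_def using that by (intro cSup_upper bdd) auto
  have Q0: "Q \<ge> 0" using Q[OF F] ball_energy_nonneg order_trans by blast
  have step: "?be F' \<le> 4 * X + 3 / 4 * Q" if F': "ess_bounded 1 F'" for F'
  proof (rule LIMSEQ_le_const)
    have "(\<lambda>n. inverse (fact n) :: real) \<longlonglongrightarrow> 0"
      using summable_LIMSEQ_zero[OF summable_exp[of "1::real"]] by simp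
    hence "(\<lambda>n. 2 * inverse (fact n) :: real) \<longlonglongrightarrow> 2 * 0" by (intro tendsto_intros)
    hence f: "(\<lambda>n. 2 / fact n :: real) \<longlonglongrightarrow> 0" by (simp only: divide_real_def mult_zero_right)
    have "(\<lambda>n. 4 * X + 3 / 4 * Q + 128 * ((2 / fact n) ^ 3 * ball_energy (real N / 1000) (\<lambda>_. 1)))
       \<longlonglongrightarrow> 4 * X + 3 / 4 * Q + 128 * (0 ^ 3 * ball_energy (real N / 1000) (\<lambda>_. 1))"
      by (intro tendsto_intros f)
    thus "(\<lambda>n. 4 * X + 3 / 4 * Q + 128 * ((2 / fact n) ^ 3 * ball_energy (real N / 1000) (\<lambda>_. 1))) \<longlonglongrightarrow> 4 * X + 3 / 4 * Q"
      by simp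
    show "\<exists>n0. \<forall>n\<ge>n0. ?be F' \<le> 4 * X + 3 / 4 * Q + 128 * ((2 / fact n) ^ 3 * ball_energy (real N / 1000) (\<lambda>_. 1))"
      using energy_step[OF N X Q Q0 F'] by blast
  qed
  have "Q \<le> 4 * X + 3 / 4 * Q"
    unfolding Q_def by (rule cSup_least) (use F step in \<open>auto simp: Q_def[symmetric]\<close>)
  thus ?thesis using Q[OF F] by simp
qed

section \<open>Choice of the scales and conclusion\<close>

lemma ball_energy_le_weighted:
  assumes F: "integrable (lebesgue_on unit_square) F" and r: "r > 0" and \<rho>: "\<rho> \<le> r"
  shows "ball_energy \<rho> (extension F) \<le> 1024 * (LINT x|lborel. norm (extension F x) ^ 3 * decay r 10 x)"
proof -
  have v: "integrable lborel (\<lambda>x::real^3. decay r 10 x)"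
    using integrable_decay_vec3[of r 10 0] r by simp
  have "ball_energy \<rho> (extension F) \<le> (LINT x|lborel. 1024 * (norm (extension F x) ^ 3 * decay r 10 x))"
    unfolding ball_energy_def set_lebesgue_integral_def
  proof (rule integral_mono)
    show "integrable lborel (\<lambda>x. indicator (ball 0 \<rho>) x *\<^sub>R norm (extension F x) ^ 3)"
      using set_integrable_cube[OF continuous_on_extension_on[OF F]] by (simp add: set_integrable_def)
    show "integrable lborel (\<lambda>x. 1024 * (norm (extension F x) ^ 3 * decay r 10 x))"
      by (intro integrable_mult_right integrable_extension_cube F v)
    fix x :: "real^3"
    have "1 \<le> 1024 * decay r 10 x" if "norm x < \<rho>"
    proof -
      have "norm x / r \<le> 1" using that r \<rho> by simp
      hence "(2::real) powr (- 10) \<le> decay r 10 x"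
        unfolding decay_def using r by (intro powr_mono2') (auto simp: add_pos_nonneg)
      thus ?thesis by (simp add: powr_minus_divide)
    qed
    thus "indicator (ball 0 \<rho>) x *\<^sub>R norm (extension F x) ^ 3 \<le> 1024 * (norm (extension F x) ^ 3 * decay r 10 x)"
      using mult_left_mono[of 1 "1024 * decay r 10 x" "norm (extension F x) ^ 3"]
      by (auto simp: indicator_def mult_ac)
  qed
  thus ?thesis by simp
qed

text \<open>Powers of two satisfy all divisibility conditions, and rounding the exponent down costs a
  factor of at most two.\<close>

lemma admissible_dyadic:
  assumes \<gamma>: "0 < \<gamma>" "\<gamma> < 1"
  obtains m where "m \<le> 2 * n" "admissible \<gamma> (4 ^ n) (2 ^ m)" "real (2 ^ m) \<le> real (4 ^ n) powr (1 - \<gamma>)"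
proof
  define t where "t = real (2 * n) * (1 - \<gamma>)"
  define m where "m = nat \<lfloor>t\<rfloor>"
  have t0: "t \<ge> 0" using \<gamma> by (simp add: t_def)
  have mt: "real m \<le> t" "t < real m + 1" using t0 unfolding m_def by linarith+
  have "t \<le> real (2 * n) * 1" unfolding t_def using \<gamma> by (intro mult_left_mono) auto
  thus m2n: "m \<le> 2 * n" using mt by linarith
  have R: "real (4 ^ n) powr (1 - \<gamma>) = 2 powr t"
  proof -
    have "real (4 ^ n) = 2 powr real (2 * n)" by (simp add: powr_realpow power_mult del: of_nat_mult)
    thus ?thesis by (simp add: powr_powr t_def)
  qed
  have M: "real (2 ^ m) = 2 powr real m" by (simp add: powr_realpow)
  show up: "real (2 ^ m) \<le> real (4 ^ n) powr (1 - \<gamma>)" unfolding R M using mt by simp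
  have "2 powr t \<le> 2 powr (real m + 1)" using mt by simp
  hence low: "1 / 2 * real (4 ^ n) powr (1 - \<gamma>) \<le> real (2 ^ m)" unfolding R M by (simp add: powr_add)
  have "sqrt (real (4 ^ n)) = real (2 ^ n)"
  proof -
    have "real (4 ^ n) = (real (2 ^ n))\<^sup>2" by (simp add: power2_eq_square flip: power_mult_distrib)
    thus ?thesis by (simp only: real_sqrt_abs abs_of_nat)
  qed
  hence "sqrt (real (4 ^ n)) \<in> \<nat>" by (simp only: of_nat_in_Nats)
  moreover have "(2::nat) ^ m dvd 4 ^ n"
    using le_imp_power_dvd[OF m2n, of "2::nat"] by (simp add: power_mult)
  ultimately show "admissible \<gamma> (4 ^ n) (2 ^ m)"
    using \<gamma> low up by (auto simp: admissible_def)
qed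

text \<open>Here \<open>u\<close> stands for \<open>R\<close> to the power \<open>\<gamma>\<close>, comparable with \<open>K\<close>, and \<open>sqrt u\<close> for the factor
  \<open>R\<close> to the power \<open>\<gamma> / 2\<close> in the assumed inequality. The recurring integral has coefficient at
  most \<open>8192 C / K\<close>, which is at most one half by the choice of \<open>u\<close>.\<close>

lemma weighted_energy_bound:
  assumes N: "N \<ge> 2" and K: "K > 0" and M: "M > 0" and NKM: "N\<^sup>2 = K * M"
    and G: "piecewise_constant N G" and C: "C \<ge> 0" and u: "u \<ge> 1" "u \<le> real K" "real K \<le> 2 * u" "16384 * C \<le> u"
    and hyp: "\<And>c P. M_set_partition (N\<^sup>2) M P \<Longrightarrow>
       Lp_norm 3 (indicator (ball c ((real N)\<^sup>2))) (extension G) ^ 3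
         \<le> C * sqrt u * sqrt (real K) * (\<Sum>j=1..K. Lp_norm 3 (ball_weight c ((real N)\<^sup>2)) (extension_on (\<Union>(P j)) G) ^ 3)"
  shows "(LINT x|lborel. norm (extension G x) ^ 3 * decay ((real N)\<^sup>2) 10 x) \<le> 1310720 * 64000 * pi * C * u\<^sup>2 * ln (real N)"
proof -
  define A W where "A = (LINT x|lborel. norm (extension G x) ^ 3 * decay ((real N)\<^sup>2) 10 x)"
    and "W = (LINT x|lborel. square_function N G x ^ 3 * decay ((real N)\<^sup>2) 10 x)"
  define B where "B = C * sqrt u * sqrt (real K)"
  have N0: "N > 0" using N by simp
  have Gi: "integrable (lebesgue_on unit_square) G" using G by (simp add: piecewise_constant_def)
  have k: "real K \<ge> 1" using u by linarith
  have A0: "A \<ge> 0" and W0: "W \<ge> 0"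
    unfolding A_def W_def by (auto intro!: Bochner_Integration.integral_nonneg)
  have B0: "B \<ge> 0" using C u by (simp add: B_def)
  have "sqrt u * sqrt (real K) \<le> sqrt (real K) * sqrt (real K)"
    using u by (intro mult_right_mono) auto
  hence BK: "B \<le> C * real K"
    using C by (auto simp: B_def mult.assoc intro!: mult_left_mono)
  have "A \<le> 2048 * (B * real K * (4 / real K ^ 3 * A + 80 * W))"
    unfolding A_def W_def
    by (rule weighted_inequality[OF N0 K M NKM Gi B0]) (use N0 hyp in \<open>auto simp: B_def\<close>)
  also have "\<dots> \<le> 2048 * (C * real K * real K * (4 / real K ^ 3 * A + 80 * W))"
    using A0 W0 BK by (intro mult_left_mono mult_right_mono) auto
  also have "\<dots> = 8192 * C / real K * A + 163840 * C * (real K)\<^sup>2 * W"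
    using k by (simp add: field_simps power2_eq_square power3_eq_cube)
  also have "\<dots> \<le> 1 / 2 * A + 655360 * C * u\<^sup>2 * W"
  proof (rule add_mono)
    have "8192 * C / real K \<le> 1 / 2" using u k by (simp add: divide_le_eq)
    thus "8192 * C / real K * A \<le> 1 / 2 * A" using A0 by (rule mult_right_mono)
    have "(real K)\<^sup>2 \<le> (2 * u)\<^sup>2" using u by (intro power_mono) auto
    hence "163840 * C * (real K)\<^sup>2 \<le> 163840 * C * (2 * u)\<^sup>2" using C by (intro mult_left_mono) auto
    also have "\<dots> = 655360 * C * u\<^sup>2" by (simp add: power2_eq_square)
    finally show "163840 * C * (real K)\<^sup>2 * W \<le> 655360 * C * u\<^sup>2 * W" using W0 by (rule mult_right_mono)
  qed
  finally have "A \<le> 1310720 * C * u\<^sup>2 * W" by simp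
  also have "\<dots> \<le> 1310720 * C * u\<^sup>2 * (64000 * pi * ln (real N))"
    using square_function_integral_le[OF N G] C by (intro mult_left_mono) (auto simp: W_def)
  finally show ?thesis by (simp add: A_def mult_ac)
qed

text \<open>The powers of \<open>K\<close> that were lost amount to \<open>u\<^sup>2\<close>, and the logarithm is at most \<open>u / \<gamma>\<close>, which
  together gives \<open>u ^ 3\<close>.\<close>

lemma dyadic_energy_bound:
  fixes C \<gamma> :: real
  assumes \<gamma>: "0 < \<gamma>" "\<gamma> < 1" and C: "C \<ge> 0"
    and hyp: "\<And>R M c F P. admissible \<gamma> R M \<Longrightarrow> integrable (lebesgue_on unit_square) F \<Longrightarrow> M_set_partition R M P \<Longrightarrow>
        Lp_norm 3 (indicator (ball c (real R))) (extension F) ^ 3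
          \<le> C * real R powr (\<gamma> / 2) * (real R / real M) powr (1 / 2) *
            (\<Sum>j = 1..R div M. Lp_norm 3 (ball_weight c (real R)) (extension_on (\<Union>(P j)) F) ^ 3)"
  obtains D n0 where "D \<ge> 0"
    "\<And>n F. n \<ge> n0 \<Longrightarrow> ess_bounded 1 F \<Longrightarrow>
       ball_energy (real (2 ^ n) / 1000) (extension F) \<le> D * real (4 ^ n) powr (3 * \<gamma>)"
proof -
  define D where "D = 16 * (1024 * (1310720 * 64000 * pi * C / \<gamma>))"
  have D0: "D \<ge> 0" using C \<gamma> by (simp add: D_def)
  obtain n1 where n1: "16384 * C < (4 powr \<gamma>) ^ n1"
    using real_arch_pow[of "4 powr \<gamma>" "16384 * C"] \<gamma> by auto
  define n0 where "n0 = max 1 n1"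
  have "ball_energy (real (2 ^ n) / 1000) (extension F) \<le> D * real (4 ^ n) powr (3 * \<gamma>)"
    if n: "n \<ge> n0" and F: "ess_bounded 1 F" for n F
  proof -
    obtain m where m: "m \<le> 2 * n" "admissible \<gamma> (4 ^ n) (2 ^ m)" "real (2 ^ m) \<le> real (4 ^ n) powr (1 - \<gamma>)"
      by (rule admissible_dyadic[OF \<gamma>])
    define N M K :: nat where "N = 2 ^ n" and "M = 2 ^ m" and "K = 2 ^ (2 * n - m)"
    define R where "R = real (4 ^ n)"
    define u where "u = R powr \<gamma>"
    have R1: "R \<ge> 1" by (simp add: R_def)
    have N2: "N \<ge> 2" using n power_increasing[of 1 n "2::nat"] by (simp add: N_def n0_def)
    have N0: "N > 0" and K0: "K > 0" and M0: "M > 0" by (simp_all add: N_def K_def M_def)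
    have NN: "N\<^sup>2 = 4 ^ n" by (simp add: N_def power2_eq_square flip: power_mult_distrib)
    have NKM: "N\<^sup>2 = K * M"
    proof -
      have "K * M = 2 ^ (2 * n)" using m(1) by (simp add: K_def M_def flip: power_add)
      thus ?thesis by (simp add: NN power_mult)
    qed
    have NR: "(real N)\<^sup>2 = R" unfolding R_def NN[symmetric] by simp
    have KM: "real K * real M = R" using NKM NN by (simp add: R_def flip: of_nat_mult)
    have RM: "R / real M = real K" using M0 by (simp add: KM[symmetric])
    have div: "4 ^ n div M = K" using NKM NN M0 by simp
    have split: "R = u * R powr (1 - \<gamma>)" using R1 by (simp add: u_def flip: powr_add)
    have pos: "R powr (1 - \<gamma>) > 0" using R1 by simp
    have u1: "u \<ge> 1" using R1 \<gamma> by (simp add: u_def ge_one_powr_ge_zero)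
    have uK: "u \<le> real K"
    proof -
      have "u * real M \<le> u * R powr (1 - \<gamma>)"
        using m(3) u1 by (intro mult_left_mono) (auto simp: M_def R_def)
      hence "u * real M \<le> real K * real M" using split KM by simp
      thus ?thesis using M0 by simp
    qed
    have Ku: "real K \<le> 2 * u"
    proof -
      have "R powr (1 - \<gamma>) \<le> 2 * real M" using m(2) by (simp add: admissible_def R_def M_def)
      hence "real K * R powr (1 - \<gamma>) \<le> real K * (2 * real M)" by (intro mult_left_mono) auto
      also have "\<dots> = 2 * u * R powr (1 - \<gamma>)" using KM split by simp
      finally show ?thesis using pos by simp
    qed
    have uC: "16384 * C \<le> u"
    proof -
      have "u = (4 powr \<gamma>) ^ n" by (simp add: u_def R_def powr_power powr_powr mult.commute flip: powr_realpow)
      moreover have "(4 powr \<gamma>) ^ n1 \<le> (4 powr \<gamma>) ^ n"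
        using n \<gamma> by (intro power_increasing) (auto simp: n0_def ge_one_powr_ge_zero)
      ultimately show ?thesis using n1 by simp
    qed
    have su: "R powr (\<gamma> / 2) = sqrt u" by (simp add: u_def powr_half_sqrt[symmetric] powr_powr)
    have lnN: "ln (real N) \<le> u / \<gamma>"
    proof -
      have "ln (real N) \<le> ln ((real N)\<^sup>2)" using N0 by (simp add: ln_realpow)
      also have "\<dots> = ln u / \<gamma>" using NR R1 \<gamma> by (simp add: u_def ln_powr)
      also have "\<dots> \<le> u / \<gamma>" using u1 \<gamma> ln_le_minus_one[of u] by (intro divide_right_mono) auto
      finally show ?thesis .
    qed
    have X: "ball_energy (real N / 1000) (extension G) \<le> 1024 * (1310720 * 64000 * pi * C / \<gamma> * u ^ 3)"
      if G: "piecewise_constant N G" for G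
    proof -
      have Gi: "integrable (lebesgue_on unit_square) G" using G by (simp add: piecewise_constant_def)
      have h: "Lp_norm 3 (indicator (ball c ((real N)\<^sup>2))) (extension G) ^ 3
         \<le> C * sqrt u * sqrt (real K) * (\<Sum>j=1..K. Lp_norm 3 (ball_weight c ((real N)\<^sup>2)) (extension_on (\<Union>(P j)) G) ^ 3)"
        if "M_set_partition (N\<^sup>2) M P" for c P
        using hyp[of "4 ^ n" M G P c] m(2) Gi that
        unfolding R_def[symmetric] RM su div NR NN M_def[symmetric]
        by (simp add: powr_half_sqrt)
      have "ball_energy (real N / 1000) (extension G) \<le> 1024 * (LINT x|lborel. norm (extension G x) ^ 3 * decay ((real N)\<^sup>2) 10 x)"
      proof (rule ball_energy_le_weighted[OF Gi])
        have "real N * 1 \<le> real N * real N" using N2 by (intro mult_left_mono) auto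
        thus "real N / 1000 \<le> (real N)\<^sup>2" by (simp add: power2_eq_square)
      qed (use N0 in simp)
      also have "\<dots> \<le> 1024 * (1310720 * 64000 * pi * C * u\<^sup>2 * ln (real N))"
        by (intro mult_left_mono weighted_energy_bound[OF N2 K0 M0 NKM G C u1 uK Ku uC h]) auto
      also have "\<dots> \<le> 1024 * (1310720 * 64000 * pi * C * u\<^sup>2 * (u / \<gamma>))"
        using C lnN by (intro mult_left_mono) auto
      also have "\<dots> = 1024 * (1310720 * 64000 * pi * C / \<gamma> * u ^ 3)" by (simp add: power2_eq_square power3_eq_cube)
      finally show ?thesis .
    qed
    have "ball_energy (real N / 1000) (extension F) \<le> 16 * (1024 * (1310720 * 64000 * pi * C / \<gamma> * u ^ 3))"
      by (rule energy_le_piecewise_constant[OF N0 X F])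
    also have "\<dots> = D * u ^ 3" by (simp add: D_def)
    also have "u ^ 3 = R powr (3 * \<gamma>)" using R1 by (simp add: u_def powr_power mult.commute)
    finally show ?thesis by (simp add: N_def R_def)
  qed
  thus thesis using that[OF D0] by blast
qed

lemma Linf_norm_bound:
  assumes F: "F \<in> borel_measurable (lebesgue_on unit_square)" and b: "bounded (F ` unit_square)"
  shows "AE \<xi> in lebesgue_on unit_square. norm (F \<xi>) \<le> Linf_norm F" and "Linf_norm F \<ge> 0"
proof -
  define s where "s = esssup (lebesgue_on unit_square) (\<lambda>\<xi>. ereal (norm (F \<xi>)))"
  have m: "(\<lambda>\<xi>. ereal (norm (F \<xi>))) \<in> borel_measurable (lebesgue_on unit_square)" using F by simp
  obtain B where B: "\<And>\<xi>. \<xi> \<in> unit_square \<Longrightarrow> norm (F \<xi>) \<le> B" using b by (auto simp: bounded_iff)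
  have "AE \<xi> in lebesgue_on unit_square. ereal (norm (F \<xi>)) \<le> ereal B"
    by (rule AE_I2) (simp add: space_restrict_space B)
  hence up: "s \<le> ereal B" unfolding s_def by (rule esssup_I[OF m])
  have AE: "AE \<xi> in lebesgue_on unit_square. ereal (norm (F \<xi>)) \<le> s" unfolding s_def by (rule esssup_AE)
  have low: "0 \<le> s"
  proof (rule ccontr)
    assume "\<not> 0 \<le> s"
    have "AE \<xi> in lebesgue_on unit_square. False"
      using AE
    proof eventually_elim
      case (elim \<xi>)
      have "(0::ereal) \<le> ereal (norm (F \<xi>))" by simp
      with elim \<open>\<not> 0 \<le> s\<close> show ?case by (meson order_trans)
    qed
    hence "emeasure (lebesgue_on unit_square) (space (lebesgue_on unit_square)) = 0"
      by (simp add: AE_iff_measurable[OF _ refl])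
    moreover have "emeasure (lebesgue_on unit_square) (space (lebesgue_on unit_square)) = 1"
      using unit_square_lmeasurable measure_unit_square
      by (simp add: space_restrict_space emeasure_restrict_space emeasure_eq_measure2)
    ultimately show False by simp
  qed
  obtain L where L: "s = ereal L" using up low by (cases s) auto
  have Ls: "Linf_norm F = L" by (simp add: Linf_norm_def s_def[symmetric] L)
  show "AE \<xi> in lebesgue_on unit_square. norm (F \<xi>) \<le> Linf_norm F" using AE by (simp add: L Ls)
  show "Linf_norm F \<ge> 0" using low by (simp add: L Ls)
qed

lemma ball_energy_mono:
  assumes "continuous_on UNIV f" "\<rho> \<le> \<rho>'"
  shows "ball_energy \<rho> f \<le> ball_energy \<rho>' f"
  unfolding ball_energy_def set_lebesgue_integral_def
  using set_integrable_cube[OF assms(1), of 0] assms(2)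
  by (intro integral_mono) (auto simp: set_integrable_def indicator_def)

text \<open>Translating the ball to the origin multiplies \<open>F\<close> by a unimodular function.\<close>

lemma translated_energy:
  assumes F: "F \<in> borel_measurable (lebesgue_on unit_square)" and b: "bounded (F ` unit_square)"
    and bd: "\<And>F'. ess_bounded 1 F' \<Longrightarrow> ball_energy \<rho> (extension F') \<le> Y"
  shows "(LINT x:ball c \<rho>|lebesgue. norm (extension F x) ^ 3) \<le> Y * Linf_norm F ^ 3"
proof -
  define L where "L = Linf_norm F"
  have L0: "L \<ge> 0" and AE: "AE \<xi> in lebesgue_on unit_square. norm (F \<xi>) \<le> L"
    using Linf_norm_bound[OF F b] by (auto simp: L_def)
  have FL: "ess_bounded L F" using F AE by (simp add: ess_bounded_def)
  have cF: "continuous_on UNIV (extension F)"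
    by (rule continuous_on_extension_on[OF ess_bounded_integrable[OF FL]])
  \<comment> \<open>If \<open>L = 0\<close>, division by zero makes this function vanish, which is the right value.\<close>
  define F' where "F' \<xi> = F \<xi> * (e (paraboloid_point \<xi> \<bullet> c) / of_real L)" for \<xi>
  have m: "(\<lambda>\<xi>. e (paraboloid_point \<xi> \<bullet> c) / of_real L) \<in> borel_measurable (lebesgue_on unit_square)"
    unfolding divide_inverse
    by (intro borel_measurable_lebesgue_on borel_measurable_continuous_onI continuous_on_mult continuous_on_const
        continuous_on_e continuous_on_paraboloid_inner continuous_on_id)
  have F'1: "ess_bounded 1 F'"
  proof -
    have "ess_bounded (L * (1 / L)) F'"
      unfolding F'_def by (rule ess_bounded_mult[OF FL m _ L0]) (use L0 in \<open>simp add: norm_divide\<close>)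
    thus ?thesis by (cases "L = 0") (auto simp: ess_bounded_def elim: eventually_mono)
  qed
  have shift: "extension F (c + x) = of_real L * extension F' x" for x
  proof (cases "L = 0")
    case True
    thus ?thesis using norm_extension_le[OF FL, of "c + x"] by simp
  next
    case False
    have "of_real L * extension F' x = (LINT \<xi>|lebesgue_on unit_square. of_real L * (F' \<xi> * e (paraboloid_point \<xi> \<bullet> x)))"
      unfolding extension_on_def by simp
    also have "\<dots> = extension F (c + x)"
      unfolding extension_on_def using False by (simp add: F'_def inner_add_right e_add mult_ac)
    finally show ?thesis by simp
  qed
  have "(LINT x:ball c \<rho>|lebesgue. norm (extension F x) ^ 3) = (LINT x|lborel. indicator (ball c \<rho>) x *\<^sub>R norm (extension F x) ^ 3)"
    unfolding set_lebesgue_integral_def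
    using set_integrable_cube[OF cF, of c \<rho>] by (intro integral_completion) (auto simp: set_integrable_def)
  also have "\<dots> = (LINT x|distr lborel borel ((+) c). indicator (ball c \<rho>) x *\<^sub>R norm (extension F x) ^ 3)"
    by (simp only: lborel_distr_plus)
  also have "\<dots> = (LINT x|lborel. indicator (ball c \<rho>) (c + x) *\<^sub>R norm (extension F (c + x)) ^ 3)"
    using set_integrable_cube[OF cF, of c \<rho>]
    by (intro integral_distr) (auto simp: set_integrable_def)
  also have "\<dots> = (LINT x|lborel. indicator (ball 0 \<rho>) x *\<^sub>R norm (of_real L * extension F' x) ^ 3)"
    unfolding shift by (intro Bochner_Integration.integral_cong) (auto simp: indicator_def dist_norm)
  also have "\<dots> = L ^ 3 * ball_energy \<rho> (extension F')"
    using ball_energy_cmult[of \<rho> "of_real L" "extension F'"] L0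
    by (simp add: ball_energy_def set_lebesgue_integral_def)
  also have "\<dots> \<le> L ^ 3 * Y" using bd[OF F'1] L0 by (intro mult_left_mono) auto
  finally show ?thesis by (simp add: L_def mult.commute)
qed

theorem corollary2p2:
  assumes "\<exists>\<gamma>\<^sub>0>0. \<forall>\<gamma>::real. 0 < \<gamma> \<and> \<gamma> < \<gamma>\<^sub>0 \<longrightarrow> (\<forall>\<epsilon>::real. \<epsilon> > 0 \<longrightarrow>
      (\<exists>C::real. \<forall>(R::nat) (M::nat) (c::real ^ 3) (F::real ^ 2 \<Rightarrow> complex)
          (P::nat \<Rightarrow> (real ^ 2) set set).
        admissible \<gamma> R M \<longrightarrow> integrable (lebesgue_on unit_square) F \<longrightarrow> M_set_partition R M P \<longrightarrow>
        Lp_norm 3 (indicator (ball c (real R))) (extension F) ^ 3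
          \<le> C * real R powr \<epsilon> * (real R / real M) powr (1 / 2) *
            (\<Sum>j = 1..R div M. Lp_norm 3 (ball_weight c (real R)) (extension_on (\<Union>(P j)) F) ^ 3)))"
  shows "\<forall>\<epsilon>::real. \<epsilon> > 0 \<longrightarrow>
      (\<exists>C'::real. \<forall>(R::real) (c::real ^ 3) (F::real ^ 2 \<Rightarrow> complex).
        R \<ge> 1 \<longrightarrow> F \<in> borel_measurable (lebesgue_on unit_square) \<longrightarrow> bounded (F ` unit_square) \<longrightarrow>
        (LINT x:ball c (sqrt R)|lebesgue. norm (extension F x) ^ 3)
          \<le> C' * R powr \<epsilon> * Linf_norm F ^ 3)"
proof (intro allI impI)
  fix \<epsilon> :: real assume \<epsilon>: "\<epsilon> > 0"
  from assms obtain \<gamma>\<^sub>0 :: real where \<gamma>0: "\<gamma>\<^sub>0 > 0"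
    and hyp: "\<And>\<gamma> \<epsilon>. 0 < \<gamma> \<Longrightarrow> \<gamma> < \<gamma>\<^sub>0 \<Longrightarrow> \<epsilon> > 0 \<Longrightarrow> \<exists>C. \<forall>R M c F P.
        admissible \<gamma> R M \<longrightarrow> integrable (lebesgue_on unit_square) F \<longrightarrow> M_set_partition R M P \<longrightarrow>
        Lp_norm 3 (indicator (ball c (real R))) (extension F) ^ 3
          \<le> C * real R powr \<epsilon> * (real R / real M) powr (1 / 2) *
            (\<Sum>j = 1..R div M. Lp_norm 3 (ball_weight c (real R)) (extension_on (\<Union>(P j)) F) ^ 3)"
    by metis
  \<comment> \<open>The total loss is \<open>R\<close> to the power \<open>3 \<gamma>\<close>; this is why arbitrarily small \<open>\<gamma>\<close> are needed.\<close>
  define \<gamma> where "\<gamma> = min (\<gamma>\<^sub>0 / 2) (min (\<epsilon> / 3) (1 / 2))"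
  have \<gamma>: "0 < \<gamma>" "\<gamma> < 1" "\<gamma> < \<gamma>\<^sub>0" "3 * \<gamma> \<le> \<epsilon>" using \<gamma>0 \<epsilon> by (auto simp: \<gamma>_def min_def)
  obtain C where C: "\<And>R M c F P. admissible \<gamma> R M \<Longrightarrow> integrable (lebesgue_on unit_square) F \<Longrightarrow> M_set_partition R M P \<Longrightarrow>
        Lp_norm 3 (indicator (ball c (real R))) (extension F) ^ 3
          \<le> C * real R powr (\<gamma> / 2) * (real R / real M) powr (1 / 2) *
            (\<Sum>j = 1..R div M. Lp_norm 3 (ball_weight c (real R)) (extension_on (\<Union>(P j)) F) ^ 3)"
    using hyp[OF \<gamma>(1,3) half_gt_zero[OF \<gamma>(1)]] by blast
  have C': "Lp_norm 3 (indicator (ball c (real R))) (extension F) ^ 3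
          \<le> max C 0 * real R powr (\<gamma> / 2) * (real R / real M) powr (1 / 2) *
            (\<Sum>j = 1..R div M. Lp_norm 3 (ball_weight c (real R)) (extension_on (\<Union>(P j)) F) ^ 3)"
    if "admissible \<gamma> R M" "integrable (lebesgue_on unit_square) F" "M_set_partition R M P" for R M c F P
  proof -
    have "(\<Sum>j = 1..R div M. Lp_norm 3 (ball_weight c (real R)) (extension_on (\<Union>(P j)) F) ^ 3) \<ge> 0"
      by (intro sum_nonneg) (simp add: Lp_norm_def)
    thus ?thesis by (intro order_trans[OF C[OF that, of c]] mult_right_mono) auto
  qed
  obtain D n0 where D: "D \<ge> 0" "\<And>n F. n \<ge> n0 \<Longrightarrow> ess_bounded 1 F \<Longrightarrow>
       ball_energy (real (2 ^ n) / 1000) (extension F) \<le> D * real (4 ^ n) powr (3 * \<gamma>)"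
    using dyadic_energy_bound[OF \<gamma>(1,2) max.cobounded2 C'] by blast
  define E where "E = 4 ^ n0 * (4000000::real)"
  show "\<exists>C'::real. \<forall>(R::real) (c::real ^ 3) (F::real ^ 2 \<Rightarrow> complex).
        R \<ge> 1 \<longrightarrow> F \<in> borel_measurable (lebesgue_on unit_square) \<longrightarrow> bounded (F ` unit_square) \<longrightarrow>
        (LINT x:ball c (sqrt R)|lebesgue. norm (extension F x) ^ 3)
          \<le> C' * R powr \<epsilon> * Linf_norm F ^ 3"
  proof (rule exI[of _ "D * E powr (3 * \<gamma>)"], intro allI impI)
    fix R :: real and c :: "real^3" and F :: "real^2 \<Rightarrow> complex"
    assume R: "R \<ge> 1" and F: "F \<in> borel_measurable (lebesgue_on unit_square)" "bounded (F ` unit_square)"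
    \<comment> \<open>Any ball of radius \<open>sqrt R\<close> is enlarged to the radius \<open>2 ^ n / 1000\<close> of a dyadic scale, which costs a constant.\<close>
    obtain k where k: "1000 * sqrt R \<le> 2 ^ k" "(2::real) ^ k \<le> 2000 * sqrt R"
    proof -
      define k where "k = nat \<lceil>log 2 (1000 * sqrt R)\<rceil>"
      have s: "sqrt R \<ge> 1" using R by simp
      have l1: "1000 * sqrt R \<ge> 1" using s by linarith
      have l0: "log 2 (1000 * sqrt R) \<ge> 0" using l1 by (subst zero_le_log_cancel_iff) linarith+
      have k1: "log 2 (1000 * sqrt R) \<le> real k" "real k \<le> log 2 (1000 * sqrt R) + 1"
        using l0 unfolding k_def by linarith+
      have "2 powr log 2 (1000 * sqrt R) = 1000 * sqrt R" using s by (intro powr_log_cancel) auto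
      moreover have "2 powr log 2 (1000 * sqrt R) \<le> 2 powr real k"
        "2 powr real k \<le> 2 powr (log 2 (1000 * sqrt R) + 1)" using k1 by auto
      ultimately have "1000 * sqrt R \<le> 2 powr real k" "2 powr real k \<le> 2000 * sqrt R" by (auto simp: powr_add)
      thus thesis using that[of k] by (simp add: powr_realpow)
    qed
    define n where "n = n0 + k"
    have rho: "sqrt R \<le> real (2 ^ n) / 1000"
    proof -
      have "(2::real) ^ k \<le> 2 ^ n" by (simp add: n_def)
      with k(1) have "1000 * sqrt R \<le> 2 ^ n" by (rule order_trans)
      thus ?thesis by simp
    qed
    have size: "real (4 ^ n) \<le> E * R"
    proof -
      have "(4::real) ^ k = (2 ^ k)\<^sup>2" by (simp add: power2_eq_square flip: power_mult_distrib)
      also have "\<dots> \<le> (2000 * sqrt R)\<^sup>2" using k(2) by (intro power_mono) auto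
      also have "\<dots> = 4000000 * R" using R by (simp add: power_mult_distrib)
      finally have "4 ^ n0 * (4::real) ^ k \<le> 4 ^ n0 * (4000000 * R)" by (intro mult_left_mono) auto
      thus ?thesis by (simp add: n_def E_def power_add)
    qed
    have "(LINT x:ball c (sqrt R)|lebesgue. norm (extension F x) ^ 3) \<le> (D * real (4 ^ n) powr (3 * \<gamma>)) * Linf_norm F ^ 3"
    proof (rule translated_energy[OF F])
      fix F' assume F': "ess_bounded 1 F'"
      have "ball_energy (sqrt R) (extension F') \<le> ball_energy (real (2 ^ n) / 1000) (extension F')"
        by (intro ball_energy_mono continuous_on_extension_on ess_bounded_integrable[OF F'] rho)
      also have "\<dots> \<le> D * real (4 ^ n) powr (3 * \<gamma>)" by (intro D(2) F') (simp add: n_def)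
      finally show "ball_energy (sqrt R) (extension F') \<le> D * real (4 ^ n) powr (3 * \<gamma>)" .
    qed
    also have "\<dots> \<le> (D * E powr (3 * \<gamma>) * R powr \<epsilon>) * Linf_norm F ^ 3"
    proof (rule mult_right_mono)
      have "real (4 ^ n) powr (3 * \<gamma>) \<le> (E * R) powr (3 * \<gamma>)" using size \<gamma> by (intro powr_mono2) auto
      also have "\<dots> = E powr (3 * \<gamma>) * R powr (3 * \<gamma>)" by (rule powr_mult)
      also have "\<dots> \<le> E powr (3 * \<gamma>) * R powr \<epsilon>" using \<gamma> R by (intro mult_left_mono powr_mono) auto
      finally have "D * real (4 ^ n) powr (3 * \<gamma>) \<le> D * (E powr (3 * \<gamma>) * R powr \<epsilon>)" using D(1) by (rule mult_left_mono)
      thus "D * real (4 ^ n) powr (3 * \<gamma>) \<le> D * E powr (3 * \<gamma>) * R powr \<epsilon>" by (simp add: mult.assoc)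
    qed (use Linf_norm_bound(2)[OF F] in simp)
    finally show "(LINT x:ball c (sqrt R)|lebesgue. norm (extension F x) ^ 3) \<le> D * E powr (3 * \<gamma>) * R powr \<epsilon> * Linf_norm F ^ 3" .
  qed
qed

end
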